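(* Let $M$ be a real hypersurface in a non-flat complex space form $M_2(c)$ (that is, in $\mathbb{C}P^2$ with $c=4$ or in $\mathbb{C}H^2$ with $c=-4$) whose $^{*}$-Ricci tensor is $\xi$-parallel. Then $M$ is a Hopf hypersurface. Moreover, $M$ is locally congruent to one of the following: (i) a real hypersurface of type $(A)$; or (ii) a Hopf hypersurface with $A\xi=0$; or (iii) a Hopf hypersurface whose principal curvatures corresponding to the holomorphic distribution are constant in the direction of $\xi$.
   Context: $M_2(c)$ denotes a non-flat complex space form of complex dimension $2$: the complex projective plane $\mathbb{C}P^2$ of constant holomorphic sectional curvature $c=4$, or the complex hyperbolic plane $\mathbb{C}H^2$ of constant holomorphic sectional curvature $c=-4$, with complex structure $J$ and Kähler metric $G$. A real hypersurface $M$ is a connected immersed submanifold of real codimension one, without boundary; everything is of class $C^\infty$. Let $N$ be a local unit normal field, $g$ the induced metric with Levi-Civita connection $\nabla$, $\xi=-JN$ the structure vector field, $\eta(X)=g(X,\xi)$, and $\varphi$ the structure tensor defined by $JX=\varphi X+\eta(X)N$ for $X$ tangent to $M$. The shape operator $A$ is given by $\overline{\nabla}_XN=-AX$, where $\overline\nabla$ is the Levi-Civita connection of $M_2(c)$. $M$ is a Hopf hypersurface if $\xi$ is an eigenvector of $A$ at every point, $A\xi=\alpha\xi$ with $\alpha=g(A\xi,\xi)$. The holomorphic distribution is $\mathbb{D}=\ker\eta$. On a Hopf hypersurface $\mathbb{D}$ is $A$-invariant, and in the three-dimensional case there is at each point a local orthonormal basis $\{W,\varphi W,\xi\}$ with $AW=\lambda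 W$, $A\varphi W=\nu\varphi W$; $\lambda,\nu$ are the principal curvatures corresponding to the holomorphic distribution, and they are constant in the direction of $\xi$ if $\xi\lambda=\xi\nu=0$. $R$ denotes the Riemannian curvature tensor of $M$, with sign convention such that the Gauss equation reads $$R(X,Y)Z=\tfrac{c}{4}[g(Y,Z)X-g(X,Z)Y+g(\varphi Y,Z)\varphi X-g(\varphi X,Z)\varphi Y-2g(\varphi X,Y)\varphi Z]+g(AY,Z)AX-g(AX,Z)AY.$$ The $^{*}$-Ricci tensor is $S^{*}(X,Y)=\frac12\,\mathrm{trace}(Z\mapsto R(X,\varphi Y)\varphi Z)$ for tangent $X,Y$; regarded as a $(1,1)$-tensor via $g(S^{*}X,Y)=S^{*}(X,Y)$, it is given in $M_2(c)$ by $S^{*}X=-[c\varphi^2X+(\varphi A)^2X]$. $S^{*}$ is called $\xi$-parallel if $(\nabla_{\xi}S^{*})X=0$, i.e. $\nabla_\xi(S^{*}X)=S^{*}(\nabla_\xi X)$, for every tangent vector field $X$ on $M$. Real hypersurfaces of type $(A)$ in $M_2(c)$: in $\mathbb{C}P^2$, geodesic hyperspheres of radius $r$, $0<r<\frac{\pi}{2}$; in $\mathbb{C}H^2$, horospheres, geodesic hyperspheres, and tubes over a totally geodesic complex hyperbolic hyperplane $\mathbb{C}H^1$. *)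

theory Defs
  imports "HOL-Analysis.Analysis"
begin

section \<open>Smooth maps and smooth manifolds\<close>

text \<open>\<open>C_diff k S f\<close>: \<open>f\<close> is of class $C^k$ on \<open>S\<close>. Only used for open \<open>S\<close>.\<close>

fun C_diff :: "nat \<Rightarrow> 'a::euclidean_space set \<Rightarrow> ('a \<Rightarrow> 'b::euclidean_space) \<Rightarrow> bool" where
  "C_diff 0 S f = continuous_on S f"
| "C_diff (Suc k) S f =
     ((\<forall>x\<in>S. f differentiable (at x)) \<and>
      (\<forall>v. C_diff k S (\<lambda>x. frechet_derivative f (at x) v)))"

definition smooth_on :: "'a::euclidean_space set \<Rightarrow> ('a \<Rightarrow> 'b::euclidean_space) \<Rightarrow> bool" where
  "smooth_on S f \<longleftrightarrow> (\<forall>k. C_diff k S f)"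

text \<open>A manifold modelled on the Euclidean space \<open>'e\<close> is given by an atlas, a set of pairs
  (chart domain, chart map). Its underlying set is the union of the chart domains, and a set is open
  iff all its chart images are open. The values of a chart map outside its domain are irrelevant.\<close>

type_synonym ('a, 'e) atlas = "('a set \<times> ('a \<Rightarrow> 'e)) set"

definition points :: "('a, 'e) atlas \<Rightarrow> 'a set" where
  "points \<A> = \<Union> (fst ` \<A>)"

definition atlas_topology :: "('a, 'e::euclidean_space) atlas \<Rightarrow> 'a topology" where
  "atlas_topology \<A> =
     topology (\<lambda>S. S \<subseteq> points \<A> \<and> (\<forall>(U, u)\<in>\<A>. open (u ` (S \<inter> U))))"

definition smooth_manifold :: "('a, 'e::euclidean_space) atlas \<Rightarrow> bool" where
  "smooth_manifold \<A> \<longleftrightarrow>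
     (\<forall>(U, u)\<in>\<A>. inj_on u U) \<and>
     (\<forall>(U, u)\<in>\<A>. \<forall>(V, v)\<in>\<A>.
        open (u ` (U \<inter> V)) \<and> smooth_on (u ` (U \<inter> V)) (v \<circ> inv_into U u)) \<and>
     Hausdorff_space (atlas_topology \<A>) \<and>
     second_countable (atlas_topology \<A>)"

definition smooth_map ::
    "('a, 'd::euclidean_space) atlas \<Rightarrow> ('b, 'e::euclidean_space) atlas \<Rightarrow> ('a \<Rightarrow> 'b) \<Rightarrow> bool" where
  "smooth_map \<A> \<B> f \<longleftrightarrow>
     continuous_map (atlas_topology \<A>) (atlas_topology \<B>) f \<and>
     (\<forall>(U, u)\<in>\<A>. \<forall>(V, v)\<in>\<B>. smooth_on (u ` (U \<inter> f -` V)) (v \<circ> f \<circ> inv_into U u))"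

definition restrict_atlas :: "('a, 'e) atlas \<Rightarrow> 'a set \<Rightarrow> ('a, 'e) atlas" where
  "restrict_atlas \<A> V = (\<lambda>(U, u). (U \<inter> V, u)) ` \<A>"

definition diffeomorphism ::
    "('a, 'd::euclidean_space) atlas \<Rightarrow> ('b, 'e::euclidean_space) atlas \<Rightarrow> ('a \<Rightarrow> 'b) \<Rightarrow> bool" where
  "diffeomorphism \<A> \<B> h \<longleftrightarrow>
     bij_betw h (points \<A>) (points \<B>) \<and> smooth_map \<A> \<B> h \<and>
     smooth_map \<B> \<A> (inv_into (points \<A>) h)"


section \<open>Riemannian calculus on open subsets of a Euclidean space\<close>

abbreviation D :: "('a::euclidean_space \<Rightarrow> 'b::euclidean_space) \<Rightarrow> 'a \<Rightarrow> 'a \<Rightarrow> 'b" where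
  "D f x v \<equiv> frechet_derivative f (at x) v"

text \<open>A metric is a function \<open>g\<close> with \<open>g x v w\<close> the inner product of the tangent vectors \<open>v\<close>, \<open>w\<close>
  at \<open>x\<close>. \<open>christoffel g x v w\<close> is \<open>\<nabla>\<^sub>V W\<close> at \<open>x\<close>, where \<open>V\<close>, \<open>W\<close> are the constant extensions of
  \<open>v\<close>, \<open>w\<close>, as determined by the Koszul formula.\<close>

definition christoffel :: "('e \<Rightarrow> 'e \<Rightarrow> 'e \<Rightarrow> real) \<Rightarrow> 'e \<Rightarrow> 'e \<Rightarrow> 'e \<Rightarrow> 'e::euclidean_space" where
  "christoffel g x v w =
     (THE u. \<forall>z. g x u z =
        (D (\<lambda>y. g y w z) x v + D (\<lambda>y. g y v z) x w - D (\<lambda>y. g y v w) x z) / 2)"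

text \<open>\<open>nabla g v Y x\<close> is the Levi-Civita covariant derivative of the vector field \<open>Y\<close> at \<open>x\<close> in
  direction \<open>v\<close>.\<close>

definition nabla :: "('e \<Rightarrow> 'e \<Rightarrow> 'e \<Rightarrow> real) \<Rightarrow> 'e \<Rightarrow> ('e \<Rightarrow> 'e) \<Rightarrow> 'e \<Rightarrow> 'e::euclidean_space" where
  "nabla g v Y x = D Y x v + christoffel g x v (Y x)"

text \<open>\<open>R(a,b)w = \<nabla>\<^sub>a \<nabla>\<^sub>b w - \<nabla>\<^sub>b \<nabla>\<^sub>a w - \<nabla>\<^bsub>[a,b]\<^esub> w\<close>; the vectors are extended to constant fields, whose
  bracket vanishes.\<close>

definition curvature :: "('e \<Rightarrow> 'e \<Rightarrow> 'e \<Rightarrow> real) \<Rightarrow> 'e \<Rightarrow> 'e \<Rightarrow> 'e \<Rightarrow> 'e \<Rightarrow> 'e::euclidean_space" where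
  "curvature g x a b w =
     nabla g a (nabla g b (\<lambda>_. w)) x - nabla g b (nabla g a (\<lambda>_. w)) x"


section \<open>The complex space forms $M_2(c)$\<close>

text \<open>For \<open>c > 0\<close> the points of $M_2(c)$ are all complex lines through the origin of $\mathbb{C}^3$,
  for \<open>c < 0\<close> those lines on which the Hermitian form of signature \<open>(-,+,+)\<close> is negative. A line
  is encoded as a set of vectors.\<close>

definition herm :: "real \<Rightarrow> complex^3 \<Rightarrow> complex^3 \<Rightarrow> complex" where
  "herm c z w = of_real (sgn c) * z$1 * cnj (w$1) + z$2 * cnj (w$2) + z$3 * cnj (w$3)"

definition complex_line :: "complex^3 \<Rightarrow> (complex^3) set" where
  "complex_line z = range (\<lambda>a. a *s z)"

definition space_form :: "real \<Rightarrow> (complex^3) set set" where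
  "space_form c = {complex_line z | z. c * Re (herm c z z) > 0}"

text \<open>The affine charts \<open>z\<^sub>j = 1\<close>. The index type \<open>3\<close> is that of the integers modulo 3, so the two
  indices different from \<open>j\<close> are \<open>j + 1\<close> and \<open>j + 2\<close>. \<open>hom_vec j a\<close> inserts \<open>a\<close> in position \<open>j\<close>.\<close>

definition hom_vec :: "3 \<Rightarrow> complex \<Rightarrow> complex^2 \<Rightarrow> complex^3" where
  "hom_vec j a x = (\<chi> k. if k = j then a else if k = j + 1 then x$1 else x$2)"

definition chart_dom :: "real \<Rightarrow> 3 \<Rightarrow> (complex^3) set set" where
  "chart_dom c j = {p \<in> space_form c. \<exists>z\<in>p. z$j \<noteq> 0}"

definition chart :: "3 \<Rightarrow> (complex^3) set \<Rightarrow> complex^2" where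
  "chart j p = (THE x. hom_vec j 1 x \<in> p)"

definition space_form_atlas :: "real \<Rightarrow> ((complex^3) set, complex^2) atlas" where
  "space_form_atlas c = range (\<lambda>j. (chart_dom c j, chart j))"

text \<open>The Fubini-Study metric (\<open>c > 0\<close>) respectively Bergman metric (\<open>c < 0\<close>) of constant
  holomorphic sectional curvature \<open>c\<close> in the \<open>j\<close>-th affine chart. The factor \<open>4 / c\<close> makes it
  positive definite in both cases. The complex structure is multiplication by \<open>\<i>\<close> in every chart.\<close>

definition kaehler_metric :: "real \<Rightarrow> 3 \<Rightarrow> complex^2 \<Rightarrow> complex^2 \<Rightarrow> complex^2 \<Rightarrow> real" where
  "kaehler_metric c j x v w =
     (let z = hom_vec j 1 x; v' = hom_vec j 0 v; w' = hom_vec j 0 w in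
      4 / c * Re ((herm c v' w' * herm c z z - herm c v' z * herm c z w') / (herm c z z)\<^sup>2))"

abbreviation J :: "complex^2 \<Rightarrow> complex^2" where
  "J v \<equiv> \<i> *s v"

definition ambient_isometry :: "real \<Rightarrow> ((complex^3) set \<Rightarrow> (complex^3) set) \<Rightarrow> bool" where
  "ambient_isometry c \<Phi> \<longleftrightarrow>
     diffeomorphism (space_form_atlas c) (space_form_atlas c) \<Phi> \<and>
     (\<forall>i j. \<forall>p \<in> chart_dom c i \<inter> \<Phi> -` chart_dom c j. \<forall>v w.
        (let T = chart j \<circ> \<Phi> \<circ> inv_into (chart_dom c i) (chart i); x = chart i p in
         kaehler_metric c j (T x) (D T x v) (D T x w) = kaehler_metric c i x v w))"

text \<open>Riemannian distance of $M_2(c)$: infimum of the lengths of smooth curves. The speed does not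
  depend on the chart in which it is computed.\<close>

definition curve_speed :: "real \<Rightarrow> (real \<Rightarrow> (complex^3) set) \<Rightarrow> real \<Rightarrow> real" where
  "curve_speed c \<gamma> t =
     (let j = (SOME j. \<gamma> t \<in> chart_dom c j); v = vector_derivative (chart j \<circ> \<gamma>) (at t) in
      sqrt (kaehler_metric c j (chart j (\<gamma> t)) v v))"

definition riem_dist :: "real \<Rightarrow> (complex^3) set \<Rightarrow> (complex^3) set \<Rightarrow> real" where
  "riem_dist c p q =
     Inf {integral {0..1} (curve_speed c \<gamma>) | \<gamma>.
            smooth_map {(UNIV, id)} (space_form_atlas c) \<gamma> \<and> \<gamma> 0 = p \<and> \<gamma> 1 = q}"


section \<open>Real hypersurfaces\<close>

text \<open>A real hypersurface is a connected 3-manifold \<open>\<A>\<close> together with an immersion \<open>f\<close> into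
  $M_2(c)$.\<close>

definition real_hypersurface ::
    "real \<Rightarrow> ('m, real^3) atlas \<Rightarrow> ('m \<Rightarrow> (complex^3) set) \<Rightarrow> bool" where
  "real_hypersurface c \<A> f \<longleftrightarrow>
     smooth_manifold \<A> \<and> connected_space (atlas_topology \<A>) \<and>
     smooth_map \<A> (space_form_atlas c) f \<and>
     (\<forall>(U, u)\<in>\<A>. \<forall>j. \<forall>x \<in> u ` (U \<inter> f -` chart_dom c j).
        inj (D (chart j \<circ> f \<circ> inv_into U u) x))"

text \<open>The following notions refer to a coordinate expression \<open>F\<close> of the immersion, the ambient metric
  \<open>G\<close> in the corresponding affine chart and a unit normal field \<open>N\<close> along \<open>F\<close>. Tangent vectors of
  the hypersurface are written in the coordinates of the domain of \<open>F\<close>, and \<open>pull F x y\<close> is the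
  tangent vector at \<open>x\<close> that is mapped to \<open>y\<close>.\<close>

context
  fixes G :: "complex^2 \<Rightarrow> complex^2 \<Rightarrow> complex^2 \<Rightarrow> real"
    and F :: "real^3 \<Rightarrow> complex^2"
begin

definition induced_metric :: "real^3 \<Rightarrow> real^3 \<Rightarrow> real^3 \<Rightarrow> real" where
  "induced_metric x v w = G (F x) (D F x v) (D F x w)"

definition pull :: "real^3 \<Rightarrow> complex^2 \<Rightarrow> real^3" where
  "pull x y = (THE v. D F x v = y)"

definition unit_normal :: "(real^3) set \<Rightarrow> (real^3 \<Rightarrow> complex^2) \<Rightarrow> bool" where
  "unit_normal S N \<longleftrightarrow>
     smooth_on S N \<and> (\<forall>x\<in>S. G (F x) (N x) (N x) = 1 \<and> (\<forall>v. G (F x) (N x) (D F x v) = 0))"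

definition shape :: "(real^3 \<Rightarrow> complex^2) \<Rightarrow> real^3 \<Rightarrow> real^3 \<Rightarrow> real^3" where
  "shape N x v = pull x (- (D N x v + christoffel G (F x) (D F x v) (N x)))"

definition xi :: "(real^3 \<Rightarrow> complex^2) \<Rightarrow> real^3 \<Rightarrow> real^3" where
  "xi N x = pull x (- J (N x))"

definition eta :: "(real^3 \<Rightarrow> complex^2) \<Rightarrow> real^3 \<Rightarrow> real^3 \<Rightarrow> real" where
  "eta N x v = induced_metric x v (xi N x)"

definition phi :: "(real^3 \<Rightarrow> complex^2) \<Rightarrow> real^3 \<Rightarrow> real^3 \<Rightarrow> real^3" where
  "phi N x v = pull x (J (D F x v) - eta N x v *\<^sub>R N x)"

definition star_ricci :: "(real^3 \<Rightarrow> complex^2) \<Rightarrow> real^3 \<Rightarrow> real^3 \<Rightarrow> real^3 \<Rightarrow> real" where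
  "star_ricci N x v w =
     trace (matrix (\<lambda>z. curvature induced_metric x v (phi N x w) (phi N x z))) / 2"

definition star_ricci_op :: "(real^3 \<Rightarrow> complex^2) \<Rightarrow> real^3 \<Rightarrow> real^3 \<Rightarrow> real^3" where
  "star_ricci_op N x v = (THE s. \<forall>w. induced_metric x s w = star_ricci N x v w)"

end

text \<open>\<open>local_data c \<A> f S G F N\<close>: \<open>F\<close> is the expression of \<open>f\<close> in a chart of \<open>\<A>\<close> and an affine chart
  of $M_2(c)$, \<open>G\<close> is the ambient metric in the latter, \<open>S\<close> is an open set of coordinates on which
  \<open>F\<close> is defined and \<open>N\<close> is a unit normal field over \<open>S\<close>. Every point of a hypersurface is covered by
  such data; there need not be a global unit normal field.\<close>

definition local_data ::
    "real \<Rightarrow> ('m, real^3) atlas \<Rightarrow> ('m \<Rightarrow> (complex^3) set) \<Rightarrow> (real^3) set \<Rightarrow>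
     (complex^2 \<Rightarrow> complex^2 \<Rightarrow> complex^2 \<Rightarrow> real) \<Rightarrow> (real^3 \<Rightarrow> complex^2) \<Rightarrow>
     (real^3 \<Rightarrow> complex^2) \<Rightarrow> bool" where
  "local_data c \<A> f S G F N \<longleftrightarrow>
     (\<exists>(U, u)\<in>\<A>. \<exists>j. open S \<and> S \<subseteq> u ` (U \<inter> f -` chart_dom c j) \<and>
        G = kaehler_metric c j \<and> F = chart j \<circ> f \<circ> inv_into U u \<and> unit_normal G F S N)"

definition star_ricci_xi_parallel ::
    "real \<Rightarrow> ('m, real^3) atlas \<Rightarrow> ('m \<Rightarrow> (complex^3) set) \<Rightarrow> bool" where
  "star_ricci_xi_parallel c \<A> f \<longleftrightarrow>
     (\<forall>S G F N X. local_data c \<A> f S G F N \<and> smooth_on S X \<longrightarrow>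
        (\<forall>x\<in>S. nabla (induced_metric G F) (xi F N x) (\<lambda>y. star_ricci_op G F N y (X y)) x =
                star_ricci_op G F N x (nabla (induced_metric G F) (xi F N x) X x)))"

definition hopf :: "real \<Rightarrow> ('m, real^3) atlas \<Rightarrow> ('m \<Rightarrow> (complex^3) set) \<Rightarrow> bool" where
  "hopf c \<A> f \<longleftrightarrow>
     (\<forall>S G F N. local_data c \<A> f S G F N \<longrightarrow>
        (\<forall>x\<in>S. \<exists>\<alpha>. shape G F N x (xi F N x) = \<alpha> *\<^sub>R xi F N x))"

definition shape_xi_zero :: "real \<Rightarrow> ('m, real^3) atlas \<Rightarrow> ('m \<Rightarrow> (complex^3) set) \<Rightarrow> bool" where
  "shape_xi_zero c \<A> f \<longleftrightarrow>
     (\<forall>S G F N. local_data c \<A> f S G F N \<longrightarrow> (\<forall>x\<in>S. shape G F N x (xi F N x) = 0))"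

text \<open>The principal curvatures \<open>\<mu>\<close>, \<open>\<nu>\<close> on the holomorphic distribution are continuous functions, but
  where they coincide they need not be differentiable and \<open>W\<close> need not have a smooth choice.
  Therefore no smoothness is imposed on \<open>W\<close>, and \<open>\<xi>\<mu> = 0\<close> means that the derivative of \<open>\<mu>\<close> along each
  integral curve of \<open>\<xi>\<close> exists and vanishes, which agrees with the usual meaning for differentiable
  \<open>\<mu>\<close>.\<close>

definition principal_pair ::
    "(complex^2 \<Rightarrow> complex^2 \<Rightarrow> complex^2 \<Rightarrow> real) \<Rightarrow> (real^3 \<Rightarrow> complex^2) \<Rightarrow>
     (real^3 \<Rightarrow> complex^2) \<Rightarrow> (real^3) set \<Rightarrow> (real^3 \<Rightarrow> real) \<Rightarrow> (real^3 \<Rightarrow> real) \<Rightarrow> bool" where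
  "principal_pair G F N S \<mu> \<nu> \<longleftrightarrow>
     continuous_on S \<mu> \<and> continuous_on S \<nu> \<and>
     (\<forall>x\<in>S. \<exists>W. induced_metric G F x W W = 1 \<and> eta G F N x W = 0 \<and>
        shape G F N x W = \<mu> x *\<^sub>R W \<and>
        shape G F N x (phi G F N x W) = \<nu> x *\<^sub>R phi G F N x W)"

definition constant_along :: "(real^3) set \<Rightarrow> (real^3 \<Rightarrow> real^3) \<Rightarrow> (real^3 \<Rightarrow> real) \<Rightarrow> bool" where
  "constant_along S V h \<longleftrightarrow>
     (\<forall>a b \<gamma>. (\<forall>t\<in>{a<..<b}. \<gamma> t \<in> S \<and> (\<gamma> has_vector_derivative V (\<gamma> t)) (at t)) \<longrightarrow>
        (\<forall>t\<in>{a<..<b}. ((h \<circ> \<gamma>) has_real_derivative 0) (at t)))"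

definition hol_curvatures_xi_constant ::
    "real \<Rightarrow> ('m, real^3) atlas \<Rightarrow> ('m \<Rightarrow> (complex^3) set) \<Rightarrow> bool" where
  "hol_curvatures_xi_constant c \<A> f \<longleftrightarrow>
     (\<forall>S G F N \<mu> \<nu>. local_data c \<A> f S G F N \<and> principal_pair G F N S \<mu> \<nu> \<longrightarrow>
        constant_along S (xi F N) \<mu> \<and> constant_along S (xi F N) \<nu>)"

text \<open>Each point of the first hypersurface has a neighbourhood that an isometry of $M_2(c)$ carries
  onto an open part of the second one.\<close>

definition locally_congruent ::
    "real \<Rightarrow> ('m, real^3) atlas \<Rightarrow> ('m \<Rightarrow> (complex^3) set) \<Rightarrow>
     ('n, real^3) atlas \<Rightarrow> ('n \<Rightarrow> (complex^3) set) \<Rightarrow> bool" where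
  "locally_congruent c \<A> f \<B> f' \<longleftrightarrow>
     (\<forall>p\<in>points \<A>. \<exists>V V' h \<Phi>.
        openin (atlas_topology \<A>) V \<and> p \<in> V \<and> openin (atlas_topology \<B>) V' \<and>
        diffeomorphism (restrict_atlas \<A> V) (restrict_atlas \<B> V') h \<and>
        ambient_isometry c \<Phi> \<and> (\<forall>q\<in>V. f' (h q) = \<Phi> (f q)))"


section \<open>Real hypersurfaces of type (A)\<close>

definition geodesic_sphere :: "real \<Rightarrow> (complex^3) set \<Rightarrow> real \<Rightarrow> (complex^3) set set" where
  "geodesic_sphere c p r = {q \<in> space_form c. riem_dist c p q = r}"

text \<open>In the complex hyperbolic plane the tube of radius \<open>r\<close> over a closed totally geodesic
  submanifold is the set of points at distance \<open>r\<close> from it.\<close>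

definition tube :: "real \<Rightarrow> (complex^3) set set \<Rightarrow> real \<Rightarrow> (complex^3) set set" where
  "tube c P r = {q \<in> space_form c. (INF p\<in>P. riem_dist c p q) = r}"

text \<open>For \<open>c < 0\<close>, the totally geodesic complex hyperbolic lines are the polars of the positive vectors.\<close>

definition complex_geodesic :: "real \<Rightarrow> complex^3 \<Rightarrow> (complex^3) set set" where
  "complex_geodesic c n = {p \<in> space_form c. \<forall>z\<in>p. herm c z n = 0}"

text \<open>Horospheres are the level sets of Busemann functions of unit speed geodesic rays; the level can
  be normalised to 0 by replacing the ray or prolonging it backwards.\<close>

definition geodesic_ray :: "real \<Rightarrow> (real \<Rightarrow> (complex^3) set) \<Rightarrow> bool" where
  "geodesic_ray c \<gamma> \<longleftrightarrow>
     (\<forall>t\<ge>0. \<gamma> t \<in> space_form c) \<and> (\<forall>s\<ge>0. \<forall>t\<ge>0. riem_dist c (\<gamma> s) (\<gamma> t) = \<bar>s - t\<bar>)"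

definition horosphere :: "real \<Rightarrow> (real \<Rightarrow> (complex^3) set) \<Rightarrow> (complex^3) set set" where
  "horosphere c \<gamma> = {q \<in> space_form c. ((\<lambda>t. riem_dist c q (\<gamma> t) - t) \<longlongrightarrow> 0) at_top}"

definition type_A_sets :: "real \<Rightarrow> (complex^3) set set set" where
  "type_A_sets c =
     (if c > 0 then {geodesic_sphere c p r | p r. p \<in> space_form c \<and> 0 < r \<and> r < pi / sqrt c}
      else {geodesic_sphere c p r | p r. p \<in> space_form c \<and> 0 < r} \<union>
           {horosphere c \<gamma> | \<gamma>. geodesic_ray c \<gamma>} \<union>
           {tube c (complex_geodesic c n) r | n r. Re (herm c n n) > 0 \<and> 0 < r})"

text \<open>The hypersurface is embedded: the map into $M_2(c)$ is the inclusion and the topology is the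
  subspace topology, which determines the smooth structure.\<close>

definition type_A :: "real \<Rightarrow> ((complex^3) set, real^3) atlas \<Rightarrow> bool" where
  "type_A c \<B> \<longleftrightarrow>
     real_hypersurface c \<B> id \<and> points \<B> \<in> type_A_sets c \<and>
     atlas_topology \<B> = subtopology (atlas_topology (space_form_atlas c)) (points \<B>)"

end

theory Submission
  imports Defs
begin

text \<open>Along a coordinate expression of the hypersurface choose a unitary frame \<open>E, N\<close> of $\mathbb{C}^2$
  for the ambient Hermitian metric, with \<open>N\<close> the given unit normal. All geometric data become scalar
  one-forms: the coframe \<open>\<theta>\<close> (complex), \<open>\<eta>\<close> (real), the components \<open>p, q\<close> of the covariant derivative
  of \<open>N\<close> (the shape operator) and the connection form \<open>r\<close> of \<open>E\<close>. Writing
  \<open>p = P \<theta> + Q cnj \<theta> + s \<eta>\<close>, the Gauss equation gives \<open>S\<^sup>* X = (\<kappa> \<theta>(X) + m \<eta>(X)) E\<close> with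
  \<open>\<kappa> = c + P\<^sup>2 - |Q|\<^sup>2\<close> and \<open>m = s P - cnj s Q\<close>. If \<open>S\<^sup>*\<close> is \<open>\<xi>\<close>-parallel, comparing components yields
  \<open>\<kappa> s = 0\<close> and \<open>m s = 0\<close>; where \<open>s \<noteq> 0\<close> this forces \<open>|P| = |Q|\<close> and hence \<open>\<kappa> = c \<noteq> 0\<close>, a contradiction.
  So \<open>M\<close> is Hopf, and then \<open>\<xi>\<kappa> = 0\<close>, that is, \<open>\<xi>(\<lambda>\<nu>) = 0\<close>.

  On a Hopf hypersurface the Codazzi equation shows that \<open>\<alpha>\<close> is locally constant and
  \<open>\<lambda>\<nu> = \<alpha> (\<lambda> + \<nu>) / 2 + c / 4\<close>. By connectedness either \<open>\<alpha> = 0\<close> everywhere, or \<open>\<alpha>\<close> vanishes nowhere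
  and then \<open>\<lambda> + \<nu>\<close> and \<open>\<lambda>\<nu>\<close> are constant along \<open>\<xi>\<close>, hence so are \<open>\<lambda>\<close> and \<open>\<nu>\<close>. Hypersurfaces of
  type (A) have constant principal curvatures and need no separate treatment.\<close>


section \<open>Smooth functions\<close>

text \<open>Two complex dimensions make the frame explicit: the kernel of the complex linear form
  \<open>h x _ (N x)\<close> is the line spanned by the swapped coefficients of that form, so
  \<open>E\<close> is smooth on every patch without any choice. The tangent vectors defined by
  \<open>THE\<close> for the induced metric are then read off from their components
  \<open>th\<close> and \<open>et\<close>. Codazzi alone gives only d\<alpha> = \<beta>\<eta>. A
  second exterior derivative yields \<beta>(\<lambda> + \<nu>) = 0, and an open set with \<lambda> +
  \<nu> = 0 must still be excluded. There \<lambda>\<nu> = c / 4, hence c = -4, and the argument of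
  \<open>Q\<close> has a differential that the Gauss equation prevents from being closed. There is
  no global unit normal, so \<alpha> is defined only up to sign. The connectedness argument
  therefore concerns the vanishing of \<alpha>, transported between patches by the one-form
  \<alpha>\<eta>, which does not see the sign. Where \<lambda> and \<nu> coincide they may fail to
  be differentiable; along an integral curve of \<xi> they are handled as continuous roots of one
  fixed quadratic polynomial.\<close>

lemma frechet_derivative_cong_open:
  assumes "open S" "x \<in> S" "\<And>y. y \<in> S \<Longrightarrow> f y = g y"
  shows "frechet_derivative f (at x) = frechet_derivative g (at x)"
proof -
  have "(f has_derivative f') (at x) \<longleftrightarrow> (g has_derivative f') (at x)" for f'
    using has_derivative_transform_within_open[OF _ assms(1,2), of f f' UNIV g]
      has_derivative_transform_within_open[OF _ assms(1,2), of g f' UNIV f] assms(3) by auto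
  then show ?thesis by (simp add: frechet_derivative_def)
qed

lemma differentiable_cong_open:
  assumes "open S" "x \<in> S" "\<And>y. y \<in> S \<Longrightarrow> f y = g y" "f differentiable (at x)"
  shows "g differentiable (at x)"
  using assms has_derivative_transform_within_open unfolding differentiable_def by metis

lemma C_diff_cong:
  assumes "open S" "\<And>y. y \<in> S \<Longrightarrow> f y = g y" "C_diff k S f"
  shows "C_diff k S g"
  using assms(2,3)
proof (induction k arbitrary: f g)
  case 0 then show ?case by (simp add: continuous_on_eq)
next
  case (Suc k)
  have "\<forall>x\<in>S. g differentiable (at x)"
    using Suc.prems assms(1) differentiable_cong_open[of S _ f g] by simp
  moreover have "C_diff k S (\<lambda>x. D g x v)" for v
    by (rule Suc.IH[of "\<lambda>x. D f x v"])
      (use Suc.prems frechet_derivative_cong_open[OF assms(1), of _ f g] in auto)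
  ultimately show ?case by simp
qed

lemma C_diff_Suc_imp: "C_diff (Suc k) S f \<Longrightarrow> C_diff k S f"
proof (induction k arbitrary: f)
  case 0 then show ?case
    by (auto intro!: continuous_at_imp_continuous_on differentiable_imp_continuous_within)
qed auto

lemma C_diff_subset: "C_diff k S f \<Longrightarrow> S' \<subseteq> S \<Longrightarrow> C_diff k S' f"
  by (induction k arbitrary: f) (auto intro: continuous_on_subset)

lemma C_diff_const: "C_diff k S (\<lambda>_. a)"
  by (induction k arbitrary: a) auto

lemma C_diff_linear:
  assumes "open S" "bounded_linear L" "C_diff k S f"
  shows "C_diff k S (\<lambda>x. L (f x))"
  using assms(3)
proof (induction k arbitrary: f)
  case 0 then show ?case
    using assms(2) by (simp add: linear_continuous_on_compose[OF _ bounded_linear.linear])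
next
  case (Suc k)
  have d: "((\<lambda>y. L (f y)) has_derivative (\<lambda>v. L (D f x v))) (at x)" if "x \<in> S" for x
    using Suc.prems that by (auto intro!: bounded_linear.has_derivative[OF assms(2)]
        simp: frechet_derivative_works[symmetric])
  have "C_diff k S (\<lambda>x. D (\<lambda>y. L (f y)) x v)" for v
    by (rule C_diff_cong[OF assms(1) _ Suc.IH[of "\<lambda>x. D f x v"]])
      (use Suc.prems fun_cong[OF frechet_derivative_at[OF d]] in auto)
  then show ?case using d by (auto simp: differentiable_def)
qed

lemma C_diff_add:
  assumes "open S" "C_diff k S f" "C_diff k S g"
  shows "C_diff k S (\<lambda>x. f x + g x)"
  using assms(2,3)
proof (induction k arbitrary: f g)
  case 0 then show ?case by (simp add: continuous_on_add)
next
  case (Suc k)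
  have d: "((\<lambda>y. f y + g y) has_derivative (\<lambda>v. D f x v + D g x v)) (at x)" if "x \<in> S" for x
    using Suc.prems that by (auto intro!: has_derivative_add simp: frechet_derivative_works[symmetric])
  have "C_diff k S (\<lambda>x. D (\<lambda>y. f y + g y) x v)" for v
    by (rule C_diff_cong[OF assms(1) _ Suc.IH[of "\<lambda>x. D f x v" "\<lambda>x. D g x v"]])
      (use Suc.prems fun_cong[OF frechet_derivative_at[OF d]] in auto)
  then show ?case using d by (auto simp: differentiable_def)
qed

lemma C_diff_bilinear:
  assumes "open S" "bounded_bilinear B" "C_diff k S f" "C_diff k S g"
  shows "C_diff k S (\<lambda>x. B (f x) (g x))"
  using assms(3,4)
proof (induction k arbitrary: f g)
  case 0 then show ?case using assms(2) by (simp add: bounded_bilinear.continuous_on)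
next
  case (Suc k)
  have d: "((\<lambda>y. B (f y) (g y)) has_derivative (\<lambda>v. B (f x) (D g x v) + B (D f x v) (g x))) (at x)"
    if "x \<in> S" for x
    using Suc.prems that by (auto intro!: bounded_bilinear.FDERIV[OF assms(2)]
        simp: frechet_derivative_works[symmetric])
  have "C_diff k S (\<lambda>x. D (\<lambda>y. B (f y) (g y)) x v)" for v
    by (rule C_diff_cong[OF assms(1) _ C_diff_add[OF assms(1) Suc.IH[of f "\<lambda>x. D g x v"]
          Suc.IH[of "\<lambda>x. D f x v" g]]])
      (use Suc.prems Suc.prems[THEN C_diff_Suc_imp] fun_cong[OF frechet_derivative_at[OF d]] in auto)
  then show ?case using d by (auto simp: differentiable_def)
qed

text \<open>The derivative of \<open>inverse (f x)\<close> is built from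
  \<open>inverse (f x)\<close> and \<open>D f x v\<close> alone, so an induction step uses the claim
  one order lower for the same \<open>f\<close>.\<close>

lemma C_diff_inverse:
  fixes f :: "'a::euclidean_space \<Rightarrow> 'b::{real_normed_field, euclidean_space}"
  assumes "open S" "C_diff k S f" "\<And>x. x \<in> S \<Longrightarrow> f x \<noteq> 0"
  shows "C_diff k S (\<lambda>x. inverse (f x))"
  using assms(2)
proof (induction k)
  case 0 then show ?case using assms(3) by (simp add: continuous_on_inverse)
next
  case (Suc k)
  have d: "((\<lambda>y. inverse (f y)) has_derivative (\<lambda>v. - (inverse (f x) * D f x v * inverse (f x)))) (at x)"
    if "x \<in> S" for x
    using Suc.prems that assms(3) by (auto intro!: has_derivative_inverse
        simp: frechet_derivative_works[symmetric])
  note IH = Suc.IH[OF C_diff_Suc_imp[OF Suc.prems]]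
  have "C_diff k S (\<lambda>x. D (\<lambda>y. inverse (f y)) x v)" for v
    by (rule C_diff_cong[OF assms(1) _ C_diff_linear[OF assms(1) bounded_linear_minus[OF bounded_linear_ident]
        C_diff_bilinear[OF assms(1) bounded_bilinear_mult
          C_diff_bilinear[OF assms(1) bounded_bilinear_mult IH] IH]], of "\<lambda>x. D f x v"])
      (use Suc.prems fun_cong[OF frechet_derivative_at[OF d]] in auto)
  then show ?case using d by (auto simp: differentiable_def)
qed

text \<open>The same self-referential scheme: the derivative is \<open>D f x v\<close> divided by
  \<open>2 * sqrt (f x)\<close>, so \<open>C_diff_inverse\<close> is applied to
  \<open>sqrt (f x)\<close> itself.\<close>

lemma C_diff_sqrt:
  assumes "open S" "C_diff k S f" "\<And>x. x \<in> S \<Longrightarrow> f x > 0"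
  shows "C_diff k S (\<lambda>x. sqrt (f x))"
  using assms(2)
proof (induction k)
  case 0 then show ?case by (simp add: continuous_on_real_sqrt)
next
  case (Suc k)
  have d: "((\<lambda>y. sqrt (f y)) has_derivative (\<lambda>v. inverse (sqrt (f x)) * (D f x v / 2))) (at x)"
    if "x \<in> S" for x
  proof -
    have "((\<lambda>y. sqrt (f y)) has_derivative (\<lambda>v. D f x v * (inverse (sqrt (f x)) / 2))) (at x)"
      using Suc.prems that assms(3)[OF that]
      by (auto intro!: DERIV_compose_FDERIV[where f = sqrt and g = f] DERIV_real_sqrt
          simp: frechet_derivative_works[symmetric] simp del: times_divide_eq_right)
    then show ?thesis by (simp add: mult.commute)
  qed
  note IH = Suc.IH[OF C_diff_Suc_imp[OF Suc.prems]]
  have "C_diff k S (\<lambda>x. D (\<lambda>y. sqrt (f y)) x v)" for v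
    by (rule C_diff_cong[OF assms(1) _ C_diff_bilinear[OF assms(1) bounded_bilinear_mult
          C_diff_inverse[OF assms(1) IH] C_diff_linear[OF assms(1) bounded_linear_divide]],
          of "\<lambda>x. D f x v" 2])
      (use Suc.prems fun_cong[OF frechet_derivative_at[OF d]] assms(3) in \<open>auto simp: less_le\<close>)
  then show ?case using d by (auto simp: differentiable_def)
qed

section \<open>Closure properties of smooth maps\<close>

lemma smooth_on_cong: "open S \<Longrightarrow> smooth_on S f \<Longrightarrow> (\<And>y. y \<in> S \<Longrightarrow> f y = g y) \<Longrightarrow> smooth_on S g"
  unfolding smooth_on_def using C_diff_cong by metis

lemma smooth_on_subset: "smooth_on S f \<Longrightarrow> S' \<subseteq> S \<Longrightarrow> smooth_on S' f"
  unfolding smooth_on_def using C_diff_subset by blast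

lemma smooth_on_const [simp]: "smooth_on S (\<lambda>_. a)"
  by (simp add: smooth_on_def C_diff_const)

lemma smooth_on_D: "smooth_on S f \<Longrightarrow> smooth_on S (\<lambda>x. D f x v)"
  unfolding smooth_on_def by (metis C_diff.simps(2))

lemma smooth_on_differentiable: "smooth_on S f \<Longrightarrow> x \<in> S \<Longrightarrow> f differentiable (at x)"
  unfolding smooth_on_def by (metis C_diff.simps(2))

lemma smooth_on_has_derivative: "smooth_on S f \<Longrightarrow> x \<in> S \<Longrightarrow> (f has_derivative D f x) (at x)"
  using smooth_on_differentiable frechet_derivative_works by blast

lemma smooth_on_continuous: "smooth_on S f \<Longrightarrow> continuous_on S f"
  unfolding smooth_on_def by (metis C_diff.simps(1))

lemma smooth_on_ident [simp]: "smooth_on S (\<lambda>x. x)"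
  unfolding smooth_on_def
proof
  fix k show "C_diff k S (\<lambda>x. x)"
    by (cases k) (simp_all add: C_diff_const)
qed

lemma smooth_on_linear: "open S \<Longrightarrow> bounded_linear L \<Longrightarrow> smooth_on S f \<Longrightarrow> smooth_on S (\<lambda>x. L (f x))"
  unfolding smooth_on_def using C_diff_linear by blast

lemma smooth_on_bilinear:
  "open S \<Longrightarrow> bounded_bilinear B \<Longrightarrow> smooth_on S f \<Longrightarrow> smooth_on S g \<Longrightarrow> smooth_on S (\<lambda>x. B (f x) (g x))"
  unfolding smooth_on_def using C_diff_bilinear by blast

lemma smooth_on_add: "open S \<Longrightarrow> smooth_on S f \<Longrightarrow> smooth_on S g \<Longrightarrow> smooth_on S (\<lambda>x. f x + g x)"
  unfolding smooth_on_def using C_diff_add by blast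

lemma smooth_on_minus: "open S \<Longrightarrow> smooth_on S f \<Longrightarrow> smooth_on S (\<lambda>x. - f x)"
  by (rule smooth_on_linear[OF _ bounded_linear_minus[OF bounded_linear_ident]])

lemma smooth_on_diff: "open S \<Longrightarrow> smooth_on S f \<Longrightarrow> smooth_on S g \<Longrightarrow> smooth_on S (\<lambda>x. f x - g x)"
  using smooth_on_add[of S f "\<lambda>x. - g x"] smooth_on_minus by fastforce

lemma smooth_on_sum:
  "open S \<Longrightarrow> (\<And>i. i \<in> I \<Longrightarrow> smooth_on S (f i)) \<Longrightarrow> smooth_on S (\<lambda>x. \<Sum>i\<in>I. f i x)"
  by (induction I rule: infinite_finite_induct) (auto intro: smooth_on_add)

lemma smooth_on_mult:
  fixes f g :: "'a::euclidean_space \<Rightarrow> 'b::{real_normed_field, euclidean_space}"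
  shows "open S \<Longrightarrow> smooth_on S f \<Longrightarrow> smooth_on S g \<Longrightarrow> smooth_on S (\<lambda>x. f x * g x)"
  by (rule smooth_on_bilinear[OF _ bounded_bilinear_mult])

lemma smooth_on_scaleR: "open S \<Longrightarrow> smooth_on S f \<Longrightarrow> smooth_on S g \<Longrightarrow> smooth_on S (\<lambda>x. f x *\<^sub>R g x)"
  by (rule smooth_on_bilinear[OF _ bounded_bilinear_scaleR])

lemma smooth_on_inverse:
  fixes f :: "'a::euclidean_space \<Rightarrow> 'b::{real_normed_field, euclidean_space}"
  shows "open S \<Longrightarrow> smooth_on S f \<Longrightarrow> (\<And>x. x \<in> S \<Longrightarrow> f x \<noteq> 0) \<Longrightarrow> smooth_on S (\<lambda>x. inverse (f x))"
  unfolding smooth_on_def using C_diff_inverse by blast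

lemma smooth_on_divide:
  fixes f g :: "'a::euclidean_space \<Rightarrow> 'b::{real_normed_field, euclidean_space}"
  shows "open S \<Longrightarrow> smooth_on S f \<Longrightarrow> smooth_on S g \<Longrightarrow> (\<And>x. x \<in> S \<Longrightarrow> g x \<noteq> 0) \<Longrightarrow>
    smooth_on S (\<lambda>x. f x / g x)"
  unfolding divide_inverse by (intro smooth_on_mult smooth_on_inverse)

lemma smooth_on_sqrt: "open S \<Longrightarrow> smooth_on S f \<Longrightarrow> (\<And>x. x \<in> S \<Longrightarrow> f x > 0) \<Longrightarrow> smooth_on S (\<lambda>x. sqrt (f x))"
  unfolding smooth_on_def using C_diff_sqrt by blast

lemmas smooth_on_cnj = smooth_on_linear[OF _ bounded_linear_cnj]
  and smooth_on_Re = smooth_on_linear[OF _ bounded_linear_Re]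
  and smooth_on_Im = smooth_on_linear[OF _ bounded_linear_Im]
  and smooth_on_of_real = smooth_on_linear[OF _ bounded_linear_of_real]
  and smooth_on_vec_nth = smooth_on_linear[OF _ bounded_linear_vec_nth]

text \<open>Complex multiples of fields are differentiated by the real product rule, for which real
  bilinearity is the right notion.\<close>

lemma bounded_bilinear_vector_scalar_mult:
  "bounded_bilinear ((*s) :: complex \<Rightarrow> complex^'n \<Rightarrow> complex^'n)"
proof -
  have "bilinear ((*s) :: complex \<Rightarrow> complex^'n \<Rightarrow> complex^'n)"
    by (auto simp: bilinear_def linear_iff vec_eq_iff algebra_simps)
  then show ?thesis by (simp add: bilinear_conv_bounded_bilinear)
qed

lemma smooth_on_vector_scalar_mult:
  fixes g :: "'a::euclidean_space \<Rightarrow> complex^'n"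
  shows "open S \<Longrightarrow> smooth_on S f \<Longrightarrow> smooth_on S g \<Longrightarrow> smooth_on S (\<lambda>x. f x *s g x)"
  by (rule smooth_on_bilinear[OF _ bounded_bilinear_vector_scalar_mult])

lemma smooth_on_vec_lambda:
  fixes f :: "'a::euclidean_space \<Rightarrow> 'b::euclidean_space^'n"
  assumes "open S" "\<And>i. smooth_on S (\<lambda>x. f x $ i)"
  shows "smooth_on S f"
proof -
  have bl: "bounded_linear (axis i :: 'b \<Rightarrow> 'b^'n)" for i
    by (rule linear_conv_bounded_linear[THEN iffD1]) (auto simp: linear_iff axis_def vec_eq_iff)
  have "f x = (\<Sum>i\<in>UNIV. axis i (f x $ i))" for x
    by (simp add: vec_eq_iff axis_def)
  moreover have "smooth_on S (\<lambda>x. \<Sum>i\<in>UNIV. axis i (f x $ i))"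
    by (intro smooth_on_sum smooth_on_linear[OF _ bl] assms)
  ultimately show ?thesis by simp
qed

text \<open>The second difference of \<open>f\<close> over the parallelogram spanned by
  \<open>t *\<^sub>R a\<close> and \<open>t *\<^sub>R b\<close> is symmetric in \<open>a\<close> and
  \<open>b\<close>. Two mean value steps turn it into \<open>t * t\<close> times a mixed derivative
  at a point near \<open>x\<close>, in either order; continuity then compares the two mixed
  derivatives at \<open>x\<close>.\<close>

lemma real_second_derivative_symmetric:
  fixes f :: "'a::euclidean_space \<Rightarrow> real"
  assumes S: "open S" "x \<in> S" and f: "smooth_on S f"
  shows "D (\<lambda>y. D f y a) x b = D (\<lambda>y. D f y b) x a"
proof -
  have key: "\<exists>y. norm (y - x) \<le> t * (norm a + norm b) \<and>
      f (x + t *\<^sub>R a + t *\<^sub>R b) - f (x + t *\<^sub>R a) - f (x + t *\<^sub>R b) + f x = t * t * D (\<lambda>y. D f y a) y b"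
    if t: "t > 0" and ball: "cball x (t * (norm a + norm b)) \<subseteq> S" for t a b
  proof -
    have inS: "x + r *\<^sub>R a + s *\<^sub>R b \<in> S" if "0 \<le> r" "r \<le> t" "0 \<le> s" "s \<le> t" for r s
    proof -
      have "norm (r *\<^sub>R a + s *\<^sub>R b) \<le> r * norm a + s * norm b"
        using that norm_triangle_ineq[of "r *\<^sub>R a" "s *\<^sub>R b"] by simp
      also have "\<dots> \<le> t * (norm a + norm b)"
        using that by (simp add: distrib_left add_mono mult_right_mono)
      finally have "x + (r *\<^sub>R a + s *\<^sub>R b) \<in> cball x (t * (norm a + norm b))"
        using norm_minus_cancel[of "r *\<^sub>R a + s *\<^sub>R b"] by (simp add: dist_norm)
      then show ?thesis using ball by (auto simp: add.assoc)
    qed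
    \<comment> \<open>\<open>u t - u 0\<close> is the second difference. The mean value theorem in
      \<open>r\<close> produces the \<open>a\<close>-derivative, and then in \<open>s\<close> the
      \<open>b\<close>-derivative.\<close>
    define u where "u r = f (x + r *\<^sub>R a + t *\<^sub>R b) - f (x + r *\<^sub>R a + 0 *\<^sub>R b)" for r
    have du: "(u has_real_derivative D f (x + r *\<^sub>R a + t *\<^sub>R b) a - D f (x + r *\<^sub>R a + 0 *\<^sub>R b) a) (at r)"
      if "0 \<le> r" "r \<le> t" for r
    proof -
      have "((\<lambda>r. f (x + r *\<^sub>R a + s *\<^sub>R b)) has_derivative (\<lambda>k. D f (x + r *\<^sub>R a + s *\<^sub>R b) (k *\<^sub>R a))) (at r)"
        if "0 \<le> s" "s \<le> t" for s
        by (rule has_derivative_compose[of "\<lambda>r. x + r *\<^sub>R a + s *\<^sub>R b" _ _ _ f])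
          (use that \<open>0 \<le> r\<close> \<open>r \<le> t\<close> f inS in \<open>auto intro!: derivative_eq_intros smooth_on_has_derivative[of S]\<close>)
      then have "((\<lambda>r. f (x + r *\<^sub>R a + s *\<^sub>R b)) has_real_derivative D f (x + r *\<^sub>R a + s *\<^sub>R b) a) (at r)"
        if s: "0 \<le> s" "s \<le> t" for s
        by (rule has_derivative_imp_has_field_derivative)
          (use linear_cmul[OF linear_frechet_derivative[OF smooth_on_differentiable[OF f
              inS[OF \<open>0 \<le> r\<close> \<open>r \<le> t\<close> s]]]] s in auto)
      from this[of t] this[of 0] show ?thesis
        unfolding u_def using t by (intro DERIV_diff) auto
    qed
    obtain r where r: "0 < r" "r < t"
      and ur: "u t - u 0 = t * (D f (x + r *\<^sub>R a + t *\<^sub>R b) a - D f (x + r *\<^sub>R a + 0 *\<^sub>R b) a)"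
      using MVT2[of 0 t u, OF t du] by auto
    note g = smooth_on_D[OF f, of a]
    have dv: "((\<lambda>s. D f (x + r *\<^sub>R a + s *\<^sub>R b) a) has_real_derivative
        D (\<lambda>y. D f y a) (x + r *\<^sub>R a + s *\<^sub>R b) b) (at s)" if s: "0 \<le> s" "s \<le> t" for s
    proof -
      have "((\<lambda>s. D f (x + r *\<^sub>R a + s *\<^sub>R b) a) has_derivative
          (\<lambda>k. D (\<lambda>y. D f y a) (x + r *\<^sub>R a + s *\<^sub>R b) (k *\<^sub>R b))) (at s)"
        by (rule has_derivative_compose[of "\<lambda>s. x + r *\<^sub>R a + s *\<^sub>R b" _ _ _ "\<lambda>y. D f y a"])
          (use s r g inS in \<open>auto intro!: derivative_eq_intros smooth_on_has_derivative[of S]\<close>)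
      then show ?thesis
        by (rule has_derivative_imp_has_field_derivative)
          (use linear_cmul[OF linear_frechet_derivative[OF smooth_on_differentiable[OF g inS[of r s]]]] s r in auto)
    qed
    obtain s where s: "0 < s" "s < t"
      and vs: "D f (x + r *\<^sub>R a + t *\<^sub>R b) a - D f (x + r *\<^sub>R a + 0 *\<^sub>R b) a =
        t * D (\<lambda>y. D f y a) (x + r *\<^sub>R a + s *\<^sub>R b) b"
      using MVT2[of 0 t "\<lambda>s. D f (x + r *\<^sub>R a + s *\<^sub>R b) a", OF t dv] by auto
    have "norm (r *\<^sub>R a + s *\<^sub>R b) \<le> r * norm a + s * norm b"
      using r s norm_triangle_ineq[of "r *\<^sub>R a" "s *\<^sub>R b"] by simp
    also have "\<dots> \<le> t * (norm a + norm b)"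
      using r s by (simp add: distrib_left add_mono mult_right_mono)
    finally have "norm ((x + r *\<^sub>R a + s *\<^sub>R b) - x) \<le> t * (norm a + norm b)" by simp
    moreover have "f (x + t *\<^sub>R a + t *\<^sub>R b) - f (x + t *\<^sub>R a) - f (x + t *\<^sub>R b) + f x =
        t * t * D (\<lambda>y. D f y a) (x + r *\<^sub>R a + s *\<^sub>R b) b"
      using ur vs by (simp add: u_def)
    ultimately show ?thesis by blast
  qed
  define X where "X = D (\<lambda>y. D f y a) x b"
  define Y where "Y = D (\<lambda>y. D f y b) x a"
  have cont: "continuous_on S (\<lambda>y. D (\<lambda>y. D f y a) y b)" for a b
    by (intro smooth_on_continuous smooth_on_D f)
  have "\<bar>X - Y\<bar> \<le> 2 * e" if e: "e > 0" for e
  proof -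
    obtain d1 where d1: "d1 > 0" "\<And>y. y \<in> S \<Longrightarrow> dist y x < d1 \<Longrightarrow> \<bar>D (\<lambda>y. D f y a) y b - X\<bar> < e"
      using cont[of a b] S(2) e unfolding continuous_on_iff X_def dist_real_def by metis
    obtain d2 where d2: "d2 > 0" "\<And>y. y \<in> S \<Longrightarrow> dist y x < d2 \<Longrightarrow> \<bar>D (\<lambda>y. D f y b) y a - Y\<bar> < e"
      using cont[of b a] S(2) e unfolding continuous_on_iff Y_def dist_real_def by metis
    obtain d3 where d3: "d3 > 0" "cball x d3 \<subseteq> S"
      using S open_contains_cball by blast
    define d where "d = min d3 (min d1 d2) / 2"
    \<comment> \<open>The summand 1 keeps the denominator positive when \<open>a\<close> and
      \<open>b\<close> both vanish.\<close>
    define t where "t = d / (norm a + norm b + 1)"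
    have d: "d > 0" "d < d1" "d < d2" "d \<le> d3" using d1 d2 d3 by (auto simp: d_def)
    have na: "norm a + norm b + 1 > 0" by (simp add: add_nonneg_pos)
    have t: "t > 0" using d na by (simp add: t_def)
    have "t * (norm a + norm b) \<le> t * (norm a + norm b + 1)" using t by simp
    also have "\<dots> = d" using na by (simp add: t_def)
    finally have td: "t * (norm a + norm b) \<le> d" .
    then have sub: "cball x (t * (norm a + norm b)) \<subseteq> S" using d d3 by auto
    obtain y1 where y1: "norm (y1 - x) \<le> t * (norm a + norm b)"
      "f (x + t *\<^sub>R a + t *\<^sub>R b) - f (x + t *\<^sub>R a) - f (x + t *\<^sub>R b) + f x = t * t * D (\<lambda>y. D f y a) y1 b"
      using key[OF t sub] by blast
    obtain y2 where y2: "norm (y2 - x) \<le> t * (norm b + norm a)"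
      "f (x + t *\<^sub>R b + t *\<^sub>R a) - f (x + t *\<^sub>R b) - f (x + t *\<^sub>R a) + f x = t * t * D (\<lambda>y. D f y b) y2 a"
      using key[OF t, of b a] sub by (auto simp: add.commute)
    have "t * t * D (\<lambda>y. D f y a) y1 b = t * t * D (\<lambda>y. D f y b) y2 a"
      using y1(2) y2(2) by (simp add: algebra_simps)
    then have eq: "D (\<lambda>y. D f y a) y1 b = D (\<lambda>y. D f y b) y2 a" using t by simp
    have "y1 \<in> S" "dist y1 x < d1" "y2 \<in> S" "dist y2 x < d2"
      using y1(1) y2(1) td d sub by (auto simp: dist_norm norm_minus_commute subset_iff add.commute)
    from d1(2)[OF this(1,2)] d2(2)[OF this(3,4)] eq show ?thesis by linarith
  qed
  \<comment> \<open>With this \<open>e\<close> the bound reads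
    \<open>\<bar>X - Y\<bar> \<le> \<bar>X - Y\<bar> / 2\<close>.\<close>
  from this[of "\<bar>X - Y\<bar> / 4"] have "X = Y" by (cases "X = Y") auto
  then show ?thesis by (simp add: X_def Y_def)
qed

lemma D_linear:
  assumes "bounded_linear L" "f differentiable (at x)"
  shows "D (\<lambda>y. L (f y)) x a = L (D f x a)"
  using frechet_derivative_at[OF bounded_linear.has_derivative[OF assms(1)
        assms(2)[unfolded frechet_derivative_works]]] by metis

lemma D_bilinear:
  assumes "bounded_bilinear B" "f differentiable (at x)" "g differentiable (at x)"
  shows "D (\<lambda>y. B (f y) (g y)) x a = B (f x) (D g x a) + B (D f x a) (g x)"
  using frechet_derivative_at[OF bounded_bilinear.FDERIV[OF assms(1)
        assms(2,3)[unfolded frechet_derivative_works]]] by metis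

lemma second_derivative_symmetric:
  fixes f :: "'a::euclidean_space \<Rightarrow> 'b::euclidean_space"
  assumes S: "open S" "x \<in> S" and f: "smooth_on S f"
  shows "D (\<lambda>y. D f y a) x b = D (\<lambda>y. D f y b) x a"
proof (rule euclidean_eqI)
  fix i :: 'b assume "i \<in> Basis"
  note bl = bounded_linear_inner_left[of i]
  note fi = smooth_on_linear[OF S(1) bl f]
  have "D (\<lambda>y. D f y u) x v \<bullet> i = D (\<lambda>y. D (\<lambda>y. f y \<bullet> i) y u) x v" for u v
  proof -
    have "D (\<lambda>y. D (\<lambda>y. f y \<bullet> i) y u) x = D (\<lambda>y. D f y u \<bullet> i) x"
      by (rule frechet_derivative_cong_open[OF S])
        (use smooth_on_differentiable[OF f] in \<open>simp add: D_linear[OF bl]\<close>)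
    then show ?thesis
      using D_linear[OF bl smooth_on_differentiable[OF smooth_on_D[OF f] S(2)]] by metis
  qed
  then show "D (\<lambda>y. D f y a) x b \<bullet> i = D (\<lambda>y. D f y b) x a \<bullet> i"
    using real_second_derivative_symmetric[OF S fi] by simp
qed

section \<open>The Hermitian metric of the complex space forms\<close>

lemma herm_add_left: "herm c (u + v) w = herm c u w + herm c v w"
  and herm_add_right: "herm c w (u + v) = herm c w u + herm c w v"
  and herm_diff_left: "herm c (u - v) w = herm c u w - herm c v w"
  and herm_diff_right: "herm c w (u - v) = herm c w u - herm c w v"
  and herm_minus_left: "herm c (- u) w = - herm c u w"
  and herm_minus_right: "herm c w (- u) = - herm c w u"
  and herm_scale_left: "herm c (a *s u) w = a * herm c u w"
  and herm_scale_right: "herm c w (a *s u) = cnj a * herm c w u"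
  and herm_scaleR_left: "herm c (r *\<^sub>R u) w = r *\<^sub>R herm c u w"
  and herm_scaleR_right: "herm c w (r *\<^sub>R u) = r *\<^sub>R herm c w u"
  and herm_cnj: "cnj (herm c u w) = herm c w u"
  by (simp_all add: herm_def algebra_simps scaleR_conv_of_real[where 'a=complex])

lemma herm_self: "herm c z z = of_real (Re (herm c z z))"
  using herm_cnj[of c z z] by (simp add: complex_eq_iff)

lemma bounded_bilinear_herm: "bounded_bilinear (herm c)"
proof -
  have "bilinear (herm c)"
    by (auto simp: bilinear_def linear_iff herm_add_left herm_add_right herm_scaleR_left herm_scaleR_right)
  then show ?thesis by (simp add: bilinear_conv_bounded_bilinear)
qed

text \<open>In an affine chart, where \<open>z\<close> is the lift with \<open>z\<^sub>j = 1\<close>, the Levi-Civita connection of the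
  space form is \<open>\<nabla>\<^sub>v W = D W v - rho(v) W - rho(W) v\<close>.\<close>

definition rho :: "real \<Rightarrow> complex^3 \<Rightarrow> complex^3 \<Rightarrow> complex" where
  "rho c z v = herm c v z / herm c z z"

text \<open>The Hermitian metric on the tangent space \<open>\<complex>\<^sup>3 / \<complex>z\<close> of $M_2(c)$ at the line of \<open>z\<close>; its real
  part is the Riemannian metric.\<close>

definition hform :: "real \<Rightarrow> complex^3 \<Rightarrow> complex^3 \<Rightarrow> complex^3 \<Rightarrow> complex" where
  "hform c z v w = of_real (4 / c) * (herm c v w * herm c z z - herm c v z * herm c z w) / (herm c z z)\<^sup>2"

lemma rho_add: "rho c z (u + v) = rho c z u + rho c z v"
  and rho_diff: "rho c z (u - v) = rho c z u - rho c z v"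
  and rho_minus: "rho c z (- u) = - rho c z u"
  and rho_scale: "rho c z (a *s u) = a * rho c z u"
  and rho_scaleR: "rho c z (r *\<^sub>R u) = r *\<^sub>R rho c z u"
  by (simp_all add: rho_def herm_add_left herm_diff_left herm_minus_left herm_scale_left
      herm_scaleR_left add_divide_distrib diff_divide_distrib scaleR_conv_of_real[where 'a=complex])

lemma hform_add_left: "hform c z (u + v) w = hform c z u w + hform c z v w"
  and hform_add_right: "hform c z w (u + v) = hform c z w u + hform c z w v"
  and hform_diff_left: "hform c z (u - v) w = hform c z u w - hform c z v w"
  and hform_diff_right: "hform c z w (u - v) = hform c z w u - hform c z w v"
  and hform_minus_left: "hform c z (- u) w = - hform c z u w"
  and hform_minus_right: "hform c z w (- u) = - hform c z w u"
  and hform_scale_left: "hform c z (a *s u) w = a * hform c z u w"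
  and hform_scale_right: "hform c z w (a *s u) = cnj a * hform c z w u"
  and hform_scaleR_left: "hform c z (r *\<^sub>R u) w = r *\<^sub>R hform c z u w"
  and hform_scaleR_right: "hform c z w (r *\<^sub>R u) = r *\<^sub>R hform c z w u"
  by (simp_all add: hform_def herm_add_left herm_diff_left herm_minus_left herm_scale_left
      herm_scaleR_left herm_add_right herm_diff_right herm_minus_right herm_scale_right
      herm_scaleR_right add_divide_distrib diff_divide_distrib algebra_simps scaleR_conv_of_real[where 'a=complex])

lemma hform_cnj: "cnj (hform c z u w) = hform c z w u"
  by (simp add: hform_def herm_cnj mult.commute)

lemma hform_base: "herm c z z \<noteq> 0 \<Longrightarrow> hform c z z w = 0" "herm c z z \<noteq> 0 \<Longrightarrow> hform c z w z = 0"
  by (simp_all add: hform_def)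

text \<open>Numerator and denominator both scale by \<open>(a * cnj a)\<^sup>2\<close>.
  Geometrically, a tangent vector is a homomorphism from the line to the quotient by it, and
  \<open>(z, v)\<close> and \<open>(a *s z, a *s v)\<close> represent the same one.\<close>

lemma hform_rescale: "a \<noteq> 0 \<Longrightarrow> hform c (a *s z) (a *s v) (a *s w) = hform c z v w"
proof -
  assume "a \<noteq> 0"
  define K where "K = (a * cnj a)\<^sup>2"
  have "K \<noteq> 0" using \<open>a \<noteq> 0\<close> by (simp add: K_def)
  have "hform c (a *s z) (a *s v) (a *s w) =
      (K * (of_real (4 / c) * (herm c v w * herm c z z - herm c v z * herm c z w))) / (K * (herm c z z)\<^sup>2)"
    by (simp add: hform_def herm_scale_left herm_scale_right K_def power2_eq_square algebra_simps)
  then show ?thesis using \<open>K \<noteq> 0\<close> by (simp add: hform_def)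
qed

text \<open>Lagrange's identity writes the Gram determinant as a signed sum of squares of the 2 x 2
  minors \<open>m\<close>. For \<open>c = 4\<close> all signs are positive. For
  \<open>c = -4\<close> the claim is the reversed Cauchy-Schwarz inequality for a negative vector
  \<open>z\<close>: the minor \<open>m 2 3\<close> is dominated by the other two.\<close>

lemma Re_hform_self_pos:
  assumes c: "c = 4 \<or> c = -4" and z: "c * Re (herm c z z) > 0" and v: "\<nexists>a. v = a *s z"
  shows "Re (hform c z v v) > 0"
proof -
  define m where "m i k = v$i * z$k - v$k * z$i" for i k
  define n where "n = Re (herm c z z)"
  have n: "herm c z z = of_real n" using herm_self[of c z] by (simp add: n_def)
  have lagrange: "herm c v v * herm c z z - herm c v z * herm c z v =
      of_real (sgn c * (cmod (m 1 2))\<^sup>2 + sgn c * (cmod (m 1 3))\<^sup>2 + (cmod (m 2 3))\<^sup>2)"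
    using c by (auto simp: herm_def m_def complex_norm_square algebra_simps simp del: of_real_power)
  have "z \<noteq> 0" using z by (auto simp: herm_def)
  have nz: "m 1 2 \<noteq> 0 \<or> m 1 3 \<noteq> 0 \<or> m 2 3 \<noteq> 0"
  proof (rule ccontr)
    assume "\<not> ?thesis"
    then have m: "v$i * z$k = v$k * z$i" for i k
      unfolding m_def using exhaust_3[of i] exhaust_3[of k] by auto
    obtain k where "z$k \<noteq> 0" using \<open>z \<noteq> 0\<close> by (auto simp: vec_eq_iff)
    then have "v = (v$k / z$k) *s z" using m[of _ k] by (auto simp: vec_eq_iff field_simps)
    then show False using v by blast
  qed
  have "4 / c * (sgn c * (cmod (m 1 2))\<^sup>2 + sgn c * (cmod (m 1 3))\<^sup>2 + (cmod (m 2 3))\<^sup>2) > 0"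
    (is "4 / c * ?L > 0")
  proof (cases "c = 4")
    case True
    have "(cmod (m 1 2))\<^sup>2 + (cmod (m 1 3))\<^sup>2 + (cmod (m 2 3))\<^sup>2 > 0"
      using nz by (metis add_nonneg_pos add_pos_nonneg norm_ge_zero zero_le_power2 zero_less_norm_iff
          zero_less_power2 add_nonneg_nonneg norm_eq_zero)
    then show ?thesis using True by simp
  next
    case False
    then have c: "c = -4" using c by simp
    define x y where "x = (cmod (z$2))\<^sup>2 + (cmod (z$3))\<^sup>2" and "y = (cmod (m 1 2))\<^sup>2 + (cmod (m 1 3))\<^sup>2"
    have zz: "x < (cmod (z$1))\<^sup>2"
      using z c by (simp add: herm_def x_def cmod_power2) (simp add: power2_eq_square)
    \<comment> \<open>Expansion of the vanishing determinant with rows \<open>z\<close>,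
      \<open>v\<close>, \<open>z\<close> along a row \<open>z\<close>. Since
      \<open>cmod (z$1)\<close> exceeds the length of the other two coordinates, Cauchy-Schwarz
      turns this into a bound on \<open>m 2 3\<close>.\<close>
    have "z$1 * m 2 3 = z$2 * m 1 3 - z$3 * m 1 2" by (simp add: m_def algebra_simps)
    then have "cmod (z$1) * cmod (m 2 3) \<le> cmod (z$2) * cmod (m 1 3) + cmod (z$3) * cmod (m 1 2)"
      by (metis norm_mult norm_triangle_ineq4)
    then have "(cmod (z$1) * cmod (m 2 3))\<^sup>2 \<le> (cmod (z$2) * cmod (m 1 3) + cmod (z$3) * cmod (m 1 2))\<^sup>2"
      by (intro power_mono) auto
    also have "\<dots> \<le> x * y"
    proof -
      have "x * y - (cmod (z$2) * cmod (m 1 3) + cmod (z$3) * cmod (m 1 2))\<^sup>2 =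
          (cmod (z$2) * cmod (m 1 2) - cmod (z$3) * cmod (m 1 3))\<^sup>2"
        by (simp add: x_def y_def power2_eq_square algebra_simps)
      then show ?thesis by (metis diff_ge_0_iff_ge zero_le_power2)
    qed
    finally have le: "(cmod (z$1))\<^sup>2 * (cmod (m 2 3))\<^sup>2 \<le> x * y" by (simp add: power_mult_distrib)
    have "x \<ge> 0" "y \<ge> 0" by (auto simp: x_def y_def)
    have "y > 0"
    proof (rule ccontr)
      assume "\<not> y > 0"
      then have "y = 0" using \<open>y \<ge> 0\<close> by simp
      then have "m 1 2 = 0" "m 1 3 = 0" by (auto simp: y_def add_nonneg_eq_0_iff)
      moreover have "m 2 3 = 0" using le \<open>y = 0\<close> zz \<open>x \<ge> 0\<close> by (auto simp: mult_le_0_iff)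
      ultimately show False using nz by auto
    qed
    have "(cmod (m 2 3))\<^sup>2 < y"
    proof (rule ccontr)
      assume "\<not> ?thesis"
      then have "x * y < (cmod (z$1))\<^sup>2 * (cmod (m 2 3))\<^sup>2"
        using zz \<open>x \<ge> 0\<close> \<open>y > 0\<close> by (intro mult_less_le_imp_less) auto
      then show False using le by simp
    qed
    then show ?thesis using c by (simp add: y_def)
  qed
  moreover have "n \<noteq> 0" using z by (auto simp: n_def)
  moreover have "hform c z v v = of_real (4 / c * ?L / n\<^sup>2)"
    unfolding hform_def lagrange unfolding n by simp
  ultimately show ?thesis by (simp del: times_divide_eq_left times_divide_eq_right)
qed

lemma Re_of_real_mult: "Re (of_real r * z) = r * Re z"
  by simp

text \<open>Of the terms containing \<open>z' a\<close>, those conjugate linear in it combine to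
  \<open>c / 4\<close> times the metric. This metric term is what survives as the ambient curvature
  in \<open>cov_curvature\<close>.\<close>

lemma rho_has_derivative:
  assumes z: "(z has_derivative z') (at x)" and v: "(v has_derivative v') (at x)"
    and n: "herm c (z x) (z x) \<noteq> 0" and c: "c \<noteq> 0"
  shows "((\<lambda>y. rho c (z y) (v y)) has_derivative (\<lambda>a. rho c (z x) (v' a) +
    of_real (c / 4) * hform c (z x) (v x) (z' a) - rho c (z x) (v x) * rho c (z x) (z' a))) (at x)"
proof -
  note B = bounded_bilinear.FDERIV[OF bounded_bilinear_herm]
  show ?thesis unfolding rho_def
    by (rule has_derivative_eq_rhs[OF has_derivative_divide[OF B[OF v z] B[OF z z] n]])
      (use n c in \<open>simp add: fun_eq_iff hform_def field_simps power2_eq_square\<close>)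
qed

text \<open>Metric compatibility of the connection with correction terms \<open>rho\<close>. It is
  stated for an arbitrary differentiable lift \<open>z\<close>, so that it serves the chart metric,
  fields along an immersion and the comparison of normals alike.\<close>

lemma hform_has_derivative:
  assumes z: "(z has_derivative z') (at x)" and v: "(v has_derivative v') (at x)"
    and w: "(w has_derivative w') (at x)" and n: "herm c (z x) (z x) \<noteq> 0"
  shows "((\<lambda>y. hform c (z y) (v y) (w y)) has_derivative (\<lambda>a.
     hform c (z x) (v' a - rho c (z x) (z' a) *s v x - rho c (z x) (v x) *s z' a) (w x) +
     hform c (z x) (v x) (w' a - rho c (z x) (z' a) *s w x - rho c (z x) (w x) *s z' a))) (at x)"
proof -
  note B = bounded_bilinear.FDERIV[OF bounded_bilinear_herm]
  have cr: "cnj (rho c (z x) u) = herm c (z x) u / herm c (z x) (z x)" for u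
    by (simp add: rho_def herm_cnj)
  show ?thesis unfolding hform_def[abs_def]
    apply (rule has_derivative_eq_rhs[OF has_derivative_divide[OF has_derivative_mult_right[OF
        has_derivative_diff[OF has_derivative_mult[OF B[OF v w] B[OF z z]]
          has_derivative_mult[OF B[OF v z] B[OF z w]]]] has_derivative_power[OF B[OF z z]]]])
    subgoal using n by simp
    subgoal
      unfolding hform_def[symmetric] hform_diff_left hform_diff_right hform_scale_left hform_scale_right cr
      unfolding hform_def rho_def using n
      by (simp add: fun_eq_iff divide_simps power2_eq_square) (simp add: algebra_simps)
    done
qed

lemma smooth_on_herm:
  "open S \<Longrightarrow> smooth_on S v \<Longrightarrow> smooth_on S w \<Longrightarrow> smooth_on S (\<lambda>x. herm c (v x) (w x))"
  by (rule smooth_on_bilinear[OF _ bounded_bilinear_herm])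

lemma smooth_on_rho:
  assumes "open S" "smooth_on S z" "smooth_on S v" "\<And>x. x \<in> S \<Longrightarrow> herm c (z x) (z x) \<noteq> 0"
  shows "smooth_on S (\<lambda>x. rho c (z x) (v x))"
  unfolding rho_def by (intro smooth_on_divide smooth_on_herm assms)

lemma smooth_on_hform:
  assumes "open S" "smooth_on S z" "smooth_on S v" "smooth_on S w"
    and "\<And>x. x \<in> S \<Longrightarrow> herm c (z x) (z x) \<noteq> 0"
  shows "smooth_on S (\<lambda>x. hform c (z x) (v x) (w x))"
  unfolding hform_def power2_eq_square
  by (intro smooth_on_divide smooth_on_mult smooth_on_diff smooth_on_herm smooth_on_const assms)
    (use assms in auto)

lemma hom_vec_nth:
  "hom_vec j a x $ j = a" "hom_vec j a x $ (j + 1) = x$1" "hom_vec j a x $ (j + 2) = x$2"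
  by (simp_all add: hom_vec_def)

lemma hom_vec_add: "hom_vec j 0 (u + v) = hom_vec j 0 u + hom_vec j 0 v"
  and hom_vec_diff: "hom_vec j 0 (u - v) = hom_vec j 0 u - hom_vec j 0 v"
  and hom_vec_minus: "hom_vec j 0 (- u) = - hom_vec j 0 u"
  and hom_vec_scale: "hom_vec j 0 (a *s u) = a *s hom_vec j 0 u"
  and hom_vec_scaleR: "hom_vec j 0 (r *\<^sub>R u) = r *\<^sub>R hom_vec j 0 u"
  by (simp_all add: hom_vec_def vec_eq_iff)

lemma hom_vec_split: "hom_vec j a u = a *s axis j 1 + hom_vec j 0 u"
  by (simp add: hom_vec_def vec_eq_iff axis_def)

lemma hom_vec_eq_iff: "hom_vec j a u = hom_vec j b v \<longleftrightarrow> a = b \<and> u = v"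
proof
  assume *: "hom_vec j a u = hom_vec j b v"
  have "u $ 1 = v $ 1" "u $ 2 = v $ 2" "a = b"
    using arg_cong[OF *, of "\<lambda>w. w $ (j + 1)"] arg_cong[OF *, of "\<lambda>w. w $ (j + 2)"]
      arg_cong[OF *, of "\<lambda>w. w $ j"] by (simp_all only: hom_vec_nth)
  then show "a = b \<and> u = v" by (simp add: vec_eq_iff forall_2)
qed simp

lemma bounded_linear_hom_vec: "bounded_linear (hom_vec j 0)"
  by (rule linear_conv_bounded_linear[THEN iffD1]) (simp add: linear_iff hom_vec_add hom_vec_scaleR)

lemma hom_vec_has_derivative:
  "(F has_derivative F') (at x) \<Longrightarrow> ((\<lambda>y. hom_vec j a (F y)) has_derivative (\<lambda>v. hom_vec j 0 (F' v))) (at x)"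
  unfolding hom_vec_split[of j a]
  by (auto intro!: derivative_eq_intros bounded_linear.has_derivative[OF bounded_linear_hom_vec])

lemma smooth_on_hom_vec: "open S \<Longrightarrow> smooth_on S F \<Longrightarrow> smooth_on S (\<lambda>y. hom_vec j a (F y))"
  unfolding hom_vec_split[of j a]
  by (intro smooth_on_add smooth_on_const smooth_on_linear[OF _ bounded_linear_hom_vec])

lemma kaehler_metric_eq:
  "kaehler_metric c j x v w = Re (hform c (hom_vec j 1 x) (hom_vec j 0 v) (hom_vec j 0 w))"
  unfolding kaehler_metric_def hform_def Let_def times_divide_eq_right[symmetric] Re_of_real_mult
  by (rule refl)

section \<open>Covariant differentiation along an immersion\<close>

lemma D_const [simp]: "D (\<lambda>_. a) x v = 0"
  by (simp add: frechet_derivative_const)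

lemma D_diff:
  assumes "f differentiable (at x)" "g differentiable (at x)"
  shows "D (\<lambda>y. f y - g y) x a = D f x a - D g x a"
  using frechet_derivative_at[OF has_derivative_diff[OF assms[unfolded frechet_derivative_works]]] by metis

lemma D_add:
  assumes "f differentiable (at x)" "g differentiable (at x)"
  shows "D (\<lambda>y. f y + g y) x a = D f x a + D g x a"
  using frechet_derivative_at[OF has_derivative_add[OF assms[unfolded frechet_derivative_works]]] by metis

lemmas D_scale = D_bilinear[OF bounded_bilinear_vector_scalar_mult]

lemma D_cong: "open S \<Longrightarrow> x \<in> S \<Longrightarrow> (\<And>y. y \<in> S \<Longrightarrow> f y = g y) \<Longrightarrow> D f x a = D g x a"
  using frechet_derivative_cong_open[of S x f g] by metis

lemma hom_vec_pos:
  assumes "c = 4 \<or> c = -4" "c * Re (herm c (hom_vec j 1 x) (hom_vec j 1 x)) > 0" "v \<noteq> 0"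
  shows "Re (hform c (hom_vec j 1 x) (hom_vec j 0 v) (hom_vec j 0 v)) > 0"
proof (rule Re_hform_self_pos[OF assms(1,2)])
  show "\<nexists>a. hom_vec j 0 v = a *s hom_vec j 1 x"
  proof
    assume "\<exists>a. hom_vec j 0 v = a *s hom_vec j 1 x"
    then obtain a where a: "hom_vec j 0 v = a *s hom_vec j 1 x" by blast
    from arg_cong[OF this, of "\<lambda>w. w $ j"] have "a = 0" by (simp add: hom_vec_nth)
    with a have "hom_vec j 0 v = hom_vec j 0 0" by (simp add: vec_eq_iff hom_vec_def)
    with assms(3) show False by (simp add: hom_vec_eq_iff)
  qed
qed

lemma christoffel_kaehler_metric:
  assumes c: "c = 4 \<or> c = -4" and pos: "c * Re (herm c (hom_vec j 1 x) (hom_vec j 1 x)) > 0"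
  shows "christoffel (kaehler_metric c j) x v w =
    - (rho c (hom_vec j 1 x) (hom_vec j 0 v) *s w + rho c (hom_vec j 1 x) (hom_vec j 0 w) *s v)"
proof -
  let ?h = "\<lambda>u w. hform c (hom_vec j 1 x) (hom_vec j 0 u) (hom_vec j 0 w)"
  define C where "C v w = - (rho c (hom_vec j 1 x) (hom_vec j 0 v) *s w + rho c (hom_vec j 1 x) (hom_vec j 0 w) *s v)" for v w
  have n: "herm c (hom_vec j 1 x) (hom_vec j 1 x) \<noteq> 0" using pos by auto
  have d: "D (\<lambda>y. kaehler_metric c j y u w) x a = Re (?h (C a u) w + ?h u (C a w))" for u w a
  proof -
    have "((\<lambda>y. kaehler_metric c j y u w) has_derivative (\<lambda>a. Re (?h (C a u) w + ?h u (C a w)))) (at x)"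
      unfolding kaehler_metric_eq
      by (rule has_derivative_eq_rhs[OF bounded_linear.has_derivative[OF bounded_linear_Re
              hform_has_derivative[OF hom_vec_has_derivative[OF has_derivative_ident]
              has_derivative_const has_derivative_const n]]])
        (simp add: fun_eq_iff C_def hom_vec_minus hom_vec_add hom_vec_scale hom_vec_diff
          hform_minus_left hform_minus_right hform_add_left hform_add_right hform_diff_left hform_diff_right)
    from fun_cong[OF frechet_derivative_at[OF this], of a] show ?thesis by (rule sym)
  qed
  have sym: "Re (?h u w) = Re (?h w u)" for u w
    using hform_cnj[of c _ "hom_vec j 0 u" "hom_vec j 0 w"] by (metis cnj.simps(1))
  have C_sym: "C u w = C w u" for u w by (simp add: C_def add.commute)
  \<comment> \<open>Each metric derivative splits into two terms with \<open>C\<close>. By the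
    symmetry of \<open>C\<close> and of the metric everything cancels except two copies of
    \<open>C v w\<close> paired with \<open>z\<close>.\<close>
  have koszul: "(D (\<lambda>y. kaehler_metric c j y w z) x v + D (\<lambda>y. kaehler_metric c j y v z) x w
      - D (\<lambda>y. kaehler_metric c j y v w) x z) / 2 = kaehler_metric c j x (C v w) z" for z
    unfolding d
    unfolding kaehler_metric_eq
    using sym[of w "C v z"] sym[of v "C w z"] C_sym[of z v] C_sym[of z w] C_sym[of v w] sym[of v "C z w"]
    by simp
  have "christoffel (kaehler_metric c j) x v w = C v w"
    unfolding christoffel_def koszul
  proof (rule the_equality)
    fix u assume u: "\<forall>z. kaehler_metric c j x u z = kaehler_metric c j x (C v w) z"
    have "Re (?h (u - C v w) (u - C v w)) = 0"
      using u[rule_format, of "u - C v w"]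
      by (simp add: kaehler_metric_eq hom_vec_diff hform_diff_left)
    then show "u = C v w" using hom_vec_pos[OF c pos, of "u - C v w"] by force
  qed simp
  then show ?thesis by (simp add: C_def)
qed

section \<open>The ambient connection along a coordinate patch\<close>

locale hypersurface_patch =
  fixes c :: real and j :: 3 and S :: "(real^3) set" and F N :: "real^3 \<Rightarrow> complex^2"
  assumes c: "c = 4 \<or> c = -4" and S: "open S" and F: "smooth_on S F"
    and inj: "x \<in> S \<Longrightarrow> inj (D F x)"
    and pos: "x \<in> S \<Longrightarrow> c * Re (herm c (hom_vec j 1 (F x)) (hom_vec j 1 (F x))) > 0"
    and N: "unit_normal (kaehler_metric c j) F S N"
begin

abbreviation "G \<equiv> kaehler_metric c j"
abbreviation "g \<equiv> induced_metric G F"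

definition h :: "real^3 \<Rightarrow> complex^2 \<Rightarrow> complex^2 \<Rightarrow> complex" where
  "h x v w = hform c (hom_vec j 1 (F x)) (hom_vec j 0 v) (hom_vec j 0 w)"

definition con :: "real^3 \<Rightarrow> complex^2 \<Rightarrow> complex" where
  "con x v = rho c (hom_vec j 1 (F x)) (hom_vec j 0 v)"

text \<open>The ambient Levi-Civita derivative pulled back along \<open>F\<close>. Its argument is a
  field along the map, tangent or not, so that one operator differentiates \<open>N\<close>,
  \<open>E\<close> and the coordinate fields.\<close>

definition cov :: "real^3 \<Rightarrow> (real^3 \<Rightarrow> complex^2) \<Rightarrow> real^3 \<Rightarrow> complex^2" where
  "cov a V x = D V x a - con x (D F x a) *s V x - con x (V x) *s D F x a"

lemma G_eq: "G (F x) v w = Re (h x v w)"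
  by (simp add: h_def kaehler_metric_eq)

lemma h_add_left: "h x (u + v) w = h x u w + h x v w"
  and h_add_right: "h x w (u + v) = h x w u + h x w v"
  and h_diff_left: "h x (u - v) w = h x u w - h x v w"
  and h_diff_right: "h x w (u - v) = h x w u - h x w v"
  and h_minus_left: "h x (- u) w = - h x u w"
  and h_minus_right: "h x w (- u) = - h x w u"
  and h_scale_left: "h x (a *s u) w = a * h x u w"
  and h_scale_right: "h x w (a *s u) = cnj a * h x w u"
  and h_scaleR_left: "h x (r *\<^sub>R u) w = r *\<^sub>R h x u w"
  and h_scaleR_right: "h x w (r *\<^sub>R u) = r *\<^sub>R h x w u"
  by (simp_all add: h_def hom_vec_add hom_vec_diff hom_vec_minus hom_vec_scale hom_vec_scaleR
      hform_add_left hform_add_right hform_diff_left hform_diff_right hform_minus_left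
      hform_minus_right hform_scale_left hform_scale_right hform_scaleR_left hform_scaleR_right)

lemmas h_simps = h_add_left h_add_right h_diff_left h_diff_right h_minus_left h_minus_right
  h_scale_left h_scale_right h_scaleR_left h_scaleR_right

lemma h_cnj: "cnj (h x u v) = h x v u"
  by (simp add: h_def hform_cnj)

lemma h_pos: "x \<in> S \<Longrightarrow> v \<noteq> 0 \<Longrightarrow> Re (h x v v) > 0"
  unfolding h_def by (rule hom_vec_pos[OF c pos])

lemma con_simps: "con x (u + v) = con x u + con x v" "con x (u - v) = con x u - con x v"
    "con x (- u) = - con x u" "con x (a *s u) = a * con x u"
  by (simp_all add: con_def hom_vec_add hom_vec_diff hom_vec_minus hom_vec_scale
      rho_add rho_diff rho_minus rho_scale)

lemma herm_nz: "x \<in> S \<Longrightarrow> herm c (hom_vec j 1 (F x)) (hom_vec j 1 (F x)) \<noteq> 0"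
  using pos by fastforce

lemma smooth_h: "smooth_on S V \<Longrightarrow> smooth_on S W \<Longrightarrow> smooth_on S (\<lambda>y. h y (V y) (W y))"
  unfolding h_def by (intro smooth_on_hform smooth_on_hom_vec S F herm_nz)

lemma smooth_con: "smooth_on S V \<Longrightarrow> smooth_on S (\<lambda>y. con y (V y))"
  unfolding con_def by (intro smooth_on_rho smooth_on_hom_vec S F herm_nz)

lemma smooth_cov: "smooth_on S V \<Longrightarrow> smooth_on S (cov a V)"
  unfolding cov_def[abs_def]
  by (intro smooth_on_diff smooth_on_vector_scalar_mult smooth_con smooth_on_D S F)

lemma smooth_N: "smooth_on S N"
  using N by (simp add: unit_normal_def)

lemma h_has_derivative:
  assumes x: "x \<in> S" and V: "V differentiable (at x)" and W: "W differentiable (at x)"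
  shows "((\<lambda>y. h y (V y) (W y)) has_derivative (\<lambda>a. h x (cov a V x) (W x) + h x (V x) (cov a W x))) (at x)"
  unfolding h_def cov_def con_def
  by (rule has_derivative_eq_rhs[OF hform_has_derivative[OF
        hom_vec_has_derivative[OF smooth_on_has_derivative[OF F x]]
        hom_vec_has_derivative[OF V[unfolded frechet_derivative_works]]
        hom_vec_has_derivative[OF W[unfolded frechet_derivative_works]] herm_nz[OF x]]])
    (simp add: hom_vec_diff hom_vec_scale)

lemma D_h:
  assumes "x \<in> S" "V differentiable (at x)" "W differentiable (at x)"
  shows "D (\<lambda>y. h y (V y) (W y)) x a = h x (cov a V x) (W x) + h x (V x) (cov a W x)"
  by (rule fun_cong[OF frechet_derivative_at[OF h_has_derivative[OF assms]], of a, symmetric])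

lemma D_con:
  assumes x: "x \<in> S" and V: "V differentiable (at x)"
  shows "D (\<lambda>y. con y (V y)) x a =
    con x (D V x a) + of_real (c / 4) * h x (V x) (D F x a) - con x (V x) * con x (D F x a)"
proof -
  have "((\<lambda>y. con y (V y)) has_derivative (\<lambda>a. con x (D V x a) +
      of_real (c / 4) * h x (V x) (D F x a) - con x (V x) * con x (D F x a))) (at x)"
    unfolding h_def con_def
    by (rule rho_has_derivative[OF
        hom_vec_has_derivative[OF smooth_on_has_derivative[OF F x]]
        hom_vec_has_derivative[OF V[unfolded frechet_derivative_works]] herm_nz[OF x]]) (use c in auto)
  from fun_cong[OF frechet_derivative_at[OF this], of a] show ?thesis by (rule sym)
qed

text \<open>Torsion-freeness: the correction terms are symmetric in the two directions and second
  derivatives commute.\<close>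

lemma cov_D_F: "x \<in> S \<Longrightarrow> cov a (\<lambda>y. D F y b) x = cov b (\<lambda>y. D F y a) x"
  by (simp add: cov_def second_derivative_symmetric[OF S _ F, of x b a] algebra_simps)

text \<open>The derivatives of \<open>V\<close> cancel and only the metric term of
  \<open>D_con\<close> remains. The right-hand side is the curvature tensor of constant holomorphic
  sectional curvature \<open>c\<close>, its five real terms rewritten with the Hermitian form
  \<open>h\<close>.\<close>

lemma cov_curvature:
  assumes x: "x \<in> S" and V: "smooth_on S V"
  shows "cov a (cov b V) x - cov b (cov a V) x =
    of_real (c / 4) *s (h x (V x) (D F x b) *s D F x a - h x (V x) (D F x a) *s D F x b
      + (h x (D F x a) (D F x b) - h x (D F x b) (D F x a)) *s V x)"
proof -
  note df = smooth_on_differentiable[OF _ x]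
  have eq: "D (cov b V) x a = D (\<lambda>y. D V y b) x a
      - (con x (D F x b) *s D V x a + D (\<lambda>y. con y (D F y b)) x a *s V x)
      - (con x (V x) *s D (\<lambda>y. D F y b) x a + D (\<lambda>y. con y (V y)) x a *s D F x b)" for a b
  proof -
    note sm = smooth_on_D[OF V, of b] smooth_con[OF smooth_on_D[OF F, of b]] smooth_con[OF V]
      smooth_on_D[OF F, of b]
      smooth_on_vector_scalar_mult[OF S smooth_con[OF smooth_on_D[OF F, of b]] V]
      smooth_on_vector_scalar_mult[OF S smooth_con[OF V] smooth_on_D[OF F, of b]]
      smooth_on_diff[OF S smooth_on_D[OF V, of b] smooth_on_vector_scalar_mult[OF S smooth_con[OF smooth_on_D[OF F, of b]] V]]
    show ?thesis
      unfolding cov_def[abs_def]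
      by (simp add: D_diff D_scale sm[THEN df] V[THEN df])
  qed
  have dc: "D (\<lambda>y. con y (D F y b)) x a = con x (D (\<lambda>y. D F y b) x a) +
      of_real (c / 4) * h x (D F x b) (D F x a) - con x (D F x b) * con x (D F x a)" for a b
    by (rule D_con[OF x df[OF smooth_on_D[OF F]]])
  note dV = D_con[OF x df[OF V]]
  show ?thesis
    unfolding cov_def[of _ "cov _ V"] eq dc dV second_derivative_symmetric[OF S x F, of b a]
      second_derivative_symmetric[OF S x V, of b a]
    by (simp add: cov_def con_simps vec_eq_iff algebra_simps)
qed

end

section \<open>Moving frames and structure equations\<close>

lemma smooth_on_cross3:
  "open S \<Longrightarrow> smooth_on S f \<Longrightarrow> smooth_on S g \<Longrightarrow> smooth_on S (\<lambda>x. cross3 (f x) (g x))"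
  by (rule smooth_on_bilinear) (simp_all add: bilinear_cross bilinear_conv_bounded_bilinear[symmetric])

lemma linear_axis_expansion:
  fixes f :: "real^3 \<Rightarrow> 'b::real_vector"
  assumes "linear f"
  shows "f a = (\<Sum>i\<in>UNIV. (a $ i) *\<^sub>R f (axis i 1))"
proof -
  have eq: "(\<Sum>i\<in>UNIV. (a $ i) *\<^sub>R axis i 1) = a" by (simp add: vec_eq_iff axis_def if_distrib cong: if_cong)
  have "f (\<Sum>i\<in>UNIV. (a $ i) *\<^sub>R axis i 1) = (\<Sum>i\<in>UNIV. (a $ i) *\<^sub>R f (axis i 1))"
    by (simp add: linear_sum[OF assms] linear_cmul[OF assms])
  then show ?thesis unfolding eq .
qed

context hypersurface_patch begin

text \<open>The coefficients of the complex linear form \<open>h x _ (N x)\<close>, swapped and with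
  one sign changed, so that the form vanishes on the vector. It is smooth and never zero, hence
  spans the complex line orthogonal to \<open>N\<close> on the whole patch.\<close>

definition E0 :: "real^3 \<Rightarrow> complex^2" where
  "E0 x = (\<chi> k. if k = 1 then - h x (axis 2 1) (N x) else h x (axis 1 1) (N x))"

definition E :: "real^3 \<Rightarrow> complex^2" where
  "E x = inverse (sqrt (Re (h x (E0 x) (E0 x)))) *\<^sub>R E0 x"

lemma h_self: "h x v v = of_real (Re (h x v v))"
  using h_cnj[of x v v] by (simp add: complex_eq_iff)

lemma h_components: "h x v w = v $ 1 * h x (axis 1 1) w + v $ 2 * h x (axis 2 1) w"
proof -
  have "v = v $ 1 *s axis 1 1 + v $ 2 *s axis 2 1"
    by (simp add: vec_eq_iff forall_2 axis_def)
  then show ?thesis by (metis h_add_left h_scale_left)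
qed

lemma h_E0_N: "h x (E0 x) (N x) = 0"
  using h_components[of x "E0 x" "N x"] by (simp add: E0_def)

lemma h_N_N: "x \<in> S \<Longrightarrow> h x (N x) (N x) = 1"
  using N h_self[of x "N x"] by (simp add: unit_normal_def G_eq)

lemma Re_h_T_N: "x \<in> S \<Longrightarrow> Re (h x (D F x a) (N x)) = 0"
  using N h_cnj[of x "D F x a" "N x"] by (simp add: unit_normal_def G_eq) (metis cnj.simps(1))

lemma E0_nz: assumes "x \<in> S" shows "E0 x \<noteq> 0"
proof
  assume "E0 x = 0"
  then have "h x (axis 2 1) (N x) = 0" "h x (axis 1 1) (N x) = 0"
    by (auto simp: E0_def vec_eq_iff forall_2)
  then have "h x (N x) (N x) = 0" using h_components[of x "N x" "N x"] by simp
  then show False using h_N_N[OF assms] by simp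
qed

lemma h_E_N: "h x (E x) (N x) = 0" and h_N_E: "h x (N x) (E x) = 0"
proof -
  show "h x (E x) (N x) = 0" by (simp add: E_def h_simps h_E0_N)
  then show "h x (N x) (E x) = 0" using h_cnj[of x "E x" "N x"] by simp
qed

lemma h_E_E: assumes "x \<in> S" shows "h x (E x) (E x) = 1"
proof -
  define s where "s = Re (h x (E0 x) (E0 x))"
  have "s > 0" using h_pos[OF assms E0_nz[OF assms]] by (simp add: s_def)
  have "h x (E x) (E x) = of_real (inverse (sqrt s) * inverse (sqrt s) * s)"
    using h_self[of x "E0 x"] by (simp add: E_def h_simps s_def[symmetric] scaleR_conv_of_real[where 'a=complex])
  also have "inverse (sqrt s) * inverse (sqrt s) * s = 1"
    using \<open>s > 0\<close> by (simp add: field_simps)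
  finally show ?thesis by simp
qed

lemma frame_expansion: assumes x: "x \<in> S" shows "v = h x v (E x) *s E x + h x v (N x) *s N x"
proof -
  define d where "d = v - (h x v (E x) *s E x + h x v (N x) *s N x)"
  define l where "l k = h x (axis k 1) (N x)" for k
  have hd: "h x d (E x) = 0" "h x d (N x) = 0"
    by (simp_all add: d_def h_simps h_E_E[OF x] h_E_N h_N_E h_N_N[OF x])
  have "d $ 1 * l 1 + d $ 2 * l 2 = 0" using h_components[of x d "N x"] hd by (simp add: l_def)
  have "E0 x $ 1 = - l 2" "E0 x $ 2 = l 1" by (simp_all add: E0_def l_def)
  moreover have "l 1 \<noteq> 0 \<or> l 2 \<noteq> 0"
    using E0_nz[OF x] calculation by (auto simp: vec_eq_iff forall_2)
  \<comment> \<open>\<open>d\<close> lies in the kernel of a nonzero linear form in two variables,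
    which is the line of \<open>E0 x\<close>; the cases only decide by which coefficient to
    divide.\<close>
  ultimately obtain k where k: "d = k *s E0 x"
  proof (cases "l 1 = 0")
    case True
    then have "l 2 \<noteq> 0" "d $ 2 = 0" using \<open>l 1 \<noteq> 0 \<or> l 2 \<noteq> 0\<close> \<open>d $ 1 * l 1 + d $ 2 * l 2 = 0\<close> by auto
    then have "d = (- d $ 1 / l 2) *s E0 x"
      using True \<open>E0 x $ 1 = - l 2\<close> \<open>E0 x $ 2 = l 1\<close> by (simp add: vec_eq_iff forall_2)
    then show ?thesis using that by blast
  next
    case False
    then have "d $ 1 = - (d $ 2 * l 2) / l 1"
      using \<open>d $ 1 * l 1 + d $ 2 * l 2 = 0\<close> by (simp add: field_simps eq_neg_iff_add_eq_0)
    then have "d = (d $ 2 / l 1) *s E0 x"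
      using False \<open>E0 x $ 1 = - l 2\<close> \<open>E0 x $ 2 = l 1\<close> by (simp add: vec_eq_iff forall_2)
    then show ?thesis using that by blast
  qed
  have "h x d d = 0"
  proof -
    have "E0 x = sqrt (Re (h x (E0 x) (E0 x))) *\<^sub>R E x"
      using h_pos[OF x E0_nz[OF x]] by (simp add: E_def)
    then have "h x d (E0 x) = 0" using hd by (metis h_scaleR_right scaleR_zero_right)
    then show ?thesis using k by (metis h_scale_right mult_zero_right)
  qed
  then have "d = 0" using h_pos[OF x, of d] by force
  then show ?thesis by (simp add: d_def)
qed

text \<open>The tangent vector \<open>a\<close> is mapped to \<open>th(a) E - \<i> et(a) N\<close>, so \<open>et = \<eta>\<close>; since the frame is unitary, the
  covariant derivatives of \<open>N\<close> and \<open>E\<close> along \<open>a\<close> are \<open>p(a) E + \<i> q(a) N\<close> and \<open>\<i> r(a) E - cnj p(a) N\<close>.\<close>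

definition th :: "real^3 \<Rightarrow> real^3 \<Rightarrow> complex" where "th x a = h x (D F x a) (E x)"
definition et :: "real^3 \<Rightarrow> real^3 \<Rightarrow> real" where "et x a = - Im (h x (D F x a) (N x))"
definition p :: "real^3 \<Rightarrow> real^3 \<Rightarrow> complex" where "p x a = h x (cov a N x) (E x)"
definition q :: "real^3 \<Rightarrow> real^3 \<Rightarrow> real" where "q x a = Im (h x (cov a N x) (N x))"
definition r :: "real^3 \<Rightarrow> real^3 \<Rightarrow> real" where "r x a = Im (h x (cov a E x) (E x))"

lemma smooth_E0: "smooth_on S E0"
proof (rule smooth_on_vec_lambda[OF S])
  fix i :: 2
  show "smooth_on S (\<lambda>x. E0 x $ i)"
    by (cases "i = 1") (auto simp: E0_def intro!: smooth_on_minus smooth_h smooth_N S smooth_on_const)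
qed

lemma smooth_E: "smooth_on S E"
  unfolding E_def[abs_def]
  by (intro smooth_on_scaleR smooth_on_inverse smooth_on_sqrt smooth_on_Re smooth_h smooth_E0 S)
    (use h_pos E0_nz in force)+

lemma diff_N: "x \<in> S \<Longrightarrow> N differentiable (at x)"
  and diff_E: "x \<in> S \<Longrightarrow> E differentiable (at x)"
  and diff_T: "x \<in> S \<Longrightarrow> (\<lambda>y. D F y a) differentiable (at x)"
  and diff_cov: "x \<in> S \<Longrightarrow> smooth_on S V \<Longrightarrow> cov a V differentiable (at x)"
  using smooth_on_differentiable smooth_N smooth_E smooth_on_D[OF F] smooth_cov by blast+

lemma smooth_th: "smooth_on S (\<lambda>x. th x a)"
  and smooth_et: "smooth_on S (\<lambda>x. et x a)"
  and smooth_p: "smooth_on S (\<lambda>x. p x a)"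
  and smooth_q: "smooth_on S (\<lambda>x. q x a)"
  and smooth_r: "smooth_on S (\<lambda>x. r x a)"
  unfolding th_def et_def p_def q_def r_def
  by (intro smooth_h smooth_on_minus smooth_on_Im smooth_cov smooth_on_D F smooth_E smooth_N S)+

lemma T_eq: assumes x: "x \<in> S" shows "D F x a = th x a *s E x - (\<i> * of_real (et x a)) *s N x"
proof -
  have "h x (D F x a) (N x) = - (\<i> * of_real (et x a))"
    using Re_h_T_N[OF x, of a] by (simp add: et_def complex_eq_iff)
  then show ?thesis
    using frame_expansion[OF x, of "D F x a"]
    by (simp add: th_def vec_eq_iff)
qed

lemma T_linear: "x \<in> S \<Longrightarrow> linear (D F x)"
  by (rule linear_frechet_derivative[OF smooth_on_differentiable[OF F]])

lemma cov_dir: 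
  assumes "x \<in> S" "V differentiable (at x)"
  shows "cov (a + b) V x = cov a V x + cov b V x" "cov (k *\<^sub>R a) V x = k *\<^sub>R cov a V x"
proof -
  note l = linear_add[OF T_linear[OF assms(1)]] linear_cmul[OF T_linear[OF assms(1)]]
    linear_add[OF linear_frechet_derivative[OF assms(2)]] linear_cmul[OF linear_frechet_derivative[OF assms(2)]]
  have "con x (k *\<^sub>R v) = k *\<^sub>R con x v" for v by (simp add: con_def hom_vec_scaleR rho_scaleR)
  then show "cov (k *\<^sub>R a) V x = k *\<^sub>R cov a V x"
    unfolding cov_def l
    by (simp add: vec_eq_iff scaleR_conv_of_real[where 'a=complex] algebra_simps)
  show "cov (a + b) V x = cov a V x + cov b V x"
    unfolding cov_def l con_simps by (simp add: vec_eq_iff algebra_simps)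
qed

lemma forms_linear:
  assumes x: "x \<in> S"
  shows "linear (th x)" "linear (et x)" "linear (p x)" "linear (q x)" "linear (r x)"
  using linear_add[OF T_linear[OF x]] linear_cmul[OF T_linear[OF x]]
  by (auto intro!: linearI simp: th_def et_def p_def q_def r_def cov_dir[OF x diff_N[OF x]]
      cov_dir[OF x diff_E[OF x]] h_simps)

text \<open>Metric compatibility applied to a constant product. For the frame fields it makes the
  connection matrix skew-Hermitian, which is why the three forms \<open>p\<close>, \<open>q\<close>,
  \<open>r\<close> describe it completely.\<close>

lemma h_constant_cov:
  assumes x: "x \<in> S" and V: "V differentiable (at x)" and W: "W differentiable (at x)"
    and k: "\<And>y. y \<in> S \<Longrightarrow> h y (V y) (W y) = k"
  shows "h x (cov a V x) (W x) = - h x (V x) (cov a W x)"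
proof -
  have "D (\<lambda>y. h y (V y) (W y)) x a = D (\<lambda>_. k) x a" by (rule D_cong[OF S x k])
  then show ?thesis using D_h[OF x V W] by (simp add: eq_neg_iff_add_eq_0)
qed

lemma imaginary_form: "z = - cnj z \<Longrightarrow> z = \<i> * of_real (Im z)"
  by (simp add: complex_eq_iff)

lemma h_cov:
  assumes x: "x \<in> S"
  shows "h x (cov a N x) (N x) = \<i> * of_real (q x a)" "h x (cov a N x) (E x) = p x a"
    "h x (cov a E x) (N x) = - cnj (p x a)" "h x (cov a E x) (E x) = \<i> * of_real (r x a)"
proof -
  have "h x (cov a N x) (N x) = - cnj (h x (cov a N x) (N x))"
    using h_constant_cov[OF x diff_N[OF x] diff_N[OF x] h_N_N] by (simp add: h_cnj)
  then show "h x (cov a N x) (N x) = \<i> * of_real (q x a)"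
    unfolding q_def by (rule imaginary_form)
  have "h x (cov a E x) (E x) = - cnj (h x (cov a E x) (E x))"
    using h_constant_cov[OF x diff_E[OF x] diff_E[OF x] h_E_E] by (simp add: h_cnj)
  then show "h x (cov a E x) (E x) = \<i> * of_real (r x a)"
    unfolding r_def by (rule imaginary_form)
  show "h x (cov a E x) (N x) = - cnj (p x a)"
    using h_constant_cov[OF x diff_E[OF x] diff_N[OF x] h_E_N] by (simp add: p_def h_cnj)
qed (simp add: p_def)

lemma cov_N: "x \<in> S \<Longrightarrow> cov a N x = p x a *s E x + (\<i> * of_real (q x a)) *s N x"
  and cov_E: "x \<in> S \<Longrightarrow> cov a E x = (\<i> * of_real (r x a)) *s E x - cnj (p x a) *s N x"
  using frame_expansion[of x "cov a N x"] frame_expansion[of x "cov a E x"] 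
  by (simp_all add: h_cov vector_smult_lneg)

lemmas frame_h = h_E_E h_E_N h_N_E h_N_N

section \<open>Structure equations of the frame\<close>

lemma d_th:
  assumes x: "x \<in> S"
  shows "D (\<lambda>y. th y b) x a = h x (cov a (\<lambda>y. D F y b) x) (E x) - \<i> * of_real (r x a) * th x b
    + \<i> * p x a * of_real (et x b)"
  unfolding th_def
  by (simp add: D_h[OF x diff_T[OF x] diff_E[OF x]] cov_E[OF x] h_simps T_eq[OF x] frame_h x algebra_simps)

lemma structure_th:
  assumes x: "x \<in> S"
  shows "D (\<lambda>y. th y b) x a - D (\<lambda>y. th y a) x b =
    - \<i> * (of_real (r x a) * th x b - of_real (r x b) * th x a)
    + \<i> * (p x a * of_real (et x b) - p x b * of_real (et x a))"
  unfolding d_th[OF x] cov_D_F[OF x, of a b] by (simp add: algebra_simps)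

lemma d_h_T_N:
  assumes x: "x \<in> S"
  shows "D (\<lambda>y. h y (D F y b) (N y)) x a = h x (cov a (\<lambda>y. D F y b) x) (N x) + cnj (p x a) * th x b
    - of_real (q x a * et x b)"
  by (simp add: D_h[OF x diff_T[OF x] diff_N[OF x]] cov_N[OF x] h_simps T_eq[OF x] frame_h x algebra_simps)

text \<open>Both parts carry content, because \<open>h y (D F y b) (N y)\<close> is purely
  imaginary: the imaginary part gives the exterior derivative of \<open>et\<close>, and the real
  part, whose left side vanishes, gives the symmetry of the shape operator.\<close>

lemma structure_N:
  assumes x: "x \<in> S"
  shows "D (\<lambda>y. h y (D F y b) (N y)) x a - D (\<lambda>y. h y (D F y a) (N y)) x b =
    cnj (p x a) * th x b - cnj (p x b) * th x a - of_real (q x a * et x b - q x b * et x a)"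
  unfolding d_h_T_N[OF x] cov_D_F[OF x, of a b] by (simp add: algebra_simps)

lemma smooth_h_T_N: "smooth_on S (\<lambda>y. h y (D F y b) (N y))"
  by (intro smooth_h smooth_on_D F smooth_N)

lemma D_et: assumes "x \<in> S" shows "D (\<lambda>y. et y b) x a = - Im (D (\<lambda>y. h y (D F y b) (N y)) x a)"
  using D_linear[OF bounded_linear_minus[OF bounded_linear_Im] smooth_on_differentiable[OF smooth_h_T_N assms]]
  by (simp add: et_def)

lemma structure_et:
  assumes x: "x \<in> S"
  shows "D (\<lambda>y. et y b) x a - D (\<lambda>y. et y a) x b = - Im (cnj (p x a) * th x b - cnj (p x b) * th x a)"
  using arg_cong[OF structure_N[OF x, of b a], of Im] by (simp add: D_et[OF x])

lemma shape_symmetric: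
  assumes x: "x \<in> S"
  shows "q x a * et x b - q x b * et x a = Re (cnj (p x a) * th x b - cnj (p x b) * th x a)"
proof -
  have "Re (D (\<lambda>y. h y (D F y b) (N y)) x a) = 0" for a b
  proof -
    have "D (\<lambda>y. Re (h y (D F y b) (N y))) x a = D (\<lambda>_. 0) x a"
      by (rule D_cong[OF S x Re_h_T_N])
    then show ?thesis
      using D_linear[OF bounded_linear_Re smooth_on_differentiable[OF smooth_h_T_N x]] by simp
  qed
  with arg_cong[OF structure_N[OF x, of b a], of Re] show ?thesis by simp
qed

lemma h_T_T: "x \<in> S \<Longrightarrow> h x (D F x a) (D F x b) = th x a * cnj (th x b) + of_real (et x a * et x b)"
  by (simp add: T_eq h_simps frame_h algebra_simps)

lemma h_N_T: "x \<in> S \<Longrightarrow> h x (N x) (D F x b) = \<i> * of_real (et x b)"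
  and h_T_N: "x \<in> S \<Longrightarrow> h x (D F x b) (N x) = - \<i> * of_real (et x b)"
  and h_E_T: "x \<in> S \<Longrightarrow> h x (E x) (D F x b) = cnj (th x b)"
  and h_T_E: "x \<in> S \<Longrightarrow> h x (D F x b) (E x) = th x b"
  by (simp_all add: T_eq h_simps frame_h)

lemma d_p:
  assumes x: "x \<in> S"
  shows "D (\<lambda>y. p y b) x a = h x (cov a (cov b N) x) (E x) - \<i> * of_real (r x a) * p x b
    - \<i> * of_real (q x b) * p x a"
  unfolding p_def[of _ b]
  by (simp add: D_h[OF x diff_cov[OF x smooth_N] diff_E[OF x]] cov_E[OF x] cov_N[OF x] h_simps frame_h x algebra_simps)

lemma d_iq:
  assumes x: "x \<in> S"
  shows "D (\<lambda>y. h y (cov b N y) (N y)) x a = h x (cov a (cov b N) x) (N x) + p x b * cnj (p x a)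
    + of_real (q x b * q x a)"
  by (simp add: D_h[OF x diff_cov[OF x smooth_N] diff_N[OF x]] cov_E[OF x] cov_N[OF x] h_simps frame_h x algebra_simps)

lemma d_ir:
  assumes x: "x \<in> S"
  shows "D (\<lambda>y. h y (cov b E y) (E y)) x a = h x (cov a (cov b E) x) (E x) + cnj (p x b) * p x a
    + of_real (r x b * r x a)"
  by (simp add: D_h[OF x diff_cov[OF x smooth_E] diff_E[OF x]] cov_E[OF x] cov_N[OF x] h_simps frame_h x algebra_simps)

text \<open>The \<open>E\<close>-component of the ambient curvature acting on \<open>N\<close>;
  together with the \<open>N\<close>-component in \<open>structure_q\<close> it forms the Codazzi
  equation.\<close>

lemma structure_p:
  assumes x: "x \<in> S"
  shows "D (\<lambda>y. p y b) x a - D (\<lambda>y. p y a) x b =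
    - \<i> * (of_real (r x a) * p x b - of_real (r x b) * p x a) - \<i> * (of_real (q x b) * p x a - of_real (q x a) * p x b)
    + of_real (c / 4) * \<i> * (of_real (et x b) * th x a - of_real (et x a) * th x b)"
proof -
  have "h x (cov a (cov b N) x) (E x) - h x (cov b (cov a N) x) (E x) =
      of_real (c / 4) * \<i> * (of_real (et x b) * th x a - of_real (et x a) * th x b)"
    unfolding h_diff_left[symmetric] cov_curvature[OF x smooth_N]
    by (simp add: h_simps frame_h x h_N_T h_T_E del: of_real_divide) (simp add: algebra_simps)
  then show ?thesis by (simp add: d_p[OF x] algebra_simps del: of_real_divide)
qed

lemma D_q: assumes "x \<in> S" shows "D (\<lambda>y. q y b) x a = Im (D (\<lambda>y. h y (cov b N y) (N y)) x a)"
  using D_linear[OF bounded_linear_Im smooth_on_differentiable[OF smooth_h[OF smooth_cov[OF smooth_N] smooth_N] assms]]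
  by (simp add: q_def)

lemma D_r: assumes "x \<in> S" shows "D (\<lambda>y. r y b) x a = Im (D (\<lambda>y. h y (cov b E y) (E y)) x a)"
  using D_linear[OF bounded_linear_Im smooth_on_differentiable[OF smooth_h[OF smooth_cov[OF smooth_E] smooth_E] assms]]
  by (simp add: r_def)

lemma structure_q:
  assumes x: "x \<in> S"
  shows "D (\<lambda>y. q y b) x a - D (\<lambda>y. q y a) x b =
    - 2 * Im (p x a * cnj (p x b)) + c / 2 * Im (th x a * cnj (th x b))"
proof -
  have "Im (h x (cov a (cov b N) x) (N x)) - Im (h x (cov b (cov a N) x) (N x)) =
      c / 2 * Im (th x a * cnj (th x b))"
    unfolding minus_complex.sel[symmetric] h_diff_left[symmetric] cov_curvature[OF x smooth_N]
    by (simp add: h_simps frame_h x h_N_T h_T_N h_T_T del: of_real_divide) (simp add: field_simps)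
  then show ?thesis by (simp add: D_q[OF x] d_iq[OF x] algebra_simps)
qed

text \<open>The component of the Gauss equation that the trace in \<open>star_ricci_eq\<close> uses.
  It has \<open>c\<close> where \<open>structure_q\<close> has \<open>c / 2\<close>: for
  \<open>E\<close> the two direct terms of \<open>cov_curvature\<close> contribute as much as the
  term proportional to the field, while for \<open>N\<close> they are symmetric in \<open>a\<close>
  and \<open>b\<close> and cancel.\<close>

lemma structure_r:
  assumes x: "x \<in> S"
  shows "D (\<lambda>y. r y b) x a - D (\<lambda>y. r y a) x b =
    2 * Im (p x a * cnj (p x b)) + c * Im (th x a * cnj (th x b))"
proof -
  have "Im (h x (cov a (cov b E) x) (E x)) - Im (h x (cov b (cov a E) x) (E x)) =
      c * Im (th x a * cnj (th x b))"
    unfolding minus_complex.sel[symmetric] h_diff_left[symmetric] cov_curvature[OF x smooth_E]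
    by (simp add: h_simps frame_h x h_E_T h_T_E h_T_T del: of_real_divide) (simp add: field_simps)
  then show ?thesis by (simp add: D_r[OF x] d_ir[OF x] field_simps)
qed

section \<open>The frame dual to the coframe\<close>

lemma coframe_inj:
  assumes x: "x \<in> S" and "th x a = th x b" "et x a = et x b"
  shows "a = b"
  using inj[OF x] assms T_eq[OF x] by (metis injD)

definition row :: "real^3 \<Rightarrow> 3 \<Rightarrow> real^3" where
  "row x k = (\<chi> i. if k = 1 then Re (th x (axis i 1)) else if k = 2 then Im (th x (axis i 1)) else et x (axis i 1))"

lemma row_inner:
  assumes x: "x \<in> S"
  shows "row x 1 \<bullet> a = Re (th x a)" "row x 2 \<bullet> a = Im (th x a)" "row x 3 \<bullet> a = et x a"
proof -
  have *: "(\<chi> i. f (axis i 1)) \<bullet> a = f a" if "linear f" for f :: "real^3 \<Rightarrow> real"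
    by (simp add: linear_axis_expansion[OF that, of a] inner_vec_def mult.commute)
  show "row x 1 \<bullet> a = Re (th x a)" "row x 2 \<bullet> a = Im (th x a)" "row x 3 \<bullet> a = et x a"
    using *[OF linear_compose[OF forms_linear(1)[OF x] bounded_linear.linear[OF bounded_linear_Re]]]
      *[OF linear_compose[OF forms_linear(1)[OF x] bounded_linear.linear[OF bounded_linear_Im]]]
      *[OF forms_linear(2)[OF x]] by (simp_all add: row_def)
qed

definition vol :: "real^3 \<Rightarrow> real" where "vol x = row x 1 \<bullet> cross3 (row x 2) (row x 3)"

text \<open>The reciprocal basis of the vectors \<open>row\<close>, written by Cramer's rule with
  cross products so that smoothness is immediate. Indices are taken modulo 3. The third vector is
  the structure vector field \<xi>.\<close>

definition fr :: "real^3 \<Rightarrow> 3 \<Rightarrow> real^3" where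
  "fr x k = inverse (vol x) *\<^sub>R cross3 (row x (k + 1)) (row x (k + 2))"

lemma vol_nz: assumes x: "x \<in> S" shows "vol x \<noteq> 0"
proof
  assume "vol x = 0"
  then have "det (vector [row x 1, row x 2, row x 3] :: real^3^3) = 0"
    by (simp add: vol_def dot_cross_det)
  then obtain a where "a \<noteq> 0" "(vector [row x 1, row x 2, row x 3] :: real^3^3) *v a = 0"
    using invertible_det_nz invertible_left_inverse matrix_left_invertible_ker by metis
  then have "row x 1 \<bullet> a = 0" "row x 2 \<bullet> a = 0" "row x 3 \<bullet> a = 0"
    by (auto simp: vec_eq_iff forall_3 matrix_vector_mult_def inner_vec_def)
  then have "th x a = th x 0" "et x a = et x 0"
    using linear_0[OF forms_linear(1)[OF x]] linear_0[OF forms_linear(2)[OF x]]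
    by (simp_all add: row_inner[OF x] complex_eq_iff)
  then show False using coframe_inj[OF x] \<open>a \<noteq> 0\<close> by blast
qed

lemma fr_dual:
  assumes x: "x \<in> S"
  shows "th x (fr x 1) = 1" "et x (fr x 1) = 0" "th x (fr x 2) = \<i>" "et x (fr x 2) = 0"
    "th x (fr x 3) = 0" "et x (fr x 3) = 1"
proof -
  have *: "(2::3) + 1 = 3" "(2::3) + 2 = 1" "(3::3) + 1 = 1" "(3::3) + 2 = 2" "(1::3) + 1 = 2" "(1::3) + 2 = 3"
    by simp_all
  have cyc: "row x 2 \<bullet> cross3 (row x 3) (row x 1) = vol x" "row x 3 \<bullet> cross3 (row x 1) (row x 2) = vol x"
    by (simp_all add: vol_def cross3_simps)
  show "th x (fr x 1) = 1" "et x (fr x 1) = 0" "th x (fr x 2) = \<i>" "et x (fr x 2) = 0"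
    "th x (fr x 3) = 0" "et x (fr x 3) = 1"
    unfolding complex_eq_iff row_inner[OF x, symmetric] fr_def *
    using vol_nz[OF x] cyc by (simp_all add: dot_cross_self vol_def[symmetric])
qed

definition frame_vec :: "real^3 \<Rightarrow> complex \<Rightarrow> real \<Rightarrow> real^3" where
  "frame_vec x u t = Re u *\<^sub>R fr x 1 + Im u *\<^sub>R fr x 2 + t *\<^sub>R fr x 3"

lemma th_vec: assumes x: "x \<in> S" shows "th x (frame_vec x u t) = u" 
  and et_vec: "et x (frame_vec x u t) = t"
  using linear_add[OF forms_linear(1)[OF x]] linear_cmul[OF forms_linear(1)[OF x]]
    linear_add[OF forms_linear(2)[OF x]] linear_cmul[OF forms_linear(2)[OF x]]
  by (simp_all add: frame_vec_def fr_dual[OF x] complex_eq_iff)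

lemma eq_vec: "x \<in> S \<Longrightarrow> th x a = u \<Longrightarrow> et x a = t \<Longrightarrow> a = frame_vec x u t"
  using coframe_inj th_vec et_vec by metis

lemma smooth_row: "smooth_on S (\<lambda>x. row x k)"
proof (rule smooth_on_vec_lambda[OF S])
  fix i :: 3
  show "smooth_on S (\<lambda>x. row x k $ i)"
    by (cases "k = 1"; cases "k = 2") (auto simp: row_def intro!: smooth_on_Re smooth_on_Im smooth_th smooth_et S)
qed

lemma smooth_fr: "smooth_on S (\<lambda>x. fr x k)"
  unfolding fr_def vol_def
  by (intro smooth_on_scaleR smooth_on_inverse smooth_on_bilinear[OF S bounded_bilinear_inner]
      smooth_on_cross3 smooth_row S) (use vol_nz vol_def in auto)

lemma smooth_vec: "smooth_on S u \<Longrightarrow> smooth_on S t \<Longrightarrow> smooth_on S (\<lambda>x. frame_vec x (u x) (t x))"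
  unfolding frame_vec_def by (intro smooth_on_add smooth_on_scaleR smooth_on_Re smooth_on_Im smooth_fr S)

end

section \<open>Intrinsic geometry and the $^{*}$-Ricci tensor\<close>

context hypersurface_patch begin

lemma smooth_form_field:
  fixes f :: "real^3 \<Rightarrow> real^3 \<Rightarrow> 'b::euclidean_space"
  assumes lin: "\<And>y. y \<in> S \<Longrightarrow> linear (f y)" and sm: "\<And>b. smooth_on S (\<lambda>y. f y b)" and Y: "smooth_on S Y"
  shows "smooth_on S (\<lambda>y. f y (Y y))"
  by (rule smooth_on_cong[OF S, where f = "\<lambda>y. \<Sum>i\<in>UNIV. (Y y $ i) *\<^sub>R f y (axis i 1)"])
    (auto simp: linear_axis_expansion[OF lin, symmetric] intro!: smooth_on_sum smooth_on_scaleR smooth_on_vec_nth sm Y S)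

text \<open>Smoothness of \<open>f y b\<close> in \<open>y\<close> is available for each fixed
  \<open>b\<close>, so the field is expanded in coordinates and the product rule applied term by
  term.\<close>

lemma D_form_field:
  fixes f :: "real^3 \<Rightarrow> real^3 \<Rightarrow> 'b::euclidean_space"
  assumes lin: "\<And>y. y \<in> S \<Longrightarrow> linear (f y)" and sm: "\<And>b. smooth_on S (\<lambda>y. f y b)"
    and x: "x \<in> S" and Y: "Y differentiable (at x)"
  shows "D (\<lambda>y. f y (Y y)) x a = D (\<lambda>y. f y (Y x)) x a + f x (D Y x a)"
proof -
  note h = smooth_on_has_derivative[OF sm x]
  have Yi: "((\<lambda>y. Y y $ i) has_derivative (\<lambda>a. D Y x a $ i)) (at x)" for i
    by (rule bounded_linear.has_derivative[OF bounded_linear_vec_nth]) (use Y frechet_derivative_works in blast)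
  have "((\<lambda>y. \<Sum>i\<in>UNIV. (Y y $ i) *\<^sub>R f y (axis i 1)) has_derivative
      (\<lambda>a. \<Sum>i\<in>UNIV. (Y x $ i) *\<^sub>R D (\<lambda>y. f y (axis i 1)) x a + (D Y x a $ i) *\<^sub>R f x (axis i 1))) (at x)"
    by (intro has_derivative_sum has_derivative_scaleR Yi h)
  from fun_cong[OF frechet_derivative_at[OF this], of a]
  have 1: "D (\<lambda>y. \<Sum>i\<in>UNIV. (Y y $ i) *\<^sub>R f y (axis i 1)) x a =
      (\<Sum>i\<in>UNIV. (Y x $ i) *\<^sub>R D (\<lambda>y. f y (axis i 1)) x a) + f x (D Y x a)"
    by (simp add: sum.distrib linear_axis_expansion[OF lin[OF x], of "D Y x a"])
  have "((\<lambda>y. \<Sum>i\<in>UNIV. (Y x $ i) *\<^sub>R f y (axis i 1)) has_derivative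
      (\<lambda>a. \<Sum>i\<in>UNIV. (Y x $ i) *\<^sub>R D (\<lambda>y. f y (axis i 1)) x a)) (at x)"
    by (intro has_derivative_sum has_derivative_scaleR_right h)
  from fun_cong[OF frechet_derivative_at[OF this], of a]
  have 2: "D (\<lambda>y. \<Sum>i\<in>UNIV. (Y x $ i) *\<^sub>R f y (axis i 1)) x a =
      (\<Sum>i\<in>UNIV. (Y x $ i) *\<^sub>R D (\<lambda>y. f y (axis i 1)) x a)" by simp
  have "D (\<lambda>y. f y (Y y)) x a = D (\<lambda>y. \<Sum>i\<in>UNIV. (Y y $ i) *\<^sub>R f y (axis i 1)) x a"
    by (rule D_cong[OF S x]) (rule linear_axis_expansion[OF lin])
  moreover have "D (\<lambda>y. f y (Y x)) x a = D (\<lambda>y. \<Sum>i\<in>UNIV. (Y x $ i) *\<^sub>R f y (axis i 1)) x a"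
    by (rule D_cong[OF S x]) (rule linear_axis_expansion[OF lin])
  ultimately show ?thesis using 1 2 by simp
qed

section \<open>Connection and curvature of the induced metric\<close>

lemma g_h: "g x v w = Re (h x (D F x v) (D F x w))"
  by (simp add: induced_metric_def G_eq)

lemma g_eq: "x \<in> S \<Longrightarrow> g x v w = Re (th x v * cnj (th x w)) + et x v * et x w"
  by (simp add: g_h h_T_T)

text \<open>Three frame vectors as test vectors recover both components of a tangent vector. This
  evaluates the \<open>THE\<close> in \<open>christoffel\<close> and in
  \<open>star_ricci_op\<close>.\<close>

lemma the_g:
  assumes x: "x \<in> S" and \<Phi>: "\<And>w. \<Phi> w = g x s w"
  shows "(THE s. \<forall>w. g x s w = \<Phi> w) = s"
proof (rule the_equality)
  fix s' assume s': "\<forall>w. g x s' w = \<Phi> w"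
  have e: "Re (th x s' * cnj (th x w)) + et x s' * et x w = Re (th x s * cnj (th x w)) + et x s * et x w" for w
    using s' \<Phi> by (simp add: g_eq[OF x])
  have "th x s' = th x s" "et x s' = et x s"
    using e[of "frame_vec x 1 0"] e[of "frame_vec x \<i> 0"] e[of "frame_vec x 0 1"]
    by (auto simp: th_vec[OF x] et_vec[OF x] complex_eq_iff)
  then show "s' = s" by (rule coframe_inj[OF x])
qed (simp add: \<Phi>)

text \<open>The Gauss formula: the Koszul expression is the real product of \<open>K a b\<close>,
  the ambient derivative of a coordinate field, with \<open>D F x z\<close>, so the intrinsic
  derivative is the tangential part of \<open>K a b\<close>.\<close>

lemma christoffel_g:
  assumes x: "x \<in> S"
  shows "th x (christoffel g x a b) = D (\<lambda>y. th y b) x a + \<i> * of_real (r x a) * th x b - \<i> * p x a * of_real (et x b)"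
    and "et x (christoffel g x a b) = D (\<lambda>y. et y b) x a + Im (cnj (p x a) * th x b)"
proof -
  define K where "K a b = cov a (\<lambda>y. D F y b) x" for a b
  have sym: "K a b = K b a" for a b unfolding K_def by (rule cov_D_F[OF x])
  have d: "D (\<lambda>y. g y v w) x a = Re (h x (K a v) (D F x w)) + Re (h x (K a w) (D F x v))" for a v w
  proof -
    have "D (\<lambda>y. g y v w) x a = Re (D (\<lambda>y. h y (D F y v) (D F y w)) x a)"
      unfolding g_h
      by (rule D_linear[OF bounded_linear_Re smooth_on_differentiable[OF smooth_h x]])
        (intro smooth_on_D F)+
    moreover have "Re (h x (D F x v) (K a w)) = Re (h x (K a w) (D F x v))"
      by (metis h_cnj cnj.simps(1))
    ultimately show ?thesis
      by (simp add: D_h[OF x diff_T[OF x] diff_T[OF x]] K_def)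
  qed
  define s where "s = frame_vec x (h x (K a b) (E x)) (- Im (h x (K a b) (N x)))"
  have "christoffel g x a b = s"
    unfolding christoffel_def
  proof (rule the_g[OF x])
    fix z
    have "(D (\<lambda>y. g y b z) x a + D (\<lambda>y. g y a z) x b - D (\<lambda>y. g y a b) x z) / 2 = Re (h x (K a b) (D F x z))"
      unfolding d using sym by simp
    also have "h x (K a b) (D F x z) = h x (K a b) (E x) * cnj (th x z) + \<i> * of_real (et x z) * h x (K a b) (N x)"
      by (simp add: T_eq[OF x, of z] h_simps)
    finally show "(D (\<lambda>y. g y b z) x a + D (\<lambda>y. g y a z) x b - D (\<lambda>y. g y a b) x z) / 2 = g x s z"
      by (simp add: g_eq[OF x] s_def th_vec[OF x] et_vec[OF x])
  qed
  then show "th x (christoffel g x a b) = D (\<lambda>y. th y b) x a + \<i> * of_real (r x a) * th x b - \<i> * p x a * of_real (et x b)"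
    "et x (christoffel g x a b) = D (\<lambda>y. et y b) x a + Im (cnj (p x a) * th x b)"
    by (simp_all add: s_def th_vec[OF x] et_vec[OF x] d_th[OF x] D_et[OF x] d_h_T_N[OF x] K_def)
qed

text \<open>The derivative of the form at frozen argument, contributed by
  \<open>christoffel_g\<close>, completes \<open>th x (D Y x a)\<close> to \<open>D u x a\<close>.
  What is left of the connection are the terms with \<open>r\<close> and \<open>p\<close>.\<close>

lemma nabla_g:
  assumes x: "x \<in> S" and Y: "Y differentiable (at x)"
    and u: "\<And>y. y \<in> S \<Longrightarrow> th y (Y y) = u y" and t: "\<And>y. y \<in> S \<Longrightarrow> et y (Y y) = t y"
  shows "th x (nabla g a Y x) = D u x a + \<i> * of_real (r x a) * u x - \<i> * p x a * of_real (t x)"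
    and "et x (nabla g a Y x) = D t x a + Im (cnj (p x a) * u x)"
proof -
  have "D u x a = D (\<lambda>y. th y (Y y)) x a" "D t x a = D (\<lambda>y. et y (Y y)) x a"
    using u t by (auto intro!: D_cong[OF S x])
  then show "th x (nabla g a Y x) = D u x a + \<i> * of_real (r x a) * u x - \<i> * p x a * of_real (t x)"
    "et x (nabla g a Y x) = D t x a + Im (cnj (p x a) * u x)"
    using u[OF x] t[OF x] D_form_field[OF forms_linear(1) smooth_th x Y, of a]
      D_form_field[OF forms_linear(2) smooth_et x Y, of a]
    by (simp_all add: nabla_def linear_add[OF forms_linear(1)[OF x]] linear_add[OF forms_linear(2)[OF x]]
        christoffel_g[OF x])
qed

lemma smooth_forms_diff:
  assumes "x \<in> S"
  shows "(\<lambda>y. th y a) differentiable (at x)" "(\<lambda>y. et y a) differentiable (at x)"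
    "(\<lambda>y. p y a) differentiable (at x)" "(\<lambda>y. q y a) differentiable (at x)" "(\<lambda>y. r y a) differentiable (at x)"
    "(\<lambda>y. D (\<lambda>z. th z a) y b) differentiable (at x)" "(\<lambda>y. D (\<lambda>z. et z a) y b) differentiable (at x)"
  using smooth_on_differentiable[OF _ assms] smooth_th smooth_et smooth_p smooth_q smooth_r smooth_on_D by blast+

lemma D_mult:
  fixes f g :: "'a::euclidean_space \<Rightarrow> 'b::{real_normed_field, euclidean_space}"
  shows "f differentiable (at x) \<Longrightarrow> g differentiable (at x) \<Longrightarrow> D (\<lambda>y. f y * g y) x a = f x * D g x a + D f x a * g x"
  by (rule D_bilinear[OF bounded_bilinear_mult])

text \<open>Cartan's second structure equation: second derivatives of \<open>th\<close> and
  \<open>et\<close> cancel by symmetry, and the curvature is the exterior derivative of the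
  connection forms plus their quadratic terms.\<close>

lemma curvature_g:
  assumes x: "x \<in> S"
  shows "th x (curvature g x a b w) =
      \<i> * of_real (D (\<lambda>y. r y b) x a - D (\<lambda>y. r y a) x b) * th x w
      - \<i> * (D (\<lambda>y. p y b) x a - D (\<lambda>y. p y a) x b) * of_real (et x w)
      + (of_real (r x a) * p x b - of_real (r x b) * p x a) * of_real (et x w)
      - \<i> * (p x a * of_real (Im (cnj (p x b) * th x w)) - p x b * of_real (Im (cnj (p x a) * th x w)))" (is ?th)
    and "et x (curvature g x a b w) =
      Im (cnj (D (\<lambda>y. p y b) x a - D (\<lambda>y. p y a) x b) * th x w)
      + Im (\<i> * (of_real (r x b) * cnj (p x a) - of_real (r x a) * cnj (p x b)) * th x w)
      - Im (\<i> * (cnj (p x a) * p x b - cnj (p x b) * p x a)) * et x w" (is ?et)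
proof -
  define u where "u b y = D (\<lambda>y. th y w) y b + \<i> * of_real (r y b) * th y w - \<i> * p y b * of_real (et y w)" for b y
  define t where "t b y = D (\<lambda>y. et y w) y b + Im (cnj (p y b) * th y w)" for b y
  define U where "U b = nabla g b (\<lambda>_. w)" for b
  have U: "th y (U b y) = u b y" "et y (U b y) = t b y" if "y \<in> S" for b y
    using christoffel_g[OF that, of b w] by (simp_all add: U_def nabla_def u_def t_def)
  have "smooth_on S (u b)" "smooth_on S (t b)" for b
    unfolding u_def t_def
    by (intro smooth_on_add smooth_on_diff smooth_on_mult smooth_on_Im smooth_on_cnj smooth_on_of_real smooth_on_D smooth_on_const
        smooth_th smooth_et smooth_p smooth_r S)+
  then have "smooth_on S (\<lambda>y. frame_vec y (u b y) (t b y))" for b by (rule smooth_vec)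
  then have "smooth_on S (U b)" for b
    by (rule smooth_on_cong[OF S]) (simp add: eq_vec[OF _ U])
  then have dU: "U b differentiable (at x)" for b using smooth_on_differentiable x by blast
  have R: "curvature g x a b w = nabla g a (U b) x - nabla g b (U a) x"
    by (simp add: curvature_def U_def)
  note d = smooth_forms_diff[OF x]
  note of_real_d = D_linear[OF bounded_linear_of_real]
  have df: "(\<lambda>y. of_real (f y) :: complex) differentiable (at x)" if "f differentiable (at x)" for f :: "real^3 \<Rightarrow> real"
    using differentiable_compose[of of_real f x] that bounded_linear_imp_differentiable[OF bounded_linear_of_real]
    by (metis bounded_linear.has_derivative bounded_linear_of_real differentiable_def)
  have du: "D (u b) x a = D (\<lambda>y. D (\<lambda>y. th y w) y b) x a
      + \<i> * (of_real (r x b) * D (\<lambda>y. th y w) x a + of_real (D (\<lambda>y. r y b) x a) * th x w)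
      - \<i> * (p x b * of_real (D (\<lambda>y. et y w) x a) + D (\<lambda>y. p y b) x a * of_real (et x w))" for a b
    unfolding u_def[abs_def]
    by (simp add: D_add D_diff D_mult of_real_d d df mult.assoc)
  have dcnj: "(\<lambda>y. cnj (p y b)) differentiable (at x)" for b
    using d(3)[of b] bounded_linear.has_derivative[OF bounded_linear_cnj] unfolding differentiable_def by blast
  have dt: "D (t b) x a = D (\<lambda>y. D (\<lambda>y. et y w) y b) x a
      + Im (cnj (p x b) * D (\<lambda>y. th y w) x a + cnj (D (\<lambda>y. p y b) x a) * th x w)" for a b
  proof -
    have "(\<lambda>y. cnj (p y b) * th y w) differentiable (at x)"
      by (intro differentiable_mult dcnj d)
    moreover from this have "(\<lambda>y. Im (cnj (p y b) * th y w)) differentiable (at x)"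
      using bounded_linear.has_derivative[OF bounded_linear_Im] unfolding differentiable_def by blast
    ultimately show ?thesis
      unfolding t_def[abs_def]
      by (simp only: D_add D_mult D_linear[OF bounded_linear_Im] D_linear[OF bounded_linear_cnj] d dcnj)
  qed
  have sym: "D (\<lambda>y. D (\<lambda>y. th y w) y b) x a = D (\<lambda>y. D (\<lambda>y. th y w) y a) x b"
    "D (\<lambda>y. D (\<lambda>y. et y w) y b) x a = D (\<lambda>y. D (\<lambda>y. et y w) y a) x b"
    using second_derivative_symmetric[OF S x] smooth_th smooth_et by blast+
  note n = nabla_g[OF x dU U, simplified]
  show ?th
    unfolding R linear_diff[OF forms_linear(1)[OF x]] n du sym(1)
    by (simp add: u_def t_def algebra_simps)
  show ?et
    unfolding R linear_diff[OF forms_linear(2)[OF x]] n dt sym(2)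
    by (simp add: u_def t_def algebra_simps)
qed

lemma linear_by_forms:
  assumes x: "x \<in> S" and "linear (\<lambda>w. th x (L w))" "linear (\<lambda>w. et x (L w))"
  shows "linear L"
proof (rule linearI)
  show "L (u + v) = L u + L v" for u v
    by (rule coframe_inj[OF x]) (simp_all add: linear_add[OF assms(2)] linear_add[OF assms(3)]
        linear_add[OF forms_linear(1)[OF x]] linear_add[OF forms_linear(2)[OF x]])
  show "L (k *\<^sub>R v) = k *\<^sub>R L v" for k v
    by (rule coframe_inj[OF x]) (simp_all add: linear_cmul[OF assms(2)] linear_cmul[OF assms(3)]
        linear_cmul[OF forms_linear(1)[OF x]] linear_cmul[OF forms_linear(2)[OF x]])
qed

lemma linear_curvature: "x \<in> S \<Longrightarrow> linear (curvature g x a b)"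
  by (rule linear_by_forms; (assumption | rule linearI))
    (simp_all add: curvature_g linear_add[OF forms_linear(1)] linear_add[OF forms_linear(2)]
      linear_cmul[OF forms_linear(1)] linear_cmul[OF forms_linear(2)] scaleR_conv_of_real[where 'a=complex] algebra_simps)

text \<open>\<open>matrix\<close> refers to the coordinate basis, whereas the operators are known
  only on the frame. Expanding the coordinate vectors in \<open>fr\<close> rewrites the trace with
  the dual pair \<open>row\<close>, \<open>fr\<close>.\<close>

lemma trace_frame:
  assumes x: "x \<in> S" and L: "linear L"
  shows "trace (matrix L) = Re (th x (L (fr x 1))) + Im (th x (L (fr x 2))) + et x (L (fr x 3))"
proof -
  have ax: "axis i 1 = row x 1 $ i *\<^sub>R fr x 1 + row x 2 $ i *\<^sub>R fr x 2 + row x 3 $ i *\<^sub>R fr x 3" for i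
    using eq_vec[OF x refl refl, of "axis i 1"] by (simp add: frame_vec_def row_def)
  have "L (axis i 1) $ i = (row x 1 $ i) * L (fr x 1) $ i + (row x 2 $ i) * L (fr x 2) $ i + (row x 3 $ i) * L (fr x 3) $ i" for i
    by (subst ax) (simp only: linear_add[OF L] linear_cmul[OF L] vector_add_component vector_scaleR_component real_scaleR_def)
  then have "trace (matrix L) = row x 1 \<bullet> L (fr x 1) + row x 2 \<bullet> L (fr x 2) + row x 3 \<bullet> L (fr x 3)"
    by (simp add: trace_def matrix_def inner_vec_def sum.distrib)
  then show ?thesis by (simp add: row_inner[OF x])
qed

section \<open>Structure tensors and the star-Ricci tensor in the frame\<close>

lemma pull_T: "x \<in> S \<Longrightarrow> D F x v = y \<Longrightarrow> pull F x y = v"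
  unfolding pull_def using inj by (auto intro!: the_equality dest: injD)

lemma T_vec: "x \<in> S \<Longrightarrow> D F x (frame_vec x u t) = u *s E x - (\<i> * of_real t) *s N x"
  by (simp add: T_eq th_vec et_vec)

lemma xi_eq: "x \<in> S \<Longrightarrow> xi F N x = frame_vec x 0 1"
  unfolding xi_def by (rule pull_T) (simp_all add: T_vec vec_eq_iff)

lemma eta_eq: "x \<in> S \<Longrightarrow> eta G F N x v = et x v"
  by (simp add: eta_def xi_eq g_eq th_vec et_vec)

lemma phi_eq: "x \<in> S \<Longrightarrow> phi G F N x v = frame_vec x (\<i> * th x v) 0"
  unfolding phi_def eta_eq
  by (rule pull_T) (simp_all add: T_vec T_eq[of x v] vec_eq_iff algebra_simps scaleR_conv_of_real[where 'a=complex])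

lemma shape_eq: 
  assumes x: "x \<in> S" shows "shape G F N x v = frame_vec x (- p x v) (q x v)"
  unfolding shape_def
proof (rule pull_T[OF x])
  have *: "D N x v + christoffel G (F x) (D F x v) (N x) = cov v N x"
    by (simp add: christoffel_kaehler_metric[OF c pos[OF x]] cov_def con_def)
  show "D F x (frame_vec x (- p x v) (q x v)) = - (D N x v + christoffel G (F x) (D F x v) (N x))"
    unfolding * T_vec[OF x] cov_N[OF x] by (simp add: vec_eq_iff)
qed

text \<open>The operator under the trace factors through \<open>phi\<close>, which kills \<xi>, so
  only curvature on the holomorphic distribution counts. Inserting \<open>structure_r\<close> turns
  the coefficient of \<open>Im (p x v * cnj (p x b))\<close> in the trace from 2 into 2 - 4 =
  -2.\<close>

lemma star_ricci_eq:
  assumes x: "x \<in> S"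
  shows "star_ricci G F N x v w = c * Re (th x v * cnj (th x w)) - Im (p x v * cnj (p x (frame_vec x (\<i> * th x w) 0)))"
proof -
  define b where "b = frame_vec x (\<i> * th x w) 0"
  define L where "L z = curvature g x v b (frame_vec x (\<i> * th x z) 0)" for z
  have lphi: "linear (\<lambda>z. frame_vec x (\<i> * th x z) 0)"
    by (rule linear_by_forms[OF x]; rule linearI)
      (simp_all add: th_vec[OF x] et_vec[OF x] linear_add[OF forms_linear(1)[OF x]] linear_cmul[OF forms_linear(1)[OF x]]
        algebra_simps)
  have L: "linear L"
    using linear_compose[OF lphi linear_curvature[OF x]] unfolding L_def comp_def .
  have L3: "L (fr x 3) = 0"
    using linear_0[OF linear_curvature[OF x]] by (simp add: L_def fr_dual[OF x] frame_vec_def)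
  have tr: "th x (curvature g x v b (frame_vec x z 0)) =
      \<i> * of_real (D (\<lambda>y. r y b) x v - D (\<lambda>y. r y v) x b) * z
      - \<i> * (p x v * of_real (Im (cnj (p x b) * z)) - p x b * of_real (Im (cnj (p x v) * z)))" for z
    by (simp add: curvature_g[OF x] th_vec[OF x] et_vec[OF x])
  have "trace (matrix L) = - 2 * (D (\<lambda>y. r y b) x v - D (\<lambda>y. r y v) x b) + 2 * Im (p x v * cnj (p x b))"
    using linear_0[OF forms_linear(2)[OF x]] L3
    by (simp add: trace_frame[OF x L] L_def fr_dual[OF x] tr algebra_simps)
  also have "\<dots> = - 2 * Im (p x v * cnj (p x b)) - 2 * c * Im (th x v * cnj (\<i> * th x w))"
    unfolding structure_r[OF x] by (simp add: b_def th_vec[OF x] algebra_simps)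
  finally have tL: "trace (matrix L) = - 2 * Im (p x v * cnj (p x b)) - 2 * c * Im (th x v * cnj (\<i> * th x w))" .
  have "star_ricci G F N x v w = trace (matrix L) / 2"
    unfolding star_ricci_def phi_eq[OF x] L_def[abs_def] b_def by (rule refl)
  also have "\<dots> = c * Re (th x v * cnj (th x w)) - Im (p x v * cnj (p x b))"
    unfolding tL by (simp add: field_simps)
  finally show ?thesis unfolding b_def .
qed

text \<open>The components of \<open>p\<close> in the coframe \<open>th\<close>, \<open>cnj th\<close>, \<open>et\<close>; the hypersurface is Hopf iff \<open>s = 0\<close>, and then
  \<open>-2P\<close> and \<open>P\<^sup>2 - |Q|\<^sup>2 = kap - c\<close> are the trace and the determinant of the shape operator on the holomorphic
  distribution.\<close>

definition P :: "real^3 \<Rightarrow> complex" where "P x = (p x (fr x 1) - \<i> * p x (fr x 2)) / 2"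
definition Q :: "real^3 \<Rightarrow> complex" where "Q x = (p x (fr x 1) + \<i> * p x (fr x 2)) / 2"
definition s :: "real^3 \<Rightarrow> complex" where "s x = p x (fr x 3)"
definition al :: "real^3 \<Rightarrow> real" where "al x = q x (fr x 3)"
definition kap :: "real^3 \<Rightarrow> real" where "kap x = c + (Re (P x))\<^sup>2 - (cmod (Q x))\<^sup>2"
definition m :: "real^3 \<Rightarrow> complex" where "m x = s x * P x - cnj (s x) * Q x"

lemma smooth_scalars:
  "smooth_on S P" "smooth_on S Q" "smooth_on S s" "smooth_on S al" "smooth_on S kap" "smooth_on S m"
proof -
  note * = smooth_form_field[OF forms_linear(3) smooth_p smooth_fr]
    smooth_form_field[OF forms_linear(4) smooth_q smooth_fr]
  show 1: "smooth_on S P" "smooth_on S Q" "smooth_on S s" "smooth_on S al"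
    unfolding P_def[abs_def] Q_def[abs_def] s_def[abs_def] al_def[abs_def]
    by (intro smooth_on_divide smooth_on_diff smooth_on_add smooth_on_mult smooth_on_const * S; simp)+
  show "smooth_on S m"
    unfolding m_def[abs_def] by (intro smooth_on_diff smooth_on_mult smooth_on_cnj 1 S)
  have "kap = (\<lambda>x. c + Re (P x) * Re (P x) - (Re (Q x) * Re (Q x) + Im (Q x) * Im (Q x)))"
    by (simp add: kap_def fun_eq_iff cmod_power2) (simp add: power2_eq_square)
  then show "smooth_on S kap"
    by (simp only:) (intro smooth_on_diff smooth_on_add smooth_on_mult smooth_on_Re smooth_on_Im smooth_on_const 1 S)
qed

lemma p_eq:
  assumes x: "x \<in> S" shows "p x a = P x * th x a + Q x * cnj (th x a) + s x * of_real (et x a)"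
proof -
  have "p x a = p x (frame_vec x (th x a) (et x a))" using eq_vec[OF x refl refl, of a] by simp
  also have "\<dots> = of_real (Re (th x a)) * p x (fr x 1) + of_real (Im (th x a)) * p x (fr x 2) + of_real (et x a) * s x"
    by (simp add: frame_vec_def linear_add[OF forms_linear(3)[OF x]] linear_cmul[OF forms_linear(3)[OF x]] s_def
        scaleR_conv_of_real[where 'a=complex])
  also have "\<dots> = P x * th x a + Q x * cnj (th x a) + s x * of_real (et x a)"
    by (simp add: P_def Q_def complex_eq_iff field_simps)
  finally show ?thesis .
qed

text \<open>Symmetry of the shape operator on the holomorphic distribution, where it acts as
  \<open>- (P w + Q cnj w)\<close>: the \<open>Q\<close> part is always symmetric, the
  \<open>P\<close> part only for real \<open>P\<close>.\<close>

lemma Im_P: assumes x: "x \<in> S" shows "Im (P x) = 0"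
  using shape_symmetric[OF x, of "fr x 1" "fr x 2"]
  by (simp add: p_eq[OF x] fr_dual[OF x])

text \<open>Symmetry again: the \<xi>-component of \<open>A X\<close> is the product of
  \<open>A \<xi>\<close> with \<open>X\<close>, so \<open>q\<close> is determined by
  \<open>al\<close> and \<open>s\<close>.\<close>

lemma q_eq: assumes x: "x \<in> S" shows "q x a = al x * et x a - Re (cnj (s x) * th x a)"
  using shape_symmetric[OF x, of a "fr x 3"]
  by (simp add: al_def p_eq[OF x, of "fr x 3"] fr_dual[OF x] algebra_simps)

lemma star_ricci_op_eq:
  assumes x: "x \<in> S"
  shows "star_ricci_op G F N x v = frame_vec x (of_real (kap x) * th x v + m x * of_real (et x v)) 0"
  unfolding star_ricci_op_def
proof (rule the_g[OF x])
  fix w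
  have P: "P x = of_real (Re (P x))" using Im_P[OF x] by (simp add: complex_eq_iff)
  show "star_ricci G F N x v w = g x (frame_vec x (of_real (kap x) * th x v + m x * of_real (et x v)) 0) w"
    unfolding star_ricci_eq[OF x] g_eq[OF x] th_vec[OF x] et_vec[OF x] p_eq[OF x] kap_def m_def cmod_power2
    using Im_P[OF x] by (simp add: algebra_simps power2_eq_square)
qed

section \<open>Consequences of parallelism along \<xi>\<close>

lemma nabla_cong: "x \<in> S \<Longrightarrow> (\<And>y. y \<in> S \<Longrightarrow> Y y = Z y) \<Longrightarrow> nabla g a Y x = nabla g a Z x"
  unfolding nabla_def using D_cong[OF S] by metis

text \<open>Constant fields \<open>w\<close> with \<open>et x w = 0\<close> are used as test fields.
  The terms with \<open>r\<close> and with derivatives of the coframe occur on both sides and drop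
  out; the two components leave two algebraic equations at \<open>x\<close>.\<close>

lemma xi_parallel_imp:
  assumes x: "x \<in> S"
    and par: "\<And>X. smooth_on S X \<Longrightarrow> nabla g (xi F N x) (\<lambda>y. star_ricci_op G F N y (X y)) x =
      star_ricci_op G F N x (nabla g (xi F N x) X x)"
  shows "s x = 0" and "D kap x (xi F N x) = 0"
proof -
  define \<xi> where "\<xi> = xi F N x"
  have \<xi>: "p x \<xi> = s x" by (simp add: \<xi>_def p_eq[OF x] xi_eq[OF x] th_vec[OF x] et_vec[OF x])
  have eqs: "of_real (D kap x \<xi>) * th x w = m x * of_real (Im (cnj (s x) * th x w))"
      "Im (cnj (s x) * (of_real (kap x) * th x w)) = 0" if w: "et x w = 0" for w
  proof -
    \<comment> \<open>\<open>et y w\<close> vanishes at \<open>x\<close> but in general not nearby,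
      so it has to stay in \<open>u\<close>: its derivative contributes.\<close>
    define u where "u y = of_real (kap y) * th y w + m y * of_real (et y w)" for y
    define Y where "Y y = frame_vec y (u y) 0" for y
    have "smooth_on S u" unfolding u_def
      by (intro smooth_on_add smooth_on_mult smooth_on_of_real smooth_scalars smooth_th smooth_et S)
    then have "smooth_on S Y" unfolding Y_def by (intro smooth_vec smooth_on_const)
    then have dY: "Y differentiable (at x)" using x by (rule smooth_on_differentiable)
    have nY: "nabla g \<xi> (\<lambda>y. star_ricci_op G F N y w) x = nabla g \<xi> Y x"
      by (rule nabla_cong[OF x]) (simp add: star_ricci_op_eq Y_def u_def)
    have Y: "th y (Y y) = u y" "et y (Y y) = 0" if "y \<in> S" for y
      using that by (simp_all add: Y_def th_vec et_vec)
    note n1 = nabla_g[OF x dY Y, of \<xi>, simplified]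
    note n2 = nabla_g[OF x, where Y = "\<lambda>_. w" and a = \<xi>, OF differentiable_const refl refl]
    have op: "nabla g \<xi> Y x = star_ricci_op G F N x (nabla g \<xi> (\<lambda>_. w) x)"
      using par[OF smooth_on_const, of w] nY by (simp add: \<xi>_def)
    note d = smooth_forms_diff[OF x] smooth_scalars[THEN smooth_on_differentiable[OF _ x]]
    have df: "(\<lambda>y. of_real (f y) :: complex) differentiable (at x)" if "f differentiable (at x)" for f :: "real^3 \<Rightarrow> real"
      using that by (metis bounded_linear.has_derivative bounded_linear_of_real differentiable_def)
    have du: "D u x \<xi> = of_real (kap x) * D (\<lambda>y. th y w) x \<xi> + of_real (D kap x \<xi>) * th x w
        + m x * of_real (D (\<lambda>y. et y w) x \<xi>)"
      unfolding u_def[abs_def]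
      by (simp add: D_add D_mult D_linear[OF bounded_linear_of_real] d df w)
    have "th x (nabla g \<xi> Y x) = th x (star_ricci_op G F N x (nabla g \<xi> (\<lambda>_. w) x))"
      "et x (nabla g \<xi> Y x) = et x (star_ricci_op G F N x (nabla g \<xi> (\<lambda>_. w) x))"
      using op by simp_all
    then show "of_real (D kap x \<xi>) * th x w = m x * of_real (Im (cnj (s x) * th x w))"
      "Im (cnj (s x) * (of_real (kap x) * th x w)) = 0"
      unfolding star_ricci_op_eq[OF x] th_vec[OF x] et_vec[OF x] n1 n2 du
      by (simp_all add: \<xi> w u_def algebra_simps)
  qed
  define k' where "k' = D kap x \<xi>"
  have 1: "of_real k' = m x * of_real (Im (cnj (s x)))" "kap x * Im (s x) = 0"
    using eqs[of "fr x 1"] by (simp_all add: fr_dual[OF x] k'_def mult.commute)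
  have 2: "\<i> * of_real k' = m x * of_real (Re (s x))" "kap x * Re (s x) = 0"
    using eqs[of "fr x 2"] by (simp_all add: fr_dual[OF x] k'_def mult.commute)
  \<comment> \<open>The two test vectors give \<open>m * Re s = \<i> k'\<close> and
    \<open>m * Im s = - k'\<close>, so \<open>m s = \<i> k' - \<i> k' = 0\<close>.\<close>
  have "m x * s x = 0"
  proof -
    have "m x * s x = m x * of_real (Re (s x)) + \<i> * (m x * of_real (Im (s x)))"
      by (simp add: complex_eq_iff algebra_simps)
    also have "m x * of_real (Im (s x)) = - of_real k'" using 1(1) by simp
    finally show ?thesis unfolding 2(1)[symmetric] by simp
  qed
  show s0: "s x = 0"
  proof (rule ccontr)
    assume s: "s x \<noteq> 0"
    then have "m x = 0" using \<open>m x * s x = 0\<close> by simp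
    have "kap x = 0" using s 1(2) 2(2) by (auto simp: complex_eq_iff)
    have "cmod (s x) * cmod (P x) = cmod (cnj (s x)) * cmod (Q x)"
      using \<open>m x = 0\<close> unfolding norm_mult[symmetric] m_def by simp
    then have "cmod (P x) = cmod (Q x)" using s by simp
    moreover have "(Re (P x))\<^sup>2 = (cmod (P x))\<^sup>2" using Im_P[OF x] by (simp add: cmod_power2)
    ultimately have "kap x = c" by (simp add: kap_def)
    then show False using \<open>kap x = 0\<close> c by auto
  qed
  then show "D kap x (xi F N x) = 0" using 1(1) by (simp add: m_def k'_def \<xi>_def)
qed

end

section \<open>Hopf hypersurfaces\<close>

context hypersurface_patch begin

lemma xi_fr: "x \<in> S \<Longrightarrow> xi F N x = fr x 3"
  by (simp add: xi_eq frame_vec_def)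

lemma shape_xi: "x \<in> S \<Longrightarrow> shape G F N x (xi F N x) = frame_vec x (- s x) (al x)"
  by (simp add: shape_eq xi_fr s_def al_def)

end

locale hopf_patch = hypersurface_patch +
  assumes s0: "x \<in> S \<Longrightarrow> s x = 0"
begin

text \<open>The area form of the holomorphic distribution, up to orientation: its value on
  \<open>fr x 1\<close>, \<open>fr x 2\<close> is -1.\<close>

definition sg :: "real^3 \<Rightarrow> real^3 \<Rightarrow> real^3 \<Rightarrow> real" where
  "sg x a b = Im (th x a * cnj (th x b))"

lemma q_hopf: "x \<in> S \<Longrightarrow> q x a = al x * et x a"
  by (simp add: q_eq s0)

lemma p_hopf: "x \<in> S \<Longrightarrow> p x a = P x * th x a + Q x * cnj (th x a)"
  by (simp add: p_eq s0)

lemma d_et: "x \<in> S \<Longrightarrow> D (\<lambda>y. et y b) x a - D (\<lambda>y. et y a) x b = 2 * Re (P x) * sg x a b"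
  by (simp add: structure_et p_hopf Im_P sg_def algebra_simps)

lemma Im_p_p: "x \<in> S \<Longrightarrow> Im (p x a * cnj (p x b)) = (kap x - c) * sg x a b"
  unfolding kap_def cmod_power2 by (simp add: p_hopf Im_P sg_def algebra_simps power2_eq_square)

lemma diff_al: "x \<in> S \<Longrightarrow> al differentiable (at x)"
  and smooth_D_al: "smooth_on S (\<lambda>y. D al y a)"
  using smooth_on_differentiable smooth_on_D smooth_scalars(4) by blast+

definition bt :: "real^3 \<Rightarrow> real" where "bt x = D al x (fr x 3)"

text \<open>Codazzi for \<open>q = al et\<close> equates d al wedge \<open>et\<close> plus
  \<open>al\<close> d \<open>et\<close> with a multiple of \<open>sg\<close>. A pair containing
  \<open>fr x 3\<close> isolates the derivative of \<open>al\<close>; the pair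
  \<open>fr x 1\<close>, \<open>fr x 2\<close> leaves the \<open>sg\<close> terms. The constant
  \<open>5 * c / 4\<close> is c + c / 4, the summand c coming from \<lambda>\<nu> =
  \<open>kap - c\<close>.\<close>

lemma hopf_curvature_relations:
  assumes x: "x \<in> S"
  shows "D al x a = bt x * et x a" and "al x * Re (P x) = 5 * c / 4 - kap x"
proof -
  have Dq: "D (\<lambda>y. q y b) x a = al x * D (\<lambda>y. et y b) x a + D al x a * et x b" for a b
  proof -
    have "D (\<lambda>y. q y b) x a = D (\<lambda>y. al y * et y b) x a"
      by (rule D_cong[OF S x q_hopf])
    then show ?thesis using D_mult[OF diff_al[OF x] smooth_forms_diff(2)[OF x]] by simp
  qed
  have key: "D al x a * et x b - D al x b * et x a + al x * (2 * Re (P x) * sg x a b) =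
      (c / 2 - 2 * (kap x - c)) * sg x a b" for a b
    using structure_q[OF x, of b a] unfolding Dq d_et[OF x, symmetric] Im_p_p[OF x] sg_def[symmetric]
    by (simp add: algebra_simps)
  from key[of a "fr x 3"] show "D al x a = bt x * et x a"
    by (simp add: fr_dual[OF x] sg_def bt_def)
  from key[of "fr x 1" "fr x 2"] show "al x * Re (P x) = 5 * c / 4 - kap x"
    by (simp add: fr_dual[OF x] sg_def field_simps)
qed

lemma smooth_bt: "smooth_on S bt"
  unfolding bt_def[abs_def]
  by (rule smooth_form_field[OF linear_frechet_derivative[OF diff_al] smooth_D_al smooth_fr])

text \<open>The exterior derivative of \<open>bt et\<close>, the differential of \<open>al\<close>,
  is zero; on the holomorphic distribution only \<open>bt\<close> times d \<open>et\<close> survives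
  in it.\<close>

lemma bt_P: assumes x: "x \<in> S" shows "bt x * Re (P x) = 0"
proof -
  have "D (\<lambda>y. D al y b) x a = bt x * D (\<lambda>y. et y b) x a + D bt x a * et x b" for a b
  proof -
    have "D (\<lambda>y. D al y b) x a = D (\<lambda>y. bt y * et y b) x a"
      by (rule D_cong[OF S x hopf_curvature_relations(1)])
    then show ?thesis
      using D_mult[OF smooth_on_differentiable[OF smooth_bt x] smooth_forms_diff(2)[OF x]] by simp
  qed
  then have "bt x * (D (\<lambda>y. et y b) x a - D (\<lambda>y. et y a) x b) + D bt x a * et x b - D bt x b * et x a = 0" for a b
    using second_derivative_symmetric[OF S x smooth_scalars(4), of b a] by (simp add: algebra_simps)
  from this[of "fr x 2" "fr x 1"] show ?thesis
    by (simp add: d_et[OF x] fr_dual[OF x] sg_def)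
qed

text \<open>Otherwise \<open>c = -4\<close> and \<open>|Q| = 1\<close>, and the Codazzi equation gives \<open>dQ = \<i> Q om\<close> with
  \<open>om = al et - 2 r\<close>. So \<open>om\<close> is closed; but \<open>al et\<close> is closed as well, whereas \<open>dr = -6 sg\<close>.\<close>

lemma P_not_identically_0:
  assumes "S \<noteq> {}" and P0: "\<And>x. x \<in> S \<Longrightarrow> P x = 0"
  shows False
proof -
  obtain x where x: "x \<in> S" using assms(1) by blast
  \<comment> \<open>With \<open>P y = 0\<close> the curvature relation says
    \<open>kap y = 5 * c / 4\<close>, while \<open>kap y\<close> is \<open>c\<close> minus the
    square of \<open>cmod (Q y)\<close>; a square being nonnegative fixes the sign of
    \<open>c\<close>.\<close>
  have Q: "(cmod (Q y))\<^sup>2 = 1" and c4: "c = -4" if "y \<in> S" for y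
  proof -
    have "(cmod (Q y))\<^sup>2 = - c / 4"
      using hopf_curvature_relations(2)[OF that] P0[OF that] by (simp add: kap_def)
    moreover have "(cmod (Q y))\<^sup>2 \<ge> 0" by simp
    ultimately show "(cmod (Q y))\<^sup>2 = 1" "c = -4" using c by auto
  qed
  have QQ: "Q y * cnj (Q y) = 1" if "y \<in> S" for y
    using Q[OF that] by (simp add: complex_norm_square[symmetric])
  note dQ = smooth_on_differentiable[OF smooth_scalars(2)]
  define om where "om y a = al y * et y a - 2 * r y a" for y a
  have DQ: "D Q y a = \<i> * Q y * of_real (om y a)" if y: "y \<in> S" for y a
  proof -
    \<comment> \<open>The derivative of the argument of \<open>Q\<close>, which has modulus 1. The
      aim is to identify it with \<open>om\<close>.\<close>
    define ta where "ta a = Im (cnj (Q y) * D Q y a)" for a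
    have Dp: "D (\<lambda>z. p z b) y a = Q y * cnj (D (\<lambda>z. th z b) y a) + D Q y a * cnj (th y b)" for a b
    proof -
      have dc: "(\<lambda>z. cnj (th z b)) differentiable (at y)"
        using smooth_on_differentiable[OF smooth_on_cnj[OF S smooth_th] y] .
      have "D (\<lambda>z. p z b) y a = D (\<lambda>z. Q z * cnj (th z b)) y a"
        by (rule D_cong[OF S y]) (simp add: p_hopf P0)
      then show ?thesis
        using D_mult[OF dQ[OF y] dc] D_linear[OF bounded_linear_cnj smooth_forms_diff(1)[OF y]] by simp
    qed
    have zz: "cnj (Q y) * D Q y a + Q y * cnj (D Q y a) = 0" for a
    proof -
      have dc: "(\<lambda>z. cnj (Q z)) differentiable (at y)"
        using smooth_on_differentiable[OF smooth_on_cnj[OF S smooth_scalars(2)] y] .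
      have "D (\<lambda>z. Q z * cnj (Q z)) y a = D (\<lambda>_. 1) y a"
        by (rule D_cong[OF S y QQ])
      then show ?thesis
        using D_mult[OF dQ[OF y] dc] D_linear[OF bounded_linear_cnj dQ[OF y]] by (simp add: mult.commute add.commute)
    qed
    have "Re (cnj (Q y) * D Q y a) = 0" for a
      using arg_cong[OF zz[of a], of Re] by simp
    then have im: "cnj (Q y) * D Q y a = \<i> * of_real (ta a)" for a
      by (simp add: ta_def complex_eq_iff)
    have DQt: "D Q y a = \<i> * Q y * of_real (ta a)" for a
    proof -
      have "D Q y a = Q y * cnj (Q y) * D Q y a" by (simp add: QQ[OF y])
      then show ?thesis unfolding mult.assoc im by (simp add: mult_ac)
    qed
    have Qn: "Q y \<noteq> 0" using QQ[OF y] by auto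
    have key: "Q y * cnj (D (\<lambda>z. th z b) y a - D (\<lambda>z. th z a) y b) + D Q y a * cnj (th y b) - D Q y b * cnj (th y a)
        = - \<i> * (of_real (r y a) * p y b - of_real (r y b) * p y a) - \<i> * (of_real (q y b) * p y a - of_real (q y a) * p y b)
          - \<i> * (of_real (et y b) * th y a - of_real (et y a) * th y b)" for a b
      using structure_p[OF y, of b a] unfolding Dp by (simp add: c4[OF y] algebra_simps)
    note ev = structure_th[OF y] p_hopf[OF y] q_hopf[OF y] P0[OF y] fr_dual[OF y]
    \<comment> \<open>A pair containing \<open>fr y 3\<close> determines \<open>ta\<close> in that
      direction. Below, the pair \<open>fr y 2\<close>, \<open>fr y 1\<close> yields the other two
      values at once, as real and imaginary parts.\<close>
    have "D Q y (fr y 3) = - 2 * \<i> * of_real (r y (fr y 3)) * Q y + \<i> * of_real (al y) * Q y"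
      using key[of "fr y 1" "fr y 3"] QQ[OF y] by (simp add: ev algebra_simps)
    then have "\<i> * Q y * of_real (ta (fr y 3)) = \<i> * Q y * of_real (al y - 2 * r y (fr y 3))"
      by (simp add: DQt algebra_simps)
    then have t3: "ta (fr y 3) = al y - 2 * r y (fr y 3)"
      using Qn by (simp del: of_real_diff of_real_mult)
    have "Q y * (of_real (ta (fr y 1)) - \<i> * of_real (ta (fr y 2))) =
        Q y * (of_real (- 2 * r y (fr y 1)) - \<i> * of_real (- 2 * r y (fr y 2)))"
      using key[of "fr y 2" "fr y 1"] by (simp add: ev DQt algebra_simps)
    then have "of_real (ta (fr y 1)) - \<i> * of_real (ta (fr y 2)) = 
        (of_real (- 2 * r y (fr y 1)) - \<i> * of_real (- 2 * r y (fr y 2)) :: complex)"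
      using Qn by (simp only: mult_cancel_left simp_thms)
    then have t12: "ta (fr y 1) = - 2 * r y (fr y 1)" "ta (fr y 2) = - 2 * r y (fr y 2)"
      by (simp_all add: complex_eq_iff)
    have lin: "linear ta"
      unfolding ta_def[abs_def]
      using linear_compose[OF linear_frechet_derivative[OF dQ[OF y]] bounded_linear.linear[OF
          bounded_linear_compose[OF bounded_linear_Im bounded_linear_mult_right[of "cnj (Q y)"]]]]
      by (simp add: comp_def)
    have "linear (\<lambda>a. om y a)" 
      unfolding om_def by (rule linearI)
        (simp_all add: linear_add[OF forms_linear(2)[OF y]] linear_add[OF forms_linear(5)[OF y]]
          linear_cmul[OF forms_linear(2)[OF y]] linear_cmul[OF forms_linear(5)[OF y]] algebra_simps)
    note lo = linear_add[OF this] linear_cmul[OF this] linear_add[OF lin] linear_cmul[OF lin]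
    have ev: "a = frame_vec y (th y a) (et y a)" by (rule eq_vec[OF y refl refl])
    have "om y (fr y 1) = ta (fr y 1)" "om y (fr y 2) = ta (fr y 2)" "om y (fr y 3) = ta (fr y 3)"
      by (simp_all add: om_def fr_dual[OF y] t3 t12)
    then have "ta a = om y a"
      using arg_cong[OF ev, of ta] arg_cong[OF ev, of "om y"] by (simp add: frame_vec_def lo)
    then show ?thesis by (simp add: DQt)
  qed
  have so: "smooth_on S (\<lambda>y. om y a)" for a
    unfolding om_def by (intro smooth_on_diff smooth_on_mult smooth_scalars smooth_et smooth_r smooth_on_const S)
  have "D (\<lambda>y. D Q y b) x a = \<i> * (D Q x a * of_real (om x b) + Q x * of_real (D (\<lambda>y. om y b) x a))" for a b
  proof -
    have do: "(\<lambda>y. of_real (om y b) :: complex) differentiable (at x)"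
      using smooth_on_differentiable[OF smooth_on_of_real[OF S so] x] .
    have dor: "D (\<lambda>y. of_real (om y b) :: complex) x a = of_real (D (\<lambda>y. om y b) x a)"
      by (rule D_linear[OF bounded_linear_of_real smooth_on_differentiable[OF so x]])
    have "D (\<lambda>y. D Q y b) x a = D (\<lambda>y. \<i> * (Q y * of_real (om y b))) x a"
      by (rule D_cong[OF S x]) (simp add: DQ mult.assoc)
    also have "\<dots> = \<i> * D (\<lambda>y. Q y * of_real (om y b)) x a"
      by (rule D_linear[OF bounded_linear_mult_right differentiable_mult[OF dQ[OF x] do]])
    finally show ?thesis
      using D_mult[OF dQ[OF x] do] dor by (simp add: add.commute)
  qed
  \<comment> \<open>By \<open>DQ\<close> the products of \<open>D Q x a\<close> with
    \<open>om x b\<close> are symmetric in \<open>a\<close> and \<open>b\<close>, so commuting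
    second derivatives of \<open>Q\<close> leave exactly the closedness of
    \<open>om\<close>.\<close>
  then have "Q x * of_real (D (\<lambda>y. om y b) x a) = Q x * of_real (D (\<lambda>y. om y a) x b)" for a b
    using second_derivative_symmetric[OF S x smooth_scalars(2), of b a] by (simp add: DQ[OF x] mult_ac)
  then have do: "D (\<lambda>y. om y b) x a = D (\<lambda>y. om y a) x b" for a b
    using QQ[OF x] by (metis mult_cancel_left mult_zero_left of_real_eq_iff zero_neq_one)
  have Do: "D (\<lambda>y. om y b) x a = al x * D (\<lambda>y. et y b) x a + D al x a * et x b - 2 * D (\<lambda>y. r y b) x a" for a b
  proof -
    note d = smooth_forms_diff[OF x] diff_al[OF x]
    show ?thesis unfolding om_def by (simp add: D_diff D_mult d)
  qed
  \<comment> \<open>\<open>al et\<close> is closed here: \<open>D al\<close> is a multiple of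
    \<open>et\<close>, and d \<open>et\<close> is a multiple of \<open>Re (P x)\<close>, which is
    0.\<close>
  have "D (\<lambda>y. r y b) x a - D (\<lambda>y. r y a) x b = 0" for a b
    using do[of b a] d_et[OF x, of b a] P0[OF x]
    by (simp add: Do hopf_curvature_relations(1)[OF x] algebra_simps)
  from this[of "fr x 2" "fr x 1"] have "2 * (kap x - c) * sg x (fr x 1) (fr x 2) + c * sg x (fr x 1) (fr x 2) = 0"
    unfolding structure_r[OF x] Im_p_p[OF x] sg_def[symmetric] by (simp add: algebra_simps)
  moreover have "kap x - c = -1" using Q[OF x] P0[OF x] by (simp add: kap_def)
  moreover have "sg x (fr x 1) (fr x 2) = -1" by (simp add: sg_def fr_dual[OF x])
  ultimately have "c = 2" by simp
  then show False using c by simp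
qed

text \<open>A nonzero value of \<open>bt\<close> spreads to an open set, on which
  \<open>bt_P\<close> makes \<open>P\<close> vanish identically. \<open>P_not_identically_0\<close>
  then applies to the patch cut down to this set.\<close>

lemma D_al_0: assumes x: "x \<in> S" shows "D al x a = 0"
proof -
  have "bt x = 0"
  proof (rule ccontr)
    assume "bt x \<noteq> 0"
    define U where "U = {y \<in> S. bt y \<noteq> 0}"
    have "U = S \<inter> bt -` (- {0})" by (auto simp: U_def)
    then have "open U"
      using continuous_open_preimage[OF smooth_on_continuous[OF smooth_bt] S, of "- {0}"] by auto
    have sub: "U \<subseteq> S" by (auto simp: U_def)
    \<comment> \<open>\<open>s\<close>, \<open>P\<close> and \<open>bt\<close> are defined without
      reference to \<open>S\<close>, so the smaller patch has the same functions.\<close>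
    interpret U: hopf_patch c j U F N
    proof
      show "smooth_on U F" using F sub by (rule smooth_on_subset)
      show "unit_normal (kaehler_metric c j) F U N"
        using N sub smooth_on_subset by (auto simp: unit_normal_def)
      show "s y = 0" if "y \<in> U" for y using s0 that sub by blast
    qed (use c inj pos sub \<open>open U\<close> in auto)
    have "P y = 0" if "y \<in> U" for y
      using bt_P[of y] Im_P[of y] that by (auto simp: U_def complex_eq_iff)
    then show False using U.P_not_identically_0 \<open>bt x \<noteq> 0\<close> x by (auto simp: U_def)
  qed
  then show ?thesis by (simp add: hopf_curvature_relations(1)[OF x])
qed

section \<open>Principal curvatures along the integral curves of \<xi>\<close>

lemma principal_curvatures:
  assumes x: "x \<in> S" and W: "induced_metric G F x W W = 1" "eta G F N x W = 0"
    "shape G F N x W = \<mu> *\<^sub>R W" "shape G F N x (phi G F N x W) = \<nu> *\<^sub>R phi G F N x W"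
  shows "\<mu> + \<nu> = - 2 * Re (P x)" "\<mu> * \<nu> = kap x - c"
proof -
  define w where "w = th x W"
  have et0: "et x W = 0" using W(2) by (simp add: eta_eq[OF x])
  have w1: "Re (w * cnj w) = 1" using W(1) by (simp add: g_eq[OF x] et0 w_def)
  then have wn: "w \<noteq> 0" by auto
  have wc: "cmod w = 1"
  proof -
    have "(cmod w)\<^sup>2 = 1" using w1 unfolding cmod_power2 by (simp add: power2_eq_square)
    then show ?thesis by (simp add: power2_eq_1_iff) (metis norm_ge_zero not_one_le_zero neg_0_le_iff_le)
  qed
  have 1: "- p x W = of_real \<mu> * w"
    using arg_cong[OF W(3), of "th x"]
    by (simp add: shape_eq[OF x] th_vec[OF x] linear_cmul[OF forms_linear(1)[OF x]] w_def scaleR_conv_of_real[where 'a=complex])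
  have 2: "- p x (frame_vec x (\<i> * w) 0) = of_real \<nu> * (\<i> * w)"
    using arg_cong[OF W(4), of "th x"]
    by (simp add: shape_eq[OF x] phi_eq[OF x] th_vec[OF x] linear_cmul[OF forms_linear(1)[OF x]] w_def scaleR_conv_of_real[where 'a=complex])
  have a: "- (P x * w + Q x * cnj w) = of_real \<mu> * w"
    using 1 by (simp add: p_hopf[OF x] w_def)
  have "\<i> * (- (P x * w - Q x * cnj w)) = \<i> * (of_real \<nu> * w)"
    using 2 by (simp add: p_hopf[OF x] th_vec[OF x] algebra_simps)
  then have b: "- (P x * w - Q x * cnj w) = of_real \<nu> * w"
    by (simp only: mult_cancel_left) simp
  \<comment> \<open>Passing from \<open>w\<close> to \<open>\<i> * w\<close> changes the sign of the
    \<open>Q\<close> term relative to the \<open>P\<close> term. The sum of the two eigenvalue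
    equations isolates \<open>P\<close>, the difference below isolates \<open>Q\<close>.\<close>
  have "w * (- 2 * P x) = - (P x * w + Q x * cnj w) + - (P x * w - Q x * cnj w)" by (simp add: algebra_simps)
  also have "\<dots> = w * of_real (\<mu> + \<nu>)" unfolding a b by (simp add: algebra_simps)
  finally have "- 2 * P x = of_real (\<mu> + \<nu>)" using wn by (simp only: mult_cancel_left) simp
  then show sum: "\<mu> + \<nu> = - 2 * Re (P x)" by (simp add: complex_eq_iff)
  have "- 2 * (Q x * cnj w) = - (P x * w + Q x * cnj w) - - (P x * w - Q x * cnj w)" by (simp add: algebra_simps)
  also have "\<dots> = of_real (\<mu> - \<nu>) * w" unfolding a b by (simp add: algebra_simps)
  finally have "cmod (- 2 * (Q x * cnj w)) = cmod (of_real (\<mu> - \<nu>) * w)" by simp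
  then have "2 * cmod (Q x) = \<bar>\<mu> - \<nu>\<bar>" unfolding norm_mult norm_of_real wc by (simp add: wc)
  then have "(2 * cmod (Q x))\<^sup>2 = (\<mu> - \<nu>)\<^sup>2" by simp
  moreover have "4 * (\<mu> * \<nu>) = (\<mu> + \<nu>)\<^sup>2 - (\<mu> - \<nu>)\<^sup>2" by (simp add: power2_eq_square algebra_simps)
  ultimately show "\<mu> * \<nu> = kap x - c" unfolding sum by (simp add: kap_def power_mult_distrib)
qed

lemma constant_on_curve:
  fixes f :: "real^3 \<Rightarrow> real"
  assumes f: "\<And>y. y \<in> S \<Longrightarrow> f differentiable (at y)" "\<And>y. y \<in> S \<Longrightarrow> D f y (xi F N y) = 0"
    and \<gamma>: "\<And>t. t \<in> {a<..<b} \<Longrightarrow> \<gamma> t \<in> S \<and> (\<gamma> has_vector_derivative xi F N (\<gamma> t)) (at t)"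
  shows "\<exists>k. \<forall>t\<in>{a<..<b}. f (\<gamma> t) = k"
proof -
  have "((\<lambda>t. f (\<gamma> t)) has_derivative (\<lambda>h. 0)) (at t)" if t: "t \<in> {a<..<b}" for t
  proof -
    have y: "\<gamma> t \<in> S" using \<gamma>[OF t] by blast
    have "((\<lambda>t. f (\<gamma> t)) has_derivative (\<lambda>h. D f (\<gamma> t) (h *\<^sub>R xi F N (\<gamma> t)))) (at t)"
      using has_derivative_compose[of \<gamma> "\<lambda>h. h *\<^sub>R xi F N (\<gamma> t)" t UNIV f "D f (\<gamma> t)"] \<gamma>[OF t] f(1)[OF y]
      by (simp add: has_vector_derivative_def frechet_derivative_works)
    then show ?thesis
      by (simp add: linear_cmul[OF linear_frechet_derivative[OF f(1)[OF y]]] f(2)[OF y])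
  qed
  then have "\<exists>k. \<forall>t\<in>{a<..<b}. f (\<gamma> t) = k"
    using has_derivative_zero_constant[of "{a<..<b}" "\<lambda>t. f (\<gamma> t)"]
    by (meson convex_real_interval(8) has_derivative_at_withinI)
  then show ?thesis .
qed

text \<open>\<open>al\<close> and \<open>kap\<close> are constant on an integral curve, and as
  \<open>al\<close> is nonzero the curvature relation makes \<open>P\<close> constant too. Thus
  \<mu> and \<nu> are roots of one fixed quadratic there, and a continuous function with finitely
  many values on an interval is constant. This covers the points where \<mu> and \<nu>
  coincide.\<close>

lemma hol_curvatures_constant:
  assumes al: "\<And>x. x \<in> S \<Longrightarrow> al x \<noteq> 0" and kap: "\<And>x. x \<in> S \<Longrightarrow> D kap x (xi F N x) = 0"
    and pp: "principal_pair G F N S \<mu> \<nu>"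
  shows "constant_along S (xi F N) \<mu> \<and> constant_along S (xi F N) \<nu>"
proof -
  have prin: "\<mu> x + \<nu> x = - 2 * Re (P x)" "\<mu> x * \<nu> x = kap x - c" if "x \<in> S" for x
  proof -
    obtain W where "induced_metric G F x W W = 1" "eta G F N x W = 0" "shape G F N x W = \<mu> x *\<^sub>R W"
      "shape G F N x (phi G F N x W) = \<nu> x *\<^sub>R phi G F N x W"
      using pp \<open>x \<in> S\<close> unfolding principal_pair_def by blast
    from principal_curvatures[OF that this]
    show "\<mu> x + \<nu> x = - 2 * Re (P x)" "\<mu> x * \<nu> x = kap x - c" .
  qed
  have "constant_along S (xi F N) f" 
    if cont: "continuous_on S f" and f: "\<And>x. x \<in> S \<Longrightarrow> (f x)\<^sup>2 + 2 * Re (P x) * f x + (kap x - c) = 0" for f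
    unfolding constant_along_def
  proof (intro allI impI ballI)
    fix a b \<gamma> t
    assume \<gamma>: "\<forall>t\<in>{a<..<b}. \<gamma> t \<in> S \<and> (\<gamma> has_vector_derivative xi F N (\<gamma> t)) (at t)"
      and t: "t \<in> {a<..<b}"
    have "\<exists>k. \<forall>t\<in>{a<..<b}. al (\<gamma> t) = k"
      by (rule constant_on_curve[OF diff_al D_al_0]) (use \<gamma> in auto)
    then obtain k1 where k1: "\<And>t. t \<in> {a<..<b} \<Longrightarrow> al (\<gamma> t) = k1" by blast
    have "\<exists>k. \<forall>t\<in>{a<..<b}. kap (\<gamma> t) = k"
      by (rule constant_on_curve[OF smooth_on_differentiable[OF smooth_scalars(5)] kap]) (use \<gamma> in auto)
    then obtain k2 where k2: "\<And>t. t \<in> {a<..<b} \<Longrightarrow> kap (\<gamma> t) = k2" by blast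
    define k3 where "k3 = (5 * c / 4 - k2) / k1"
    have k3: "Re (P (\<gamma> t)) = k3" if "t \<in> {a<..<b}" for t
      using hopf_curvature_relations(2)[of "\<gamma> t"] al[of "\<gamma> t"] \<gamma> k1[OF that] k2[OF that] that
      by (simp add: k3_def field_simps)
    have root: "(f (\<gamma> t))\<^sup>2 + 2 * k3 * f (\<gamma> t) + (k2 - c) = 0" if "t \<in> {a<..<b}" for t
      using f[of "\<gamma> t"] \<gamma> k2[OF that] k3[OF that] that by auto
    have "continuous_on {a<..<b} \<gamma>"
      using \<gamma> by (intro continuous_at_imp_continuous_on ballI) (blast intro: has_vector_derivative_continuous)
    then have cf: "continuous_on {a<..<b} (\<lambda>t. f (\<gamma> t))"
      using \<gamma> by (intro continuous_on_compose2[OF cont]) auto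
    have "((\<lambda>t. f (\<gamma> t)) ` {a<..<b}) \<subseteq> {y. poly [:k2 - c, 2 * k3, 1:] y = 0}"
      using root by (auto simp: algebra_simps power2_eq_square)
    then have fin: "finite ((\<lambda>t. f (\<gamma> t)) ` {a<..<b})"
      by (rule finite_subset) (rule poly_roots_finite, simp)
    obtain k where "\<And>t. t \<in> {a<..<b} \<Longrightarrow> f (\<gamma> t) = k"
      using continuous_finite_range_constant[OF connected_Ioo cf fin] unfolding constant_on_def by blast
    then have "((\<lambda>_. k) has_real_derivative 0) (at t) \<Longrightarrow> ((f \<circ> \<gamma>) has_real_derivative 0) (at t)"
      using has_field_derivative_transform_within_open[of "\<lambda>_. k" 0 t "{a<..<b}" "f \<circ> \<gamma>"] t by auto
    then show "((f \<circ> \<gamma>) has_real_derivative 0) (at t)" by simp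
  qed
  moreover have "(\<mu> x)\<^sup>2 + 2 * Re (P x) * \<mu> x + (kap x - c) = 0"
    "(\<nu> x)\<^sup>2 + 2 * Re (P x) * \<nu> x + (kap x - c) = 0" if "x \<in> S" for x
  proof -
    have "Re (P x) = - (\<mu> x + \<nu> x) / 2" "kap x - c = \<mu> x * \<nu> x" using prin[OF that] by simp_all
    then show "(\<mu> x)\<^sup>2 + 2 * Re (P x) * \<mu> x + (kap x - c) = 0"
      "(\<nu> x)\<^sup>2 + 2 * Re (P x) * \<nu> x + (kap x - c) = 0"
      by (simp_all only:) (simp_all add: power2_eq_square field_simps)
  qed
  moreover have "continuous_on S \<mu>" "continuous_on S \<nu>" using pp by (auto simp: principal_pair_def)
  ultimately show ?thesis by blast
qed

end

section \<open>Charts, atlases and the identity congruence\<close>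

definition affine_part :: "3 \<Rightarrow> complex^3 \<Rightarrow> complex^2" where
  "affine_part j z = (\<chi> k. if k = 1 then z $ (j + 1) / z $ j else z $ (j + 2) / z $ j)"

lemma index_cases: "(k::3) = j \<or> k = j + 1 \<or> k = j + 2"
  using exhaust_3[of j] exhaust_3[of k] by auto

lemma hom_vec_affine_part:
  assumes "z $ j \<noteq> 0" shows "hom_vec j 1 (affine_part j z) = inverse (z $ j) *s z"
proof -
  have "hom_vec j 1 (affine_part j z) $ k = (inverse (z $ j) *s z) $ k" for k
    using index_cases[of k j] assms
    by (elim disjE) (simp_all only: hom_vec_nth, simp_all add: affine_part_def field_simps)
  then show ?thesis by (simp add: vec_eq_iff)
qed

text \<open>\<open>z\<close> lies in the radical of the form, so multiples of it may be added
  freely, and \<open>hform_rescale\<close> removes \<open>b\<close>. This invariance is behind every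
  change of affine chart.\<close>

lemma hform_shift:
  assumes b: "b \<noteq> 0" and n: "herm c z z \<noteq> 0"
  shows "hform c (b *s z) (b *s v + k *s z) (b *s w + l *s z) = hform c z v w"
proof -
  have "herm c (b *s z) (b *s z) \<noteq> 0" using b n by (simp add: herm_scale_left herm_scale_right)
  from hform_base[OF this] have "b * hform c (b *s z) z w = 0" "cnj b * hform c (b *s z) w z = 0" for w
    by (simp_all only: hform_scale_left hform_scale_right)
  then have "hform c (b *s z) z w = 0" "hform c (b *s z) w z = 0" for w
    using b by auto
  then show ?thesis
    using hform_rescale[OF b, of c z v w]
    by (simp add: hform_add_left hform_add_right hform_scale_left hform_scale_right)
qed

lemma complex_line_scale: assumes "a \<noteq> 0" shows "complex_line (a *s z) = complex_line z"
proof -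
  have "(\<lambda>b. b *s (a *s z)) ` UNIV = (\<lambda>b. b *s z) ` (\<lambda>b. b * a) ` UNIV"
    by (simp add: image_image)
  also have "(\<lambda>b. b * a) ` UNIV = UNIV"
    using assms by (auto intro!: image_eqI[of _ _ "_ / a"])
  finally show ?thesis by (simp add: complex_line_def)
qed

lemma in_own_line: "z \<in> complex_line z"
  unfolding complex_line_def by (rule range_eqI[of _ _ 1]) simp

lemma complex_line_eqE:
  assumes "complex_line z = complex_line (hom_vec j 1 x)" shows "z = z $ j *s hom_vec j 1 x"
proof -
  have "z \<in> complex_line (hom_vec j 1 x)" using in_own_line[of z] assms by simp
  then obtain a where a: "z = a *s hom_vec j 1 x" by (auto simp: complex_line_def)
  then have "z $ j = a" by (simp add: hom_vec_nth)
  then show ?thesis using a by simp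
qed

lemma chart_line:
  assumes "z $ j \<noteq> 0" shows "chart j (complex_line z) = affine_part j z"
  unfolding chart_def
proof (rule the_equality)
  have "complex_line (hom_vec j 1 (affine_part j z)) = complex_line z"
    using assms by (simp add: hom_vec_affine_part complex_line_scale)
  then show "hom_vec j 1 (affine_part j z) \<in> complex_line z" using in_own_line by metis
  fix x assume "hom_vec j 1 x \<in> complex_line z"
  then obtain a where a: "hom_vec j 1 x = a *s z" by (auto simp: complex_line_def)
  from arg_cong[OF a, of "\<lambda>w. w $ j"] have "a = inverse (z $ j)"
    using assms by (simp add: hom_vec_nth field_simps)
  then have "hom_vec j 1 x = hom_vec j 1 (affine_part j z)"
    using a assms by (simp add: hom_vec_affine_part)
  then show "x = affine_part j z" by (simp add: hom_vec_eq_iff)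
qed

lemma chart_line_hom_vec: "chart j (complex_line (hom_vec j 1 x)) = x"
proof -
  have "hom_vec j 1 (affine_part j (hom_vec j 1 x)) = hom_vec j 1 x"
    using hom_vec_affine_part[of "hom_vec j 1 x" j] by (simp add: hom_vec_nth)
  then show ?thesis by (simp add: chart_line hom_vec_nth hom_vec_eq_iff)
qed

lemma herm_scale_self: "Re (herm c (a *s z) (a *s z)) = (cmod a)\<^sup>2 * Re (herm c z z)"
proof -
  have "herm c (a *s z) (a *s z) = of_real ((cmod a)\<^sup>2) * herm c z z"
    by (simp add: herm_scale_left herm_scale_right complex_norm_square mult_ac del: of_real_power)
  then show ?thesis by (simp del: of_real_power)
qed

lemma chart_domD:
  assumes "p \<in> chart_dom c j"
  shows "p = complex_line (hom_vec j 1 (chart j p))"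
    and "c * Re (herm c (hom_vec j 1 (chart j p)) (hom_vec j 1 (chart j p))) > 0"
proof -
  obtain z w where z: "p = complex_line z" "c * Re (herm c z z) > 0" and w: "w \<in> p" "w $ j \<noteq> 0"
    using assms by (auto simp: chart_dom_def space_form_def)
  then have zj: "z $ j \<noteq> 0" by (auto simp: complex_line_def)
  then have eq: "hom_vec j 1 (chart j p) = inverse (z $ j) *s z"
    by (simp add: z chart_line hom_vec_affine_part)
  show "p = complex_line (hom_vec j 1 (chart j p))"
    unfolding eq using zj by (simp add: complex_line_scale z)
  have "c * Re (herm c (hom_vec j 1 (chart j p)) (hom_vec j 1 (chart j p))) =
      (cmod (inverse (z $ j)))\<^sup>2 * (c * Re (herm c z z))"
    unfolding eq herm_scale_self by simp
  moreover have "(cmod (inverse (z $ j)))\<^sup>2 > 0" using zj by simp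
  ultimately show "c * Re (herm c (hom_vec j 1 (chart j p)) (hom_vec j 1 (chart j p))) > 0"
    using z(2) by (metis mult_pos_pos)
qed

lemma line_in_chart_dom:
  assumes "c * Re (herm c z z) > 0" "z $ j \<noteq> 0" shows "complex_line z \<in> chart_dom c j"
  using assms in_own_line by (auto simp: chart_dom_def space_form_def)

lemma inj_on_chart: "inj_on (chart j) (chart_dom c j)"
  by (rule inj_onI) (metis chart_domD(1))

lemma chart_image:
  "chart j ` (chart_dom c j \<inter> chart_dom c i) =
    {x. c * Re (herm c (hom_vec j 1 x) (hom_vec j 1 x)) > 0 \<and> hom_vec j 1 x $ i \<noteq> 0}" (is "?L = ?R")
proof
  show "?L \<subseteq> ?R"
  proof
    fix x assume "x \<in> ?L"
    then obtain p where p: "p \<in> chart_dom c j" "p \<in> chart_dom c i" "x = chart j p" by blast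
    have "complex_line (hom_vec i 1 (chart i p)) = complex_line (hom_vec j 1 x)"
      using chart_domD(1)[OF p(1)] chart_domD(1)[OF p(2)] p(3) by simp
    then have "hom_vec i 1 (chart i p) = hom_vec i 1 (chart i p) $ j *s hom_vec j 1 x"
      by (rule complex_line_eqE)
    from arg_cong[OF this, of "\<lambda>w. w $ i"] have "hom_vec j 1 x $ i \<noteq> 0"
      by (auto simp: hom_vec_nth)
    then show "x \<in> ?R" using chart_domD(2)[OF p(1)] p(3) by simp
  qed
  show "?R \<subseteq> ?L"
  proof
    fix x assume x: "x \<in> ?R"
    then have "complex_line (hom_vec j 1 x) \<in> chart_dom c j \<inter> chart_dom c i"
      using line_in_chart_dom[of c "hom_vec j 1 x"] by (auto simp: hom_vec_nth)
    then show "x \<in> ?L" using chart_line_hom_vec by (metis image_eqI)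
  qed
qed

lemma inv_chart:
  assumes "x \<in> chart j ` (chart_dom c j \<inter> chart_dom c i)"
  shows "inv_into (chart_dom c j) (chart j) x = complex_line (hom_vec j 1 x)"
proof -
  have "complex_line (hom_vec j 1 x) \<in> chart_dom c j"
    using assms unfolding chart_image by (intro line_in_chart_dom) (auto simp: hom_vec_nth)
  then show ?thesis
    using inv_into_f_f[OF inj_on_chart, of "complex_line (hom_vec j 1 x)" c j] by (simp add: chart_line_hom_vec)
qed

lemma open_chart_image: "open (chart j ` (chart_dom c j \<inter> chart_dom c i))"
proof -
  have 1: "smooth_on UNIV (\<lambda>x. hom_vec j 1 x)" by (intro smooth_on_hom_vec smooth_on_ident open_UNIV)
  have "continuous_on UNIV (\<lambda>x. c * Re (herm c (hom_vec j 1 x) (hom_vec j 1 x)))"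
    by (intro smooth_on_continuous smooth_on_mult smooth_on_const smooth_on_Re smooth_on_herm 1 open_UNIV)
  moreover have "continuous_on UNIV (\<lambda>x. hom_vec j 1 x $ i)"
    by (intro smooth_on_continuous smooth_on_vec_nth 1 open_UNIV)
  ultimately show ?thesis
    unfolding chart_image by (intro open_Collect_conj open_Collect_less open_Collect_neq) (auto intro: continuous_on_const)
qed

section \<open>Topology and identity map of a manifold given by an atlas\<close>

definition compatible_atlas :: "('a, 'e::euclidean_space) atlas \<Rightarrow> bool" where
  "compatible_atlas \<A> \<longleftrightarrow> (\<forall>(U, u)\<in>\<A>. inj_on u U) \<and>
     (\<forall>(U, u)\<in>\<A>. \<forall>(V, v)\<in>\<A>. open (u ` (U \<inter> V)) \<and> smooth_on (u ` (U \<inter> V)) (v \<circ> inv_into U u))"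

lemma smooth_manifold_compatible: "smooth_manifold \<A> \<Longrightarrow> compatible_atlas \<A>"
  by (simp add: smooth_manifold_def compatible_atlas_def)

lemma compatible_space_form_atlas: "compatible_atlas (space_form_atlas c)"
proof -
  have "smooth_on (chart i ` (chart_dom c i \<inter> chart_dom c j)) (chart j \<circ> inv_into (chart_dom c i) (chart i))" for i j
  proof (rule smooth_on_cong[OF open_chart_image, where f = "\<lambda>x. affine_part j (hom_vec i 1 x)"])
    show "smooth_on (chart i ` (chart_dom c i \<inter> chart_dom c j)) (\<lambda>x. affine_part j (hom_vec i 1 x))"
    proof (rule smooth_on_vec_lambda[OF open_chart_image])
      fix k :: 2
      have "smooth_on (chart i ` (chart_dom c i \<inter> chart_dom c j)) (\<lambda>x. hom_vec i 1 x $ l / hom_vec i 1 x $ j)" for l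
        by (intro smooth_on_divide smooth_on_vec_nth smooth_on_hom_vec smooth_on_ident open_chart_image)
          (simp add: chart_image)
      then show "smooth_on (chart i ` (chart_dom c i \<inter> chart_dom c j)) (\<lambda>x. affine_part j (hom_vec i 1 x) $ k)"
        by (cases "k = 1") (simp_all add: affine_part_def)
    qed
    show "affine_part j (hom_vec i 1 x) = (chart j \<circ> inv_into (chart_dom c i) (chart i)) x"
      if "x \<in> chart i ` (chart_dom c i \<inter> chart_dom c j)" for x
      using inv_chart[OF that] that unfolding chart_image by (simp add: chart_line)
  qed
  then show ?thesis
    using inj_on_chart open_chart_image by (auto simp: compatible_atlas_def space_form_atlas_def)
qed

text \<open>\<open>topology\<close> is controlled only on predicates satisfying
  \<open>istopology\<close>. Closure under intersections comes from the injectivity of the charts,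
  which makes their images commute with intersections.\<close>

lemma openin_atlas_topology:
  assumes "compatible_atlas \<A>"
  shows "openin (atlas_topology \<A>) S \<longleftrightarrow> S \<subseteq> points \<A> \<and> (\<forall>(U, u)\<in>\<A>. open (u ` (S \<inter> U)))"
proof -
  let ?P = "\<lambda>S. S \<subseteq> points \<A> \<and> (\<forall>(U, u)\<in>\<A>. open (u ` (S \<inter> U)))"
  have "istopology ?P"
    unfolding istopology_def
  proof (intro conjI allI impI)
    fix S T assume S: "?P S" and T: "?P T"
    show "S \<inter> T \<subseteq> points \<A>" using S by blast
    show "\<forall>(U, u)\<in>\<A>. open (u ` (S \<inter> T \<inter> U))"
    proof safe
      fix U u assume "(U, u) \<in> \<A>"
      then have "inj_on u U" using assms by (auto simp: compatible_atlas_def)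
      then have "u ` (S \<inter> T \<inter> U) = u ` (S \<inter> U) \<inter> u ` (T \<inter> U)"
        by (auto simp: inj_on_def)
      then show "open (u ` (S \<inter> T \<inter> U))" using S T \<open>(U, u) \<in> \<A>\<close> by auto
    qed
  next
    fix K assume K: "\<forall>S\<in>K. ?P S"
    show "\<Union> K \<subseteq> points \<A>" using K by blast
    show "\<forall>(U, u)\<in>\<A>. open (u ` (\<Union> K \<inter> U))"
    proof safe
      fix U u assume "(U, u) \<in> \<A>"
      have "u ` (\<Union> K \<inter> U) = (\<Union>S\<in>K. u ` (S \<inter> U))" by blast
      also have "open \<dots>" using K \<open>(U, u) \<in> \<A>\<close> by (intro open_UN) auto
      finally show "open (u ` (\<Union> K \<inter> U))" .
    qed
  qed
  then show ?thesis by (simp add: atlas_topology_def topology_inverse')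
qed

lemma chart_subset_points: "(U, u) \<in> \<A> \<Longrightarrow> U \<subseteq> points \<A>"
  by (force simp: points_def)

lemma topspace_atlas_topology:
  assumes "compatible_atlas \<A>" shows "topspace (atlas_topology \<A>) = points \<A>"
proof -
  have "openin (atlas_topology \<A>) (points \<A>)"
    unfolding openin_atlas_topology[OF assms]
  proof safe
    fix U u assume U: "(U, u) \<in> \<A>"
    have "points \<A> \<inter> U = U \<inter> U" using chart_subset_points[OF U] by blast
    then show "open (u ` (points \<A> \<inter> U))" using U assms unfolding compatible_atlas_def by fastforce
  qed
  moreover have "topspace (atlas_topology \<A>) \<subseteq> points \<A>"
    using openin_topspace openin_atlas_topology[OF assms] by blast
  ultimately show ?thesis using openin_subset by blast
qed

text \<open>In any other chart the set is the preimage of \<open>S\<close> under the transition map,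
  which is continuous on an open domain.\<close>

lemma openin_chart_preimage:
  assumes \<A>: "compatible_atlas \<A>" and U: "(U, u) \<in> \<A>" and S: "open S" "S \<subseteq> u ` U"
  shows "openin (atlas_topology \<A>) {m \<in> U. u m \<in> S}"
  unfolding openin_atlas_topology[OF \<A>]
proof safe
  show "m \<in> points \<A>" if "m \<in> U" for m using that chart_subset_points[OF U] by blast
  fix V v assume V: "(V, v) \<in> \<A>"
  have inj: "inj_on v V" "inj_on u U" using \<A> U V by (auto simp: compatible_atlas_def)
  have op: "open (v ` (V \<inter> U))" and sm: "smooth_on (v ` (V \<inter> U)) (u \<circ> inv_into V v)"
    using \<A> U V by (auto simp: compatible_atlas_def)
  have "v ` ({m \<in> U. u m \<in> S} \<inter> V) = v ` (V \<inter> U) \<inter> (u \<circ> inv_into V v) -` S"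
    using inj by (auto simp: inv_into_f_f)
  then show "open (v ` ({m \<in> U. u m \<in> S} \<inter> V))"
    using continuous_open_preimage[OF smooth_on_continuous[OF sm] op S(1)] by simp
qed

lemma openin_chart_dom: "openin (atlas_topology (space_form_atlas c)) (chart_dom c j)"
  unfolding openin_atlas_topology[OF compatible_space_form_atlas]
  using open_chart_image by (auto simp: space_form_atlas_def points_def Int_commute)

lemma smooth_map_identity:
  assumes \<A>: "compatible_atlas \<A>" and h: "\<And>x. x \<in> points \<A> \<Longrightarrow> h x = x"
  shows "smooth_map \<A> \<A> h"
  unfolding smooth_map_def
proof (intro conjI)
  show "continuous_map (atlas_topology \<A>) (atlas_topology \<A>) h"
    by (rule continuous_map_eq[OF continuous_map_id]) (simp add: topspace_atlas_topology[OF \<A>] h)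
  show "\<forall>(U, u)\<in>\<A>. \<forall>(V, v)\<in>\<A>. smooth_on (u ` (U \<inter> h -` V)) (v \<circ> h \<circ> inv_into U u)"
  proof safe
    fix U u V v assume U: "(U, u) \<in> \<A>" and V: "(V, v) \<in> \<A>"
    have hU: "h x = x" if "x \<in> U" for x using h that chart_subset_points[OF U] by blast
    have eq: "U \<inter> h -` V = U \<inter> V" using hU by auto
    have "inj_on u U" and op: "open (u ` (U \<inter> V))" and sm: "smooth_on (u ` (U \<inter> V)) (v \<circ> inv_into U u)"
      using \<A> U V by (auto simp: compatible_atlas_def)
    show "smooth_on (u ` (U \<inter> h -` V)) (v \<circ> h \<circ> inv_into U u)"
      unfolding eq by (rule smooth_on_cong[OF op sm]) (use hU \<open>inj_on u U\<close> in \<open>auto simp: inv_into_f_f\<close>)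
  qed
qed

lemma diffeomorphism_identity:
  assumes "compatible_atlas \<A>" shows "diffeomorphism \<A> \<A> id"
  unfolding diffeomorphism_def
  by (intro conjI smooth_map_identity[OF assms]) (auto simp: inv_into_f_f[of id, simplified])

text \<open>The identity is compared in every pair of affine charts. A chart change multiplies the
  lift by \<open>b\<close>, so its derivative is \<open>b\<close> times the vector plus a multiple
  of the base point, and \<open>hform_shift\<close> absorbs both.\<close>

lemma ambient_isometry_id:
  assumes "c = 4 \<or> c = -4" shows "ambient_isometry c id"
  unfolding ambient_isometry_def
proof (intro conjI allI ballI)
  show "diffeomorphism (space_form_atlas c) (space_form_atlas c) id"
    by (rule diffeomorphism_identity[OF compatible_space_form_atlas])
  fix i j p v w assume p: "p \<in> chart_dom c i \<inter> id -` chart_dom c j"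
  define O' where "O' = chart i ` (chart_dom c i \<inter> chart_dom c j)"
  define x where "x = chart i p"
  define T where "T = chart j \<circ> id \<circ> inv_into (chart_dom c i) (chart i)"
  define b where "b y = inverse (hom_vec i 1 y $ j)" for y
  have op: "open O'" unfolding O'_def by (rule open_chart_image)
  have xO: "x \<in> O'" using p by (auto simp: x_def O'_def)
  then have bx: "b x \<noteq> 0" and n: "herm c (hom_vec i 1 x) (hom_vec i 1 x) \<noteq> 0"
    by (auto simp: O'_def chart_image b_def)
  have Teq: "hom_vec j 1 (T y) = b y *s hom_vec i 1 y" if "y \<in> O'" for y
    using inv_chart[of y i c j] that unfolding O'_def chart_image
    by (simp add: T_def chart_line hom_vec_affine_part b_def chart_image)
  have "smooth_on O' T"
    using compatible_space_form_atlas by (auto simp: compatible_atlas_def space_form_atlas_def T_def O'_def)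
  then have dT: "(T has_derivative D T x) (at x)" using xO by (rule smooth_on_has_derivative)
  have db: "(b has_derivative D b x) (at x)"
  proof (rule smooth_on_has_derivative[OF _ xO])
    show "smooth_on O' b" unfolding b_def
      by (intro smooth_on_inverse smooth_on_vec_nth smooth_on_hom_vec smooth_on_ident op) (auto simp: O'_def chart_image)
  qed
  have DT: "hom_vec j 0 (D T x v) = b x *s hom_vec i 0 v + D b x v *s hom_vec i 1 x" for v
  proof -
    have "((\<lambda>y. hom_vec j 1 (T y)) has_derivative (\<lambda>v. b x *s hom_vec i 0 v + D b x v *s hom_vec i 1 x)) (at x)"
      by (rule has_derivative_transform_within_open[OF bounded_bilinear.FDERIV[OF
              bounded_bilinear_vector_scalar_mult db hom_vec_has_derivative[OF has_derivative_ident]] op xO])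
        (simp add: Teq)
    from has_derivative_unique[OF hom_vec_has_derivative[OF dT] this] show ?thesis by meson
  qed
  have "kaehler_metric c j (T x) (D T x v) (D T x w) = kaehler_metric c i x v w"
    unfolding kaehler_metric_eq DT Teq[OF xO] hform_shift[OF bx n] by (rule refl)
  then show "let T = chart j \<circ> id \<circ> inv_into (chart_dom c i) (chart i); x = chart i p
      in kaehler_metric c j (T x) (D T x v) (D T x w) = kaehler_metric c i x v w"
    by (simp add: T_def x_def Let_def)
qed

lemma locally_congruent_self:
  assumes "c = 4 \<or> c = -4" and \<A>: "compatible_atlas \<A>"
  shows "locally_congruent c \<A> f \<A> f"
proof -
  have "restrict_atlas \<A> (points \<A>) = id ` \<A>"
    unfolding restrict_atlas_def by (rule image_cong) (auto dest: chart_subset_points)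
  then have "diffeomorphism (restrict_atlas \<A> (points \<A>)) (restrict_atlas \<A> (points \<A>)) id"
    using diffeomorphism_identity[OF \<A>] by simp
  moreover have "openin (atlas_topology \<A>) (points \<A>)"
    using openin_topspace[of "atlas_topology \<A>"] by (simp add: topspace_atlas_topology[OF \<A>])
  ultimately show ?thesis
    unfolding locally_congruent_def using ambient_isometry_id[OF assms(1)] by (metis id_apply)
qed

section \<open>Unit normals and change of charts\<close>

lemma smooth_kaehler_along:
  assumes "open S" "smooth_on S F" "smooth_on S V" "smooth_on S W"
    and "\<And>x. x \<in> S \<Longrightarrow> c * Re (herm c (hom_vec j 1 (F x)) (hom_vec j 1 (F x))) > 0"
  shows "smooth_on S (\<lambda>x. kaehler_metric c j (F x) (V x) (W x))"
  unfolding kaehler_metric_eq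
  by (intro smooth_on_Re smooth_on_hform smooth_on_hom_vec assms) (use assms(5) in fastforce)

lemma exists_not_in_linear_range:
  assumes "linear (f :: real^3 \<Rightarrow> complex^2)" shows "\<exists>v. v \<notin> range f"
proof (rule ccontr)
  assume "\<not> ?thesis"
  then have "range f = UNIV" by auto
  then have "dim (UNIV :: (complex^2) set) \<le> dim (UNIV :: (real^3) set)"
    using dim_image_le[OF assms, of UNIV] by simp
  then show False by simp
qed

text \<open>Gram-Schmidt orthogonalisation of the three coordinate tangent fields and a constant
  transversal vector.\<close>

lemma exists_unit_normal:
  assumes c: "c = 4 \<or> c = -4" and S: "open S" "x0 \<in> S" and F: "smooth_on S F"
    and inj: "\<And>x. x \<in> S \<Longrightarrow> inj (D F x)"
    and pos: "\<And>x. x \<in> S \<Longrightarrow> c * Re (herm c (hom_vec j 1 (F x)) (hom_vec j 1 (F x))) > 0"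
  shows "\<exists>S' N. open S' \<and> x0 \<in> S' \<and> S' \<subseteq> S \<and> unit_normal (kaehler_metric c j) F S' N"
proof -
  define gg where "gg x v w = kaehler_metric c j (F x) v w" for x v w
  have gg: "gg x (u + v) w = gg x u w + gg x v w" "gg x (u - v) w = gg x u w - gg x v w"
    "gg x (k *\<^sub>R v) w = k * gg x v w" for x u v w k
    by (simp_all add: gg_def kaehler_metric_eq hom_vec_add hom_vec_diff hom_vec_scaleR
        hform_add_left hform_diff_left hform_scaleR_left)
  have gg_sym: "gg x v w = gg x w v" for x v w
    unfolding gg_def kaehler_metric_eq using hform_cnj by (metis cnj.simps(1))
  have gg_pos: "gg x v v > 0" if "x \<in> S" "v \<noteq> 0" for x v
    unfolding gg_def kaehler_metric_eq using hom_vec_pos[OF c pos] that by blast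
  have lin: "linear (D F x)" if "x \<in> S" for x
    by (rule linear_frechet_derivative[OF smooth_on_differentiable[OF F that]])
  define pr where "pr x w v = v - (gg x v w / gg x w w) *\<^sub>R w" for x w v
  have pr_orth: "gg x (pr x w v) w = 0" if "x \<in> S" "w \<noteq> 0" for x w v
    using gg_pos[OF that] by (simp add: pr_def gg)
  have pr_keep: "gg x (pr x w v) u = 0" if "gg x v u = 0" "gg x w u = 0" for x w v u
    using that by (simp add: pr_def gg)
  have sm_gg: "smooth_on S' (\<lambda>x. gg x (V x) (W x))" if "open S'" "S' \<subseteq> S" "smooth_on S' V" "smooth_on S' W" for S' V W
    unfolding gg_def using that smooth_on_subset[OF F] pos by (intro smooth_kaehler_along) auto
  have sm_pr: "smooth_on S (\<lambda>x. pr x (W x) (V x))"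
    if "smooth_on S W" "smooth_on S V" "\<And>x. x \<in> S \<Longrightarrow> W x \<noteq> 0" for V W
    unfolding pr_def
    by (intro smooth_on_diff smooth_on_scaleR smooth_on_divide sm_gg that S(1) order_refl)
      (use gg_pos that(3) in force)
  \<comment> \<open>A three-dimensional image cannot exhaust a space of real dimension four. The
    constant \<open>v\<close> is known to be transversal only at \<open>x0\<close>, hence the later
    shrinking to \<open>S'\<close>.\<close>
  obtain v where v: "v \<notin> range (D F x0)"
    using exists_not_in_linear_range[OF lin[OF S(2)]] by blast
  define T where "T i x = D F x (axis i 1)" for i x
  define W2 where "W2 x = pr x (T 1 x) (T 2 x)" for x
  define W3 where "W3 x = pr x (W2 x) (pr x (T 1 x) (T 3 x))" for x
  define n where "n x = pr x (W3 x) (pr x (W2 x) (pr x (T 1 x) v))" for x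
  have indep: "T 1 x \<noteq> 0" "W2 x \<noteq> 0" "W3 x \<noteq> 0" if x: "x \<in> S" for x
  proof -
    have ker: "b = 0" if "D F x b = 0" for b
      using inj[OF x] that linear_0[OF lin[OF x]] by (metis injD)
    note l = linear_diff[OF lin[OF x]] linear_cmul[OF lin[OF x]] linear_add[OF lin[OF x]]
    show "T 1 x \<noteq> 0" using ker[of "axis 1 1"] by (auto simp: T_def)
    define k where "k = gg x (T 2 x) (T 1 x) / gg x (T 1 x) (T 1 x)"
    have W2: "W2 x = D F x (axis 2 1 - k *\<^sub>R axis 1 1)"
      by (simp add: W2_def pr_def T_def k_def l)
    show "W2 x \<noteq> 0"
    proof
      assume "W2 x = 0"
      then have "axis 2 1 - k *\<^sub>R axis 1 1 = (0 :: real^3)" by (intro ker) (simp add: W2[symmetric])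
      from arg_cong[OF this, of "\<lambda>b. b $ 2"] show False by (simp add: axis_def)
    qed
    define k1 where "k1 = gg x (T 3 x) (T 1 x) / gg x (T 1 x) (T 1 x)"
    define k2 where "k2 = gg x (pr x (T 1 x) (T 3 x)) (W2 x) / gg x (W2 x) (W2 x)"
    have "W3 x = T 3 x - k1 *\<^sub>R T 1 x - k2 *\<^sub>R W2 x"
      by (simp add: W3_def pr_def[of x "W2 x"] k2_def) (simp add: pr_def k1_def)
    then have W3: "W3 x = D F x (axis 3 1 - k1 *\<^sub>R axis 1 1 - k2 *\<^sub>R (axis 2 1 - k *\<^sub>R axis 1 1))"
      by (simp add: W2 T_def l)
    show "W3 x \<noteq> 0"
    proof
      assume "W3 x = 0"
      then have "axis 3 1 - k1 *\<^sub>R axis 1 1 - k2 *\<^sub>R (axis 2 1 - k *\<^sub>R axis 1 1) = (0 :: real^3)"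
        by (intro ker) (simp add: W3[symmetric])
      from arg_cong[OF this, of "\<lambda>b. b $ 3"] show False by (simp add: axis_def)
    qed
  qed
  have sm_T: "smooth_on S (T i)" for i unfolding T_def by (intro smooth_on_D F)
  have sm_W2: "smooth_on S W2" unfolding W2_def by (intro sm_pr sm_T indep)
  have sm_W3: "smooth_on S W3" unfolding W3_def by (intro sm_pr sm_T sm_W2 indep)
  have sm_n: "smooth_on S n" unfolding n_def
    by (intro sm_pr sm_T sm_W2 sm_W3 indep smooth_on_const)
  have orth: "gg x (n x) (D F x a) = 0" if x: "x \<in> S" for x a
  proof -
    have 21: "gg x (W2 x) (T 1 x) = 0" unfolding W2_def by (rule pr_orth[OF x indep(1)[OF x]])
    have 32: "gg x (W3 x) (W2 x) = 0" unfolding W3_def by (rule pr_orth[OF x indep(2)[OF x]])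
    have 31: "gg x (W3 x) (T 1 x) = 0" unfolding W3_def
      by (rule pr_keep[OF pr_orth[OF x indep(1)[OF x]] 21])
    have n3: "gg x (n x) (W3 x) = 0" unfolding n_def by (rule pr_orth[OF x indep(3)[OF x]])
    have n2: "gg x (n x) (W2 x) = 0" unfolding n_def
      by (rule pr_keep[OF pr_orth[OF x indep(2)[OF x]] 32])
    have n1: "gg x (n x) (T 1 x) = 0" unfolding n_def
      by (rule pr_keep[OF pr_keep[OF pr_orth[OF x indep(1)[OF x]] 21] 31])
    note s = gg_sym[of x "n x"]
    have "gg x (T 2 x) (n x) = 0"
      using n1 n2 unfolding s W2_def by (simp add: pr_def gg)
    moreover have "gg x (T 3 x) (n x) = 0"
      using n1 n2 n3 unfolding s W3_def by (simp add: pr_def gg)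
    moreover have "D F x a = a $ 1 *\<^sub>R T 1 x + a $ 2 *\<^sub>R T 2 x + a $ 3 *\<^sub>R T 3 x"
    proof -
      have a: "a = a $ 1 *\<^sub>R axis 1 1 + a $ 2 *\<^sub>R axis 2 1 + a $ 3 *\<^sub>R axis 3 1"
        by (simp add: vec_eq_iff forall_3 axis_def)
      show ?thesis by (subst a) (simp add: T_def linear_add[OF lin[OF x]] linear_cmul[OF lin[OF x]])
    qed
    ultimately show ?thesis using n1 unfolding s by (simp add: gg)
  qed
  \<comment> \<open>Each projection changes a vector by a tangent one, so it can be undone within
    the tangent space: if \<open>n x0\<close> vanished, \<open>v\<close> would be tangent.\<close>
  have n0: "n x0 \<noteq> 0"
  proof
    assume "n x0 = 0"
    let ?R = "range (D F x0)"
    have R: "subspace ?R" using linear_subspace_image[OF lin[OF S(2)]] by simp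
    have TR: "T i x0 \<in> ?R" for i by (simp add: T_def)
    have prR: "pr x0 w u \<in> ?R" if "w \<in> ?R" "u \<in> ?R" for w u
      unfolding pr_def using that R by (intro subspace_diff subspace_scale)
    have unpr: "u \<in> ?R" if "pr x0 w u \<in> ?R" "w \<in> ?R" for w u
    proof -
      have "u = pr x0 w u + (gg x0 u w / gg x0 w w) *\<^sub>R w" by (simp add: pr_def)
      then show ?thesis using that R by (metis subspace_add subspace_scale)
    qed
    have "W2 x0 \<in> ?R" unfolding W2_def by (intro prR TR)
    moreover from this have "W3 x0 \<in> ?R" unfolding W3_def by (intro prR TR)
    moreover have "n x0 \<in> ?R" unfolding \<open>n x0 = 0\<close> using R by (rule subspace_0)
    ultimately have "v \<in> ?R" unfolding n_def using unpr TR by blast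
    then show False using v by simp
  qed
  define S' where "S' = {x \<in> S. n x \<noteq> 0}"
  have "S' = S \<inter> n -` (- {0})" by (auto simp: S'_def)
  then have S': "open S'" "S' \<subseteq> S" "x0 \<in> S'"
    using continuous_open_preimage[OF smooth_on_continuous[OF sm_n] S(1), of "- {0}"] n0 S(2)
    by (auto simp: S'_def)
  define N where "N x = inverse (sqrt (gg x (n x) (n x))) *\<^sub>R n x" for x
  have np: "gg x (n x) (n x) > 0" if "x \<in> S'" for x
    using gg_pos that by (auto simp: S'_def)
  have "smooth_on S' N"
    unfolding N_def
    by (intro smooth_on_scaleR smooth_on_inverse smooth_on_sqrt sm_gg S' smooth_on_subset[OF sm_n])
      (use np in force)+
  moreover have "gg x (N x) (N x) = 1" if "x \<in> S'" for x
  proof -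
    define t where "t = sqrt (gg x (n x) (n x))"
    have "t > 0" and "gg x (n x) (n x) = t * t" using np[OF that] by (simp_all add: t_def)
    then show ?thesis
      unfolding N_def t_def[symmetric] by (simp add: gg gg_sym[of x "n x" "inverse t *\<^sub>R n x"]) (simp add: field_simps)
  qed
  moreover have "gg x (N x) (D F x a) = 0" if "x \<in> S'" for x a
    using orth that by (simp add: N_def gg S'_def)
  ultimately have "unit_normal (kaehler_metric c j) F S' N"
    by (simp add: unit_normal_def gg_def)
  then show ?thesis using S' by blast
qed

text \<open>With \<open>Y\<close> the covariant derivative of \<open>v\<close>, that of
  \<open>V\<close> is \<open>b\<close> times \<open>e Y + e' v\<close> modulo \<open>z\<close>: the
  derivatives \<open>b'\<close> and \<open>k'\<close> enter only through multiples of
  \<open>z\<close>. In the application \<open>V\<close> is a normal in another lift,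
  \<open>e\<close> the relative sign and \<open>k\<close> the component along the line.\<close>

lemma hform_covariant_rescale:
  fixes z z' v v' :: "complex^3" and b b' k k' :: complex and e e' :: real
  defines "Z \<equiv> b *s z" and "Z' \<equiv> b *s z' + b' *s z"
    and "V \<equiv> (b * of_real e) *s v + k *s z"
    and "V' \<equiv> (b * of_real e) *s v' + (b * of_real e' + b' * of_real e) *s v + (k *s z' + k' *s z)"
  assumes b: "b \<noteq> 0" and n: "herm c z z \<noteq> 0" and v: "hform c z v v = 1"
  shows "hform c Z (V' - rho c Z Z' *s V - rho c Z V *s Z') V =
    of_real (e\<^sup>2) * hform c z (v' - rho c z z' *s v - rho c z v *s z') v + of_real (e * e')"
proof -
  have rz: "rho c z z = 1" using n by (simp add: rho_def)
  have rZ: "rho c Z u = rho c z u / b" for u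
    using b by (simp add: rho_def Z_def herm_scale_left herm_scale_right)
  have r1: "rho c Z Z' = rho c z z' + b' / b"
    using b unfolding rZ by (simp add: Z'_def rho_add rho_scale rz add_divide_distrib)
  have r2: "rho c Z V = of_real e * rho c z v + k / b"
    using b unfolding rZ by (simp add: V_def rho_add rho_scale rz add_divide_distrib)
  define Y where "Y = v' - rho c z z' *s v - rho c z v *s z'"
  define K where "K = k' - rho c Z Z' * k - rho c Z V * b'"
  have X: "V' - rho c Z Z' *s V - rho c Z V *s Z' = b *s (of_real e *s Y + of_real e' *s v) + K *s z"
    unfolding K_def r1 r2 using b
    by (simp add: V'_def V_def Z'_def Y_def vec_eq_iff field_simps)
  have V: "V = b *s (of_real e *s v) + k *s z" by (simp add: V_def vec_eq_iff)
  show ?thesis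
    unfolding X Y_def[symmetric] unfolding V Z_def hform_shift[OF b n]
    by (simp add: hform_add_left hform_scale_left hform_scale_right v power2_eq_square algebra_simps)
qed

lemma hom_vec_of_nth_0: "u $ j = 0 \<Longrightarrow> \<exists>M. u = hom_vec j 0 M"
proof -
  assume u: "u $ j = 0"
  define M :: "complex^2" where "M = (\<chi> k. if k = 1 then u $ (j + 1) else u $ (j + 2))"
  have "hom_vec j 0 M $ k = u $ k" for k
    using index_cases[of k j] by (elim disjE) (simp_all only: hom_vec_nth u, simp_all add: M_def)
  then show ?thesis by (metis vec_eq_iff)
qed

text \<open>Two lifts \<open>z\<close>, \<open>zt\<close> of the same curve of lines differ by a factor \<open>b\<close>, and modulo the line the two unit
  normals differ by \<open>b\<close> and a sign \<open>e\<close>. As \<open>q\<close> is quadratic in the normal, the sign drops out.\<close>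

lemma normal_form_change:
  assumes A: "hypersurface_patch c j1 S1 F1 N1" and B: "hypersurface_patch c j2 S2 F2 N2"
    and W: "open W" "y \<in> W" "W \<subseteq> S2" and \<tau>: "\<tau> ` W \<subseteq> S1" "smooth_on W \<tau>"
    and line: "\<And>w. w \<in> W \<Longrightarrow> complex_line (hom_vec j1 1 (F1 (\<tau> w))) = complex_line (hom_vec j2 1 (F2 w))"
  shows "hypersurface_patch.q c j1 F1 N1 (\<tau> y) (D \<tau> y a) = hypersurface_patch.q c j2 F2 N2 y a"
proof -
  interpret A: hypersurface_patch c j1 S1 F1 N1 by (rule A)
  interpret B: hypersurface_patch c j2 S2 F2 N2 by (rule B)
  define z where "z w = hom_vec j1 1 (F1 (\<tau> w))" for w
  define n where "n w = hom_vec j1 0 (N1 (\<tau> w))" for w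
  define zt where "zt w = hom_vec j2 1 (F2 w)" for w
  define v where "v w = hom_vec j2 0 (N2 w)" for w
  define b where "b w = z w $ j2" for w
  define k where "k w = n w $ j2" for w
  \<comment> \<open>The sign is written as an inner product, so that it is visibly differentiable;
    that its square is 1 comes out below.\<close>
  define e where "e w = Re (hform c (zt w) (inverse (b w) *s n w) (v w))" for w
  have zb: "z w = b w *s zt w" if "w \<in> W" for w
    unfolding b_def zt_def by (rule complex_line_eqE) (simp add: z_def line that)
  have b0: "b w \<noteq> 0" if "w \<in> W" for w
    using arg_cong[OF zb[OF that], of "\<lambda>u. u $ j1"] by (auto simp: z_def hom_vec_nth)
  have d\<tau>: "(\<tau> has_derivative D \<tau> w) (at w)" if "w \<in> W" for w
    using \<tau>(2) that by (rule smooth_on_has_derivative)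
  have dz: "(z has_derivative (\<lambda>a. hom_vec j1 0 (D F1 (\<tau> w) (D \<tau> w a)))) (at w)"
    and dn: "(n has_derivative (\<lambda>a. hom_vec j1 0 (D N1 (\<tau> w) (D \<tau> w a)))) (at w)"
    and dzt: "(zt has_derivative (\<lambda>a. hom_vec j2 0 (D F2 w a))) (at w)"
    and dv: "(v has_derivative (\<lambda>a. hom_vec j2 0 (D N2 w a))) (at w)" if w: "w \<in> W" for w
  proof -
    have tw: "\<tau> w \<in> S1" "w \<in> S2" using \<tau>(1) W(3) w by auto
    show "(z has_derivative (\<lambda>a. hom_vec j1 0 (D F1 (\<tau> w) (D \<tau> w a)))) (at w)"
      unfolding z_def[abs_def]
      by (rule hom_vec_has_derivative[OF has_derivative_compose[OF d\<tau>[OF w] smooth_on_has_derivative[OF A.F tw(1)]]])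
    show "(n has_derivative (\<lambda>a. hom_vec j1 0 (D N1 (\<tau> w) (D \<tau> w a)))) (at w)"
      unfolding n_def[abs_def]
      by (rule hom_vec_has_derivative[OF has_derivative_compose[OF d\<tau>[OF w] smooth_on_has_derivative[OF A.smooth_N tw(1)]]])
    show "(zt has_derivative (\<lambda>a. hom_vec j2 0 (D F2 w a))) (at w)"
      unfolding zt_def[abs_def] by (rule hom_vec_has_derivative[OF smooth_on_has_derivative[OF B.F tw(2)]])
    show "(v has_derivative (\<lambda>a. hom_vec j2 0 (D N2 w a))) (at w)"
      unfolding v_def[abs_def] by (rule hom_vec_has_derivative[OF smooth_on_has_derivative[OF B.smooth_N tw(2)]])
  qed
  have db: "(b has_derivative (\<lambda>a. hom_vec j1 0 (D F1 (\<tau> w) (D \<tau> w a)) $ j2)) (at w)"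
    and dk: "(k has_derivative (\<lambda>a. hom_vec j1 0 (D N1 (\<tau> w) (D \<tau> w a)) $ j2)) (at w)" if w: "w \<in> W" for w
    unfolding b_def[abs_def] k_def[abs_def]
    by (rule bounded_linear.has_derivative[OF bounded_linear_vec_nth dz[OF w]],
        rule bounded_linear.has_derivative[OF bounded_linear_vec_nth dn[OF w]])
  define b' where "b' w a = hom_vec j1 0 (D F1 (\<tau> w) (D \<tau> w a)) $ j2" for w a
  define k' where "k' a = hom_vec j1 0 (D N1 (\<tau> y) (D \<tau> y a)) $ j2" for a
  have z': "hom_vec j1 0 (D F1 (\<tau> w) (D \<tau> w a)) = b w *s hom_vec j2 0 (D F2 w a) + b' w a *s zt w"
    if w: "w \<in> W" for w a
  proof -
    have "(z has_derivative (\<lambda>a. b w *s hom_vec j2 0 (D F2 w a) + b' w a *s zt w)) (at w)"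
      unfolding b'_def
      by (rule has_derivative_transform_within_open[OF bounded_bilinear.FDERIV[OF
              bounded_bilinear_vector_scalar_mult db[OF w] dzt[OF w]] W(1) w]) (simp add: zb)
    from has_derivative_unique[OF dz[OF w] this] show ?thesis by meson
  qed
  have nz: "herm c (zt w) (zt w) \<noteq> 0" if "w \<in> W" for w
    unfolding zt_def using B.herm_nz W(3) that by blast
  have nv: "n w = (b w * of_real (e w)) *s v w + k w *s zt w"
    and vv: "hform c (zt w) (v w) (v w) = 1" and e1: "(e w)\<^sup>2 = 1" if w: "w \<in> W" for w
  proof -
    have tw: "\<tau> w \<in> S1" "w \<in> S2" using \<tau>(1) W(3) w by auto
    have zt_j: "zt w $ j2 = 1" by (simp add: zt_def hom_vec_nth)
    then have "(inverse (b w) *s (n w - k w *s zt w)) $ j2 = 0" by (simp add: k_def)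
    then obtain M where M: "inverse (b w) *s (n w - k w *s zt w) = hom_vec j2 0 M"
      using hom_vec_of_nth_0 by blast
    have "n w = b w *s (inverse (b w) *s (n w - k w *s zt w)) + k w *s zt w"
      using b0[OF w] by (simp add: vec_eq_iff)
    then have nM: "n w = b w *s hom_vec j2 0 M + k w *s zt w" unfolding M .
    have zw: "z w = b w *s zt w" by (rule zb[OF w])
    \<comment> \<open>By \<open>z'\<close> the two coordinate expressions have the same tangent
      vectors modulo the line, so orthogonality of \<open>N1\<close> carries over to
      \<open>M\<close>.\<close>
    have orth: "Re (B.h w M (D F2 w a)) = 0" for a
    proof -
      have "Re (A.h (\<tau> w) (N1 (\<tau> w)) (D F1 (\<tau> w) (D \<tau> w a))) = 0"
        using A.Re_h_T_N[OF tw(1)] A.h_cnj by (metis cnj.simps(1))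
      then have "Re (hform c (z w) (n w) (hom_vec j1 0 (D F1 (\<tau> w) (D \<tau> w a)))) = 0"
        by (simp add: A.h_def z_def n_def)
      then show ?thesis
        unfolding z'[OF w] nM zw hform_shift[OF b0[OF w] nz[OF w]] by (simp add: B.h_def zt_def)
    qed
    \<comment> \<open>These three vectors span the real tangent space, so what is orthogonal to them
      is a real multiple of \<open>N2 w\<close>.\<close>
    have "Re (B.h w M (B.E w)) = 0" "Re (B.h w M (\<i> *s B.E w)) = 0" "Re (B.h w M (- (\<i> *s N2 w))) = 0"
      using orth[of "B.frame_vec w 1 0"] orth[of "B.frame_vec w \<i> 0"] orth[of "B.frame_vec w 0 1"]
      by (simp_all add: B.T_vec[OF tw(2)] B.h_simps)
    then have "B.h w M (B.E w) = 0" "Im (B.h w M (N2 w)) = 0"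
      by (simp_all add: B.h_simps complex_eq_iff)
    then have "M = of_real (Re (B.h w M (N2 w))) *s N2 w"
      using B.frame_expansion[OF tw(2), of M] by (simp add: complex_eq_iff complex_of_real_def vec_eq_iff)
    moreover have "B.h w M (N2 w) = hform c (zt w) (inverse (b w) *s n w) (v w)"
    proof -
      have "hom_vec j2 0 M = inverse (b w) *s n w - (inverse (b w) * k w) *s zt w"
        unfolding M[symmetric] by (simp add: vec_eq_iff algebra_simps)
      then show ?thesis
        by (simp add: B.h_def zt_def[symmetric] v_def[symmetric] hform_diff_left hform_scale_left hform_base[OF nz[OF w]])
    qed
    ultimately have Me: "hom_vec j2 0 M = of_real (e w) *s v w"
      by (metis e_def hom_vec_scale v_def)
    show "n w = (b w * of_real (e w)) *s v w + k w *s zt w"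
      using nM unfolding Me by (simp add: vec_eq_iff)
    show vv: "hform c (zt w) (v w) (v w) = 1"
      using B.h_N_N[OF tw(2)] by (simp add: B.h_def zt_def v_def)
    have "hform c (z w) (n w) (n w) = 1"
      using A.h_N_N[OF tw(1)] by (simp add: A.h_def z_def n_def)
    then have "of_real ((e w)\<^sup>2) = (1 :: complex)"
      unfolding nM zw hform_shift[OF b0[OF w] nz[OF w]] Me
      by (simp add: hform_scale_left hform_scale_right vv power2_eq_square)
    then show "(e w)\<^sup>2 = 1" by (metis of_real_eq_1_iff)
  qed
  \<comment> \<open>The mere existence of a derivative is enough: \<open>e'\<close> enters only
    through the real summand \<open>e y * e' a\<close>, which the imaginary part in \<open>q\<close>
    discards.\<close>
  have "\<exists>e'. (e has_derivative e') (at y)"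
    unfolding e_def[abs_def]
    by (rule exI, rule bounded_linear.has_derivative[OF bounded_linear_Re], rule hform_has_derivative[OF dzt[OF W(2)]
        bounded_bilinear.FDERIV[OF bounded_bilinear_vector_scalar_mult Deriv.has_derivative_inverse[OF b0[OF W(2)] db[OF W(2)]]
          dn[OF W(2)]] dv[OF W(2)] nz[OF W(2)]])
  then obtain e' where de: "(e has_derivative e') (at y)" by blast
  have n': "hom_vec j1 0 (D N1 (\<tau> y) (D \<tau> y a)) =
      (b y * of_real (e y)) *s hom_vec j2 0 (D N2 y a) + (b y * of_real (e' a) + b' y a * of_real (e y)) *s v y
      + (k y *s hom_vec j2 0 (D F2 y a) + k' a *s zt y)"
  proof -
    have "(n has_derivative (\<lambda>a. (b y * of_real (e y)) *s hom_vec j2 0 (D N2 y a)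
        + (b y * of_real (e' a) + b' y a * of_real (e y)) *s v y
        + (k y *s hom_vec j2 0 (D F2 y a) + k' a *s zt y))) (at y)"
      unfolding b'_def k'_def
      by (rule has_derivative_transform_within_open[OF has_derivative_add[OF bounded_bilinear.FDERIV[OF
              bounded_bilinear_vector_scalar_mult has_derivative_mult[OF db[OF W(2)]
                bounded_linear.has_derivative[OF bounded_linear_of_real de]] dv[OF W(2)]]
            bounded_bilinear.FDERIV[OF bounded_bilinear_vector_scalar_mult dk[OF W(2)] dzt[OF W(2)]]] W(1,2)])
        (simp add: nv)
    from has_derivative_unique[OF dn[OF W(2)] this] show ?thesis by meson
  qed
  have "A.h (\<tau> y) (A.cov (D \<tau> y a) N1 (\<tau> y)) (N1 (\<tau> y)) =
      hform c (z y) (hom_vec j1 0 (D N1 (\<tau> y) (D \<tau> y a)) -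
        rho c (z y) (hom_vec j1 0 (D F1 (\<tau> y) (D \<tau> y a))) *s n y -
        rho c (z y) (n y) *s hom_vec j1 0 (D F1 (\<tau> y) (D \<tau> y a))) (n y)"
    by (simp add: A.h_def A.cov_def A.con_def hom_vec_diff hom_vec_scale z_def n_def)
  also have "\<dots> = of_real ((e y)\<^sup>2) * B.h y (B.cov a N2 y) (N2 y) + of_real (e y * e' a)"
    unfolding z'[OF W(2)] n' nv[OF W(2)] zb[OF W(2)] hform_covariant_rescale[OF b0[OF W(2)] nz[OF W(2)] vv[OF W(2)]]
    by (simp add: B.h_def B.cov_def B.con_def hom_vec_diff hom_vec_scale zt_def v_def)
  finally have "A.q (\<tau> y) (D \<tau> y a) = (e y)\<^sup>2 * B.q y a"
    by (simp add: A.q_def B.q_def)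
  then show ?thesis using e1[OF W(2)] by simp
qed

section \<open>The global argument\<close>

locale xi_parallel_hypersurface =
  fixes c :: real and \<A> :: "('m, real^3) atlas" and f :: "'m \<Rightarrow> (complex^3) set"
  assumes c: "c = 4 \<or> c = -4" and hyp: "real_hypersurface c \<A> f"
    and par: "star_ricci_xi_parallel c \<A> f"
begin

abbreviation expr :: "'m set \<Rightarrow> ('m \<Rightarrow> real^3) \<Rightarrow> 3 \<Rightarrow> real^3 \<Rightarrow> complex^2" where
  "expr U u j \<equiv> chart j \<circ> f \<circ> inv_into U u"

text \<open>\<open>local_data\<close> with its chart and index as explicit parameters, so that two
  patches around the same point can be compared.\<close>

definition patch :: "'m set \<Rightarrow> ('m \<Rightarrow> real^3) \<Rightarrow> 3 \<Rightarrow> (real^3) set \<Rightarrow> (real^3 \<Rightarrow> complex^2) \<Rightarrow> bool" where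
  "patch U u j S N \<longleftrightarrow> (U, u) \<in> \<A> \<and> open S \<and> S \<subseteq> u ` (U \<inter> f -` chart_dom c j) \<and>
     unit_normal (kaehler_metric c j) (expr U u j) S N"

lemma local_data_iff:
  "local_data c \<A> f S G F N \<longleftrightarrow>
    (\<exists>U u j. patch U u j S N \<and> G = kaehler_metric c j \<and> F = expr U u j)"
  unfolding local_data_def patch_def by blast

lemma compatible: "compatible_atlas \<A>"
  using hyp smooth_manifold_compatible by (auto simp: real_hypersurface_def)

lemma inj_chart: "(U, u) \<in> \<A> \<Longrightarrow> inj_on u U"
  using compatible by (auto simp: compatible_atlas_def)

lemma expr_props:
  assumes U: "(U, u) \<in> \<A>"
  shows "open (u ` (U \<inter> f -` chart_dom c j))" "smooth_on (u ` (U \<inter> f -` chart_dom c j)) (expr U u j)"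
    and "x \<in> u ` (U \<inter> f -` chart_dom c j) \<Longrightarrow> inj (D (expr U u j) x)"
    and "x \<in> u ` (U \<inter> f -` chart_dom c j) \<Longrightarrow>
      c * Re (herm c (hom_vec j 1 (expr U u j x)) (hom_vec j 1 (expr U u j x))) > 0"
proof -
  have cm: "continuous_map (atlas_topology \<A>) (atlas_topology (space_form_atlas c)) f"
    and sm: "\<And>V v. (V, v) \<in> space_form_atlas c \<Longrightarrow> smooth_on (u ` (U \<inter> f -` V)) (v \<circ> f \<circ> inv_into U u)"
    using hyp U by (auto simp: real_hypersurface_def smooth_map_def)
  have "openin (atlas_topology \<A>) {x \<in> points \<A>. f x \<in> chart_dom c j}"
    using openin_continuous_map_preimage[OF cm openin_chart_dom] by (simp add: topspace_atlas_topology[OF compatible])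
  then have "open (u ` ({x \<in> points \<A>. f x \<in> chart_dom c j} \<inter> U))"
    using U unfolding openin_atlas_topology[OF compatible] by blast
  moreover have "{x \<in> points \<A>. f x \<in> chart_dom c j} \<inter> U = U \<inter> f -` chart_dom c j"
    using chart_subset_points[OF U] by blast
  ultimately show "open (u ` (U \<inter> f -` chart_dom c j))" by simp
  show "smooth_on (u ` (U \<inter> f -` chart_dom c j)) (expr U u j)"
    by (rule sm) (simp add: space_form_atlas_def)
  show "inj (D (expr U u j) x)" if "x \<in> u ` (U \<inter> f -` chart_dom c j)"
    using hyp U that by (auto simp: real_hypersurface_def)
  show "c * Re (herm c (hom_vec j 1 (expr U u j x)) (hom_vec j 1 (expr U u j x))) > 0"
    if "x \<in> u ` (U \<inter> f -` chart_dom c j)"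
    using chart_domD(2) that inj_chart[OF U] by (auto simp: inv_into_f_f)
qed

lemma parallel:
  assumes "patch U u j S N" "smooth_on S X" "x \<in> S"
  shows "nabla (induced_metric (kaehler_metric c j) (expr U u j)) (xi (expr U u j) N x)
      (\<lambda>y. star_ricci_op (kaehler_metric c j) (expr U u j) N y (X y)) x =
    star_ricci_op (kaehler_metric c j) (expr U u j) N x
      (nabla (induced_metric (kaehler_metric c j) (expr U u j)) (xi (expr U u j) N x) X x)"
proof -
  have "local_data c \<A> f S (kaehler_metric c j) (expr U u j) N"
    using assms(1) local_data_iff by blast
  then show ?thesis using par assms(2,3) unfolding star_ricci_xi_parallel_def by blast
qed

lemma patch_hopf:
  assumes "patch U u j S N" shows "hopf_patch c j S (expr U u j) N"
proof -
  have U: "(U, u) \<in> \<A>" and S: "open S" "S \<subseteq> u ` (U \<inter> f -` chart_dom c j)"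
    and N: "unit_normal (kaehler_metric c j) (expr U u j) S N"
    using assms by (auto simp: patch_def)
  interpret hypersurface_patch c j S "expr U u j" N
  proof
    show "smooth_on S (expr U u j)" by (rule smooth_on_subset[OF expr_props(2)[OF U] S(2)])
    show "inj (D (expr U u j) x)" if "x \<in> S" for x
      using that S(2) by (intro expr_props(3)[OF U]) auto
    show "c * Re (herm c (hom_vec j 1 (expr U u j x)) (hom_vec j 1 (expr U u j x))) > 0" if "x \<in> S" for x
      using that S(2) by (intro expr_props(4)[OF U]) auto
  qed (fact c S(1) N)+
  show ?thesis
  proof
    fix x assume x: "x \<in> S"
    show "s x = 0"
      by (rule xi_parallel_imp(1)[OF x parallel[OF assms _ x]])
  qed
qed

lemma patch_kap:
  assumes "patch U u j S N" "x \<in> S"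
  shows "D (hypersurface_patch.kap c j (expr U u j) N) x (xi (expr U u j) N x) = 0"
proof -
  interpret hopf_patch c j S "expr U u j" N by (rule patch_hopf[OF assms(1)])
  show ?thesis
    by (rule xi_parallel_imp(2)[OF assms(2) parallel[OF assms(1) _ assms(2)]])
qed

definition hopf_curv :: "'m set \<Rightarrow> ('m \<Rightarrow> real^3) \<Rightarrow> 3 \<Rightarrow> (real^3 \<Rightarrow> complex^2) \<Rightarrow> real^3 \<Rightarrow> real" where
  "hopf_curv U u j N = hypersurface_patch.al c j (expr U u j) N"

lemma hopf: "hopf c \<A> f"
  unfolding hopf_def
proof (intro allI impI ballI)
  fix S G F N x assume "local_data c \<A> f S G F N" and x: "x \<in> S"
  then obtain U u j where p: "patch U u j S N" and eq: "G = kaehler_metric c j" "F = expr U u j"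
    by (auto simp: local_data_iff)
  interpret hopf_patch c j S "expr U u j" N by (rule patch_hopf[OF p])
  have "shape (kaehler_metric c j) (expr U u j) N x (xi (expr U u j) N x) = al x *\<^sub>R xi (expr U u j) N x"
    unfolding shape_xi[OF x] by (simp add: s0[OF x] xi_eq[OF x] frame_vec_def)
  then show "\<exists>\<alpha>. shape G F N x (xi F N x) = \<alpha> *\<^sub>R xi F N x" unfolding eq by blast
qed

lemma shape_xi_hopf_curv:
  assumes "patch U u j S N" "x \<in> S" "hopf_curv U u j N x = 0"
  shows "shape (kaehler_metric c j) (expr U u j) N x (xi (expr U u j) N x) = 0"
proof -
  interpret hopf_patch c j S "expr U u j" N by (rule patch_hopf[OF assms(1)])
  show ?thesis
    using assms(3) unfolding shape_xi[OF assms(2)] by (simp add: s0[OF assms(2)] hopf_curv_def frame_vec_def)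
qed

section \<open>The zero set of the Hopf curvature\<close>

lemma open_hopf_curv:
  assumes "patch U u j S N"
  shows "open {x \<in> S. hopf_curv U u j N x \<noteq> 0}" "open {x \<in> S. hopf_curv U u j N x = 0}"
proof -
  interpret hopf_patch c j S "expr U u j" N by (rule patch_hopf[OF assms])
  have "{x \<in> S. al x \<noteq> 0} = S \<inter> al -` (- {0})" by auto
  then show "open {x \<in> S. hopf_curv U u j N x \<noteq> 0}"
    using continuous_open_preimage[OF smooth_on_continuous[OF smooth_scalars(4)] S, of "- {0}"]
    by (simp add: hopf_curv_def open_Compl)
  \<comment> \<open>\<open>D_al_0\<close> makes \<open>al\<close> constant on balls, so a zero is
    surrounded by zeros.\<close>
  show "open {x \<in> S. hopf_curv U u j N x = 0}"
    unfolding open_contains_ball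
  proof safe
    fix x assume x: "x \<in> S" "hopf_curv U u j N x = 0"
    obtain r where r: "r > 0" "ball x r \<subseteq> S" using S x(1) open_contains_ball by blast
    have "\<exists>k. \<forall>y\<in>ball x r. al y = k"
    proof (rule has_derivative_zero_constant)
      fix y assume "y \<in> ball x r"
      then have y: "y \<in> S" using r by blast
      have "(al has_derivative D al y) (at y)" using smooth_scalars(4) y by (rule smooth_on_has_derivative)
      then have "(al has_derivative (\<lambda>h. 0)) (at y)" by (simp add: D_al_0[OF y])
      then show "(al has_derivative (\<lambda>h. 0)) (at y within ball x r)" by (rule has_derivative_at_withinI)
    qed simp
    then have "al y = 0" if "y \<in> ball x r" for y
      using that r(1) x(2) unfolding hopf_curv_def by (metis centre_in_ball)
    then show "\<exists>e>0. ball x e \<subseteq> {x \<in> S. hopf_curv U u j N x = 0}"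
      using r by (auto simp: hopf_curv_def)
  qed
qed

text \<open>\<open>al\<close> changes sign with the unit normal and only its vanishing is invariant.
  It amounts to the vanishing of the one-form \<open>q = al et\<close>, which
  \<open>normal_form_change\<close> transports along the transition map
  \<open>\<tau>\<close>.\<close>

lemma hopf_curv_change:
  assumes A: "patch U u i S N" and B: "patch V v j S' N'"
    and m: "m \<in> U" "u m \<in> S" "m \<in> V" "v m \<in> S'" and z: "hopf_curv U u i N (u m) = 0"
  shows "hopf_curv V v j N' (v m) = 0"
proof -
  interpret A: hopf_patch c i S "expr U u i" N by (rule patch_hopf[OF A])
  interpret B: hopf_patch c j S' "expr V v j" N' by (rule patch_hopf[OF B])
  have UV: "(U, u) \<in> \<A>" "(V, v) \<in> \<A>" and sub: "S \<subseteq> u ` (U \<inter> f -` chart_dom c i)" "S' \<subseteq> v ` (V \<inter> f -` chart_dom c j)"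
    using A B by (auto simp: patch_def)
  note inj = inj_chart[OF UV(1)] inj_chart[OF UV(2)]
  define \<tau> where "\<tau> = u \<circ> inv_into V v"
  have op: "open (v ` (V \<inter> U))" and sm: "smooth_on (v ` (V \<inter> U)) \<tau>"
    using compatible UV by (auto simp: compatible_atlas_def \<tau>_def)
  define W where "W = S' \<inter> (v ` (V \<inter> U) \<inter> \<tau> -` S)"
  have W: "open W" unfolding W_def
    by (intro open_Int B.S continuous_open_preimage[OF smooth_on_continuous[OF sm] op A.S])
  have \<tau>m: "\<tau> (v m) = u m" using inj m by (simp add: \<tau>_def)
  have vm: "v m \<in> W" using m \<tau>m by (auto simp: W_def)
  have line: "complex_line (hom_vec i 1 (expr U u i (\<tau> w))) = complex_line (hom_vec j 1 (expr V v j w))"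
    if w: "w \<in> W" for w
  proof -
    obtain p where p: "p \<in> V" "p \<in> U" "w = v p" using w by (auto simp: W_def)
    have "\<tau> w = u p" using inj p by (simp add: \<tau>_def)
    moreover have "f p \<in> chart_dom c i"
      using w sub(1) inj(1) p \<open>\<tau> w = u p\<close> by (auto simp: W_def inj_on_def)
    moreover have "f p \<in> chart_dom c j"
      using w sub(2) inj(2) p by (auto simp: W_def inj_on_def)
    ultimately show ?thesis
      using chart_domD(1)[of "f p" c i] chart_domD(1)[of "f p" c j] inj p by simp
  qed
  have "hypersurface_patch.q c i (expr U u i) N (\<tau> (v m)) (D \<tau> (v m) a) = B.q (v m) a" for a
    by (rule normal_form_change[OF A.hypersurface_patch_axioms B.hypersurface_patch_axioms W vm _ _
          smooth_on_subset[OF sm] line])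
      (auto simp: W_def)
  moreover have "A.q (u m) a = 0" for a
    using A.q_hopf[OF m(2)] z by (simp add: hopf_curv_def)
  ultimately show ?thesis
    unfolding \<tau>m by (simp add: hopf_curv_def B.al_def)
qed

lemma exists_patch:
  assumes "m \<in> points \<A>" shows "\<exists>U u j S N. patch U u j S N \<and> m \<in> U \<and> u m \<in> S"
proof -
  obtain U u where U: "(U, u) \<in> \<A>" "m \<in> U" using assms by (force simp: points_def)
  have "f m \<in> points (space_form_atlas c)"
    using hyp assms continuous_map_image_subset_topspace
    unfolding real_hypersurface_def smooth_map_def
    by (metis (no_types, lifting) compatible compatible_space_form_atlas image_subset_iff topspace_atlas_topology)
  then obtain j where "f m \<in> chart_dom c j" by (auto simp: points_def space_form_atlas_def)
  then have um: "u m \<in> u ` (U \<inter> f -` chart_dom c j)" using U by blast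
  from exists_unit_normal[OF c expr_props(1)[OF U(1)] um expr_props(2-4)[OF U(1)]]
  obtain S N where "open S" "u m \<in> S" "S \<subseteq> u ` (U \<inter> f -` chart_dom c j)"
    "unit_normal (kaehler_metric c j) (expr U u j) S N" by blast
  then show ?thesis using U unfolding patch_def by blast
qed

lemma hopf_curv_dichotomy:
  "(\<forall>U u j S N. patch U u j S N \<longrightarrow> (\<forall>x\<in>S. hopf_curv U u j N x = 0)) \<or>
   (\<forall>U u j S N. patch U u j S N \<longrightarrow> (\<forall>x\<in>S. hopf_curv U u j N x \<noteq> 0))"
proof -
  \<comment> \<open>Membership refers to some patch around the point;
    \<open>hopf_curv_change\<close> makes the two sets disjoint, so the choice of the patch does not
    matter.\<close>
  define M where "M b = {m. \<exists>U u j S N. patch U u j S N \<and> m \<in> U \<and> u m \<in> S \<and> (hopf_curv U u j N (u m) = 0) = b}" for b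
  have MI: "m \<in> M b" if "patch U u j S N" "m \<in> U" "u m \<in> S" "(hopf_curv U u j N (u m) = 0) = b" for m b U u j S N
    unfolding M_def using that by blast
  have ME: "\<exists>U u j S N. patch U u j S N \<and> m \<in> U \<and> u m \<in> S \<and> (hopf_curv U u j N (u m) = 0) = b"
    if "m \<in> M b" for m b
    using that unfolding M_def by (rule CollectD)
  have "openin (atlas_topology \<A>) (M b)" for b
  proof (subst openin_subopen, safe)
    fix m assume "m \<in> M b"
    then obtain U u j S N where p: "patch U u j S N" and m: "m \<in> U" "u m \<in> S" "(hopf_curv U u j N (u m) = 0) = b"
      by (auto simp: M_def)
    define S' where "S' = {x \<in> S. (hopf_curv U u j N x = 0) = b}"
    have "open S'" using open_hopf_curv[OF p] by (cases b) (simp_all add: S'_def)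
    moreover have "(U, u) \<in> \<A>" "S' \<subseteq> u ` U" using p by (auto simp: S'_def patch_def)
    ultimately have "openin (atlas_topology \<A>) {m \<in> U. u m \<in> S'}"
      using openin_chart_preimage[OF compatible] by blast
    moreover have "m \<in> {m \<in> U. u m \<in> S'}" using m by (simp add: S'_def)
    moreover have "{m \<in> U. u m \<in> S'} \<subseteq> M b" by (auto intro!: MI[OF p] simp: S'_def)
    ultimately show "\<exists>T. openin (atlas_topology \<A>) T \<and> m \<in> T \<and> T \<subseteq> M b" by blast
  qed
  moreover have "topspace (atlas_topology \<A>) \<subseteq> M True \<union> M False"
  proof
    fix m assume "m \<in> topspace (atlas_topology \<A>)"
    then obtain U u j S N where p: "patch U u j S N" "m \<in> U" "u m \<in> S"
      using exists_patch unfolding topspace_atlas_topology[OF compatible] by blast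
    have "m \<in> M (hopf_curv U u j N (u m) = 0)" by (rule MI[OF p refl])
    then show "m \<in> M True \<union> M False" by (cases "hopf_curv U u j N (u m) = 0") simp_all
  qed
  moreover have "M True \<inter> M False = {}"
  proof (rule ccontr)
    assume "M True \<inter> M False \<noteq> {}"
    then obtain m where "m \<in> M True" "m \<in> M False" by blast
    from ME[OF this(1)] obtain U u i S N where 1: "patch U u i S N" "m \<in> U" "u m \<in> S" "hopf_curv U u i N (u m) = 0"
      by auto
    from ME[OF \<open>m \<in> M False\<close>] obtain V v j S' N' where 2: "patch V v j S' N'" "m \<in> V" "v m \<in> S'" "hopf_curv V v j N' (v m) \<noteq> 0"
      by auto
    show False using hopf_curv_change[OF 1(1) 2(1) 1(2,3) 2(2,3) 1(4)] 2(4) by simp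
  qed
  moreover have "connected_space (atlas_topology \<A>)" using hyp by (simp add: real_hypersurface_def)
  ultimately consider "M True = {}" | "M False = {}"
    unfolding connected_space_def by metis
  \<comment> \<open>Every point of a patch is the image of a point of the manifold, so an empty
    \<open>M b\<close> excludes the case \<open>b\<close> on all patches.\<close>
  moreover have in_M: "\<exists>m. m \<in> M (hopf_curv U u j N x = 0)" if p: "patch U u j S N" and x: "x \<in> S" for U u j S N x
  proof -
    obtain m where m: "m \<in> U" "x = u m" using p x by (auto simp: patch_def)
    then show ?thesis using MI[OF p m(1)] x by blast
  qed
  ultimately show ?thesis
  proof cases
    case 1
    then have "hopf_curv U u j N x \<noteq> 0" if "patch U u j S N" "x \<in> S" for U u j S N x
      using in_M[OF that] by (cases "hopf_curv U u j N x = 0") auto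
    then show ?thesis by blast
  next
    case 2
    then have "hopf_curv U u j N x = 0" if "patch U u j S N" "x \<in> S" for U u j S N x
      using in_M[OF that] by (cases "hopf_curv U u j N x = 0") auto
    then show ?thesis by blast
  qed
qed

lemma shape_xi_zero_or_curvatures_constant:
  "shape_xi_zero c \<A> f \<or> hol_curvatures_xi_constant c \<A> f"
  using hopf_curv_dichotomy
proof
  assume *: "\<forall>U u j S N. patch U u j S N \<longrightarrow> (\<forall>x\<in>S. hopf_curv U u j N x = 0)"
  have "shape_xi_zero c \<A> f"
    unfolding shape_xi_zero_def local_data_iff using * shape_xi_hopf_curv by blast
  then show ?thesis by blast
next
  assume *: "\<forall>U u j S N. patch U u j S N \<longrightarrow> (\<forall>x\<in>S. hopf_curv U u j N x \<noteq> 0)"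
  have "constant_along S (xi (expr U u j) N) \<mu> \<and> constant_along S (xi (expr U u j) N) \<nu>"
    if p: "patch U u j S N" and pp: "principal_pair (kaehler_metric c j) (expr U u j) N S \<mu> \<nu>" for U u j S N \<mu> \<nu>
  proof -
    interpret hopf_patch c j S "expr U u j" N by (rule patch_hopf[OF p])
    show ?thesis
      by (rule hol_curvatures_constant[OF _ patch_kap[OF p] pp]) (use * p hopf_curv_def in auto)
  qed
  then have "hol_curvatures_xi_constant c \<A> f"
    unfolding hol_curvatures_xi_constant_def local_data_iff by blast
  then show ?thesis by blast
qed

end

theorem theorem1p4:
  fixes c :: real
    and \<A> :: "('m, real^3) atlas"
    and f :: "'m \<Rightarrow> (complex^3) set"
  assumes "c = 4 \<or> c = -4"
    and "real_hypersurface c \<A> f"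
    and "star_ricci_xi_parallel c \<A> f"
  shows "hopf c \<A> f \<and>
    ((\<exists>\<B>. type_A c \<B> \<and> locally_congruent c \<A> f \<B> id) \<or>
     (\<exists>(\<B> :: ('m, real^3) atlas) f'. real_hypersurface c \<B> f' \<and> hopf c \<B> f' \<and>
        shape_xi_zero c \<B> f' \<and> locally_congruent c \<A> f \<B> f') \<or>
     (\<exists>(\<B> :: ('m, real^3) atlas) f'. real_hypersurface c \<B> f' \<and> hopf c \<B> f' \<and>
        hol_curvatures_xi_constant c \<B> f' \<and> locally_congruent c \<A> f \<B> f'))"
proof -
  interpret xi_parallel_hypersurface c \<A> f
    using assms by unfold_locales
  \<comment> \<open>The hypersurface itself is the witness for \<open>\<B>\<close> and
    \<open>f'\<close>, congruent to itself by the identity.\<close>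
  show ?thesis
    using hopf assms(2) shape_xi_zero_or_curvatures_constant locally_congruent_self[OF c compatible] by blast
qed

end
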